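(* Let $\mathfrak g=\mathfrak o_N$ with $N=2n+1$ or $N=2n$. The Segal--Sugawara vectors $$\phi_{mm}=\gamma_m(N)\operatorname{tr}_{1,\dots,m}S^{(m)}(T+F[-1]_1)\cdots(T+F[-1]_m)\,1\in U(t^{-1}\mathfrak o_N[t^{-1}])$$ can be written in the form $$\phi_{mm}=\sum_{l=1}^{\lfloor m/2\rfloor}\binom{N+m-2}{m-2l}\,\varpi\big(T^{m-2l}\Phi_{2l}[-1]\big)\,1$$ for $m\geqslant1$.
   Context: Put $i'=N-i+1$. $\mathfrak o_N\subset\mathfrak{gl}_N$ is spanned over $\mathbb C$ by $F_{ij}=E_{ij}-E_{j'i'}$; $X[r]:=Xt^r$. $T=-d/dt$ is a derivation of $t^{-1}\mathfrak g[t^{-1}]$, and we use the Lie algebra $\mathbb CT\oplus t^{-1}\mathfrak g[t^{-1}]$ with $[T,X[r]]=-rX[r-1]$. For $Y$ in its enveloping algebra, $Y1\in U(t^{-1}\mathfrak g[t^{-1}])$ is obtained by moving all $T$ to the right and using $T1=0$. With $e_{ij}$ the matrix units of $\operatorname{End}\mathbb C^N$, set $F[r]_a=\sum_{i,j}1^{\otimes(a-1)}\otimes e_{ij}\otimes1^{\otimes(m-a)}\otimes F_{ij}[r]$. The trace is over all $m$ copies of $\operatorname{End}\mathbb C^N$. Symmetrizer. An $m$-diagram is a perfect matching (set of $m$ edges) on $2m$ dots arranged in a top and a bottom row of $m$ dots, each row labelled $1,\dots,m$; an edge is horizontal if it joins two dots of the same row. The Brauer algebra $\mathcal B_m(\omega)$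 has basis the $m$-diagrams; the product $dd'$ is obtained by placing $d$ under $d'$, identifying the adjacent rows, and equals $\omega^s$ times the resulting diagram with its $s$ closed loops removed. With $\mathcal D^{(r)}$ the set of diagrams having exactly $r$ horizontal edges in the top row, $$s^{(m)}=\frac1{m!}\sum_{r=0}^{\lfloor m/2\rfloor}(-1)^r\binom{\omega/2+m-2}{r}^{-1}\sum_{d\in\mathcal D^{(r)}}d,\qquad \gamma_m(\omega)=\frac{\omega+m-2}{\omega+2m-2}.$$ For $a<b$ let $s_{ab}$ be the diagram of the transposition $(a\,b)$, and $\epsilon_{ab}$ the diagram with horizontal edges joining dots $a,b$ in each row and vertical edges otherwise; these generate the algebra. For $\omega=N$ the algebra acts on $(\mathbb C^N)^{\otimes m}$ by $s_{ab}\mapsto P_{ab}$, $\epsilon_{ab}\mapsto Q_{ab}$, where $P_{ab}$ permutes the tensor factors $a$ and $b$, and $Q_{ab}=\sum_{i,j}1^{\otimes(a-1)}\otimes e_{ij}\otimes1^{\otimes(b-a-1)}\otimes e_{i'j'}\otimes1^{\otimes(m-b)}$. $S^{(m)}$ is the image of $s^{(m)}$ (with $\omega=N$). The symmetrization map $\varpi:S(\mathfrak a)\to U(\mathfrak a)$ is $x_1\cdots x_p\mapsto\frac1{p!}\sum_{\sigma\in\mathfrak S_p}x_{\sigma(1)}\cdots x_{\sigma(p)}$, applied with $\mathfrak a=\mathbb CT\oplus t^{-1}\mathfrak g[t^{-1}]$. For $S\in S(\mathfrak g)$, $S[-1]$ is its image under the embedding $S(\mathfrak g)\hookrightarrow S(t^{-1}\mathfrak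 g[t^{-1}])$, $X\mapsto X[-1]$. With $F=[F_{ij}]$ a matrix over $S(\mathfrak o_N)$, the elements $\Phi_{2l}$ are defined by $\det(1-qF)^{-1}=1+\sum_{l=1}^\infty\Phi_{2l}q^{2l}$. *)

theory Defs
  imports
    Complex_Main
    "HOL-Library.Poly_Mapping"
    "HOL-Library.Cardinality"
    "HOL-Library.Multiset"
    "HOL-Library.FuncSet"
    "HOL-Combinatorics.Permutations"
    "HOL-Computational_Algebra.Formal_Power_Series"
    "Jordan_Normal_Form.Determinant"
begin

section \<open>Complex vector spaces, associative algebras and Lie algebras\<close>

class cscale =
  fixes cscale :: "complex \<Rightarrow> 'a \<Rightarrow> 'a"  (infixr "*\<^sub>C" 75)

class complex_vector = cscale + ab_group_add +
  assumes cscale_add_right: "c *\<^sub>C (x + y) = c *\<^sub>C x + c *\<^sub>C y"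
    and cscale_add_left: "(c + d) *\<^sub>C x = c *\<^sub>C x + d *\<^sub>C x"
    and cscale_cscale [simp]: "c *\<^sub>C d *\<^sub>C x = (c * d) *\<^sub>C x"
    and cscale_one [simp]: "1 *\<^sub>C x = x"

class complex_algebra = complex_vector + ring_1 +
  assumes cscale_mult_left [simp]: "(c *\<^sub>C x) * y = c *\<^sub>C (x * y)"
    and cscale_mult_right [simp]: "x * (c *\<^sub>C y) = c *\<^sub>C (x * y)"

class complex_lie = complex_vector +
  fixes lie :: "'a \<Rightarrow> 'a \<Rightarrow> 'a"
  assumes lie_add_left: "lie (x + y) z = lie x z + lie y z"
    and lie_add_right: "lie x (y + z) = lie x y + lie x z"
    and lie_cscale_left: "lie (c *\<^sub>C x) y = c *\<^sub>C lie x y"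
    and lie_cscale_right: "lie x (c *\<^sub>C y) = c *\<^sub>C lie x y"
    and lie_self [simp]: "lie x x = 0"
    and lie_jacobi: "lie x (lie y z) + lie y (lie z x) + lie z (lie x y) = 0"

lemma cscale_zero_right [simp]: "c *\<^sub>C (0::'a::complex_vector) = 0"
  using cscale_add_right[of c 0 "0::'a"] by simp

lemma cscale_zero_left [simp]: "0 *\<^sub>C (x::'a::complex_vector) = 0"
  using cscale_add_left[of 0 0 x] by simp

lemma cscale_minus_right [simp]: "c *\<^sub>C (- x) = - (c *\<^sub>C (x::'a::complex_vector))"
  using cscale_add_right[of c x "-x"] by (simp add: eq_neg_iff_add_eq_0 add.commute)

lemma cscale_minus_left [simp]: "(- c) *\<^sub>C x = - (c *\<^sub>C (x::'a::complex_vector))"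
  using cscale_add_left[of c "-c" x] by (simp add: eq_neg_iff_add_eq_0 add.commute)

lemma cscale_diff_right: "c *\<^sub>C (x - y) = c *\<^sub>C x - c *\<^sub>C (y::'a::complex_vector)"
  using cscale_add_right[of c x "-y"] by simp

lemma cscale_sum_right: "c *\<^sub>C (\<Sum>i\<in>A. f i) = (\<Sum>i\<in>A. c *\<^sub>C (f i :: 'a::complex_vector))"
  by (induction A rule: infinite_finite_induct) (auto simp: cscale_add_right)

lemma cscale_left_commute: "c *\<^sub>C d *\<^sub>C (x::'a::complex_vector) = d *\<^sub>C c *\<^sub>C x"
  by (simp add: mult.commute)

lemma lie_zero_left [simp]: "lie (0::'a::complex_lie) x = 0"
  using lie_add_left[of 0 0 x] by simp

lemma lie_zero_right [simp]: "lie x (0::'a::complex_lie) = 0"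
  using lie_add_right[of x 0 0] by simp

lemma lie_skew: "lie x y = - lie y (x::'a::complex_lie)"
proof -
  have "lie (x + y) (x + y) = 0" by simp
  then show ?thesis by (simp only: lie_add_left lie_add_right) (simp add: eq_neg_iff_add_eq_0 add.commute)
qed

lemma lie_minus_right [simp]: "lie x (- y) = - lie x (y::'a::complex_lie)"
  using lie_add_right[of x y "-y"] by (simp add: eq_neg_iff_add_eq_0 add.commute)

lemma lie_diff_right: "lie x (y - z) = lie x y - lie x (z::'a::complex_lie)"
  using lie_add_right[of x y "-z"] by simp

instantiation complex :: complex_algebra
begin
definition cscale_complex :: "complex \<Rightarrow> complex \<Rightarrow> complex"
  where "cscale_complex c x = c * x"
instance by standard (auto simp: cscale_complex_def algebra_simps)
end

instantiation poly_mapping :: (type, complex_vector) complex_vector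
begin
lift_definition cscale_poly_mapping :: "complex \<Rightarrow> ('a \<Rightarrow>\<^sub>0 'b) \<Rightarrow> ('a \<Rightarrow>\<^sub>0 'b)"
  is "\<lambda>c f k. c *\<^sub>C f k"
  by (erule rev_finite_subset) auto
instance
  by standard (transfer; simp add: fun_eq_iff cscale_add_right cscale_add_left)+
end

lemma lookup_cscale [simp]: "Poly_Mapping.lookup (c *\<^sub>C p) k = c *\<^sub>C Poly_Mapping.lookup p k"
  by transfer simp

lemma cscale_single [simp]: "c *\<^sub>C Poly_Mapping.single k x = Poly_Mapping.single k (c *\<^sub>C x)"
  by (rule poly_mapping_eqI) (simp add: lookup_single when_def)

definition addext :: "('k \<Rightarrow> 'b::zero \<Rightarrow> 'c::comm_monoid_add) \<Rightarrow> ('k \<Rightarrow>\<^sub>0 'b) \<Rightarrow> 'c"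
  where "addext h p = (\<Sum>k\<in>Poly_Mapping.keys p. h k (Poly_Mapping.lookup p k))"

definition linext :: "('k \<Rightarrow> 'c::complex_vector) \<Rightarrow> ('k \<Rightarrow>\<^sub>0 complex) \<Rightarrow> 'c"
  where "linext f = addext (\<lambda>k c. c *\<^sub>C f k)"

lemma addext_superset:
  assumes "\<And>k. h k 0 = 0" "finite A" "Poly_Mapping.keys p \<subseteq> A"
  shows "addext h p = (\<Sum>k\<in>A. h k (Poly_Mapping.lookup p k))"
  unfolding addext_def
  by (rule sum.mono_neutral_left) (use assms in \<open>auto simp: in_keys_iff\<close>)

lemma addext_add:
  assumes "\<And>k. h k 0 = 0" "\<And>k x y. h k (x + y) = h k x + h k y"
  shows "addext h (p + q) = addext h p + addext h q"
proof -
  let ?A = "Poly_Mapping.keys p \<union> Poly_Mapping.keys q"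
  have "addext h (p + q) = (\<Sum>k\<in>?A. h k (Poly_Mapping.lookup (p + q) k))"
    by (rule addext_superset) (use assms(1) keys_add[of p q] in auto)
  also have "\<dots> = (\<Sum>k\<in>?A. h k (Poly_Mapping.lookup p k)) + (\<Sum>k\<in>?A. h k (Poly_Mapping.lookup q k))"
    by (simp add: lookup_add assms(2) sum.distrib)
  also have "\<dots> = addext h p + addext h q"
    using addext_superset[of h ?A p] addext_superset[of h ?A q] assms(1) by auto
  finally show ?thesis .
qed

lemma addext_zero [simp]: "addext h 0 = 0"
  by (simp add: addext_def)

lemma addext_single:
  assumes "h k 0 = 0"
  shows "addext h (Poly_Mapping.single k x) = h k x"
  using assms by (cases "x = 0") (auto simp: addext_def)

lemma pm_induct [case_names zero single add]:
  assumes "P 0" "\<And>k c. P (Poly_Mapping.single k c)" "\<And>p q. P p \<Longrightarrow> P q \<Longrightarrow> P (p + q)"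
  shows "P (p :: 'k \<Rightarrow>\<^sub>0 'b::comm_monoid_add)"
proof -
  have "P (\<Sum>k\<in>A. Poly_Mapping.single k (Poly_Mapping.lookup p k))" if "finite A" for A
    using that by induction (use assms in auto)
  moreover have "p = (\<Sum>k\<in>Poly_Mapping.keys p. Poly_Mapping.single k (Poly_Mapping.lookup p k))"
    by (rule poly_mapping_eqI)
      (auto simp: lookup_sum lookup_single when_def in_keys_iff sum.delta)
  ultimately show ?thesis by (metis finite_keys)
qed

instance poly_mapping :: (monoid_add, complex_algebra) complex_algebra
proof
  fix c :: complex and x y :: "'a \<Rightarrow>\<^sub>0 'b"
  have *: "(c *\<^sub>C Poly_Mapping.single k a) * z = c *\<^sub>C (Poly_Mapping.single k a * z)"
    for k a and z :: "'a \<Rightarrow>\<^sub>0 'b"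
    by (induction z rule: pm_induct) (simp_all add: distrib_left cscale_add_right mult_single)
  show "(c *\<^sub>C x) * y = c *\<^sub>C (x * y)"
    by (induction x rule: pm_induct) (simp_all only: * distrib_right cscale_add_right mult_zero_left cscale_zero_right)
  have *: "z * (c *\<^sub>C Poly_Mapping.single k a) = c *\<^sub>C (z * Poly_Mapping.single k a)"
    for k a and z :: "'a \<Rightarrow>\<^sub>0 'b"
    by (induction z rule: pm_induct) (simp_all add: distrib_right cscale_add_right mult_single)
  show "x * (c *\<^sub>C y) = c *\<^sub>C (x * y)"
    by (induction y rule: pm_induct) (simp_all only: * distrib_left cscale_add_right mult_zero_right cscale_zero_right)
qed

lemma linext_zero [simp]: "linext f 0 = 0"
  by (simp add: linext_def)

lemma linext_single [simp]: "linext f (Poly_Mapping.single k c) = c *\<^sub>C f k"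
  by (simp add: linext_def addext_single)

lemma linext_add: "linext f (p + q) = linext f p + linext f q"
  unfolding linext_def by (rule addext_add) (simp_all add: cscale_add_left)

lemma linext_cscale: "linext f (c *\<^sub>C p) = c *\<^sub>C linext f p"
  by (induction p rule: pm_induct) (simp_all add: linext_add cscale_add_right cscale_complex_def)

lemma linext_uminus: "linext f (- p) = - linext f p"
  using linext_add[of f p "-p"] by (simp add: eq_neg_iff_add_eq_0 add.commute)

lemma linext_diff: "linext f (p - q) = linext f p - linext f q"
  using linext_add[of f p "-q"] by (simp add: linext_uminus)


section \<open>Universal enveloping algebras and symmetric algebras\<close>

text \<open>The two-sided ideal of all finite sums of elements \<open>a r b\<close> with \<open>r \<in> R\<close>.\<close>

inductive_set ideal_gen :: "'r::ring_1 set \<Rightarrow> 'r set" for R where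
  zero: "0 \<in> ideal_gen R"
| add_gen: "r \<in> R \<Longrightarrow> p \<in> ideal_gen R \<Longrightarrow> a * r * b + p \<in> ideal_gen R"

lemma ideal_gen_gen: "r \<in> R \<Longrightarrow> r \<in> ideal_gen R"
  using ideal_gen.add_gen[of r R 0 1 1] ideal_gen.zero[of R] by simp

lemma ideal_gen_add: "p \<in> ideal_gen R \<Longrightarrow> q \<in> ideal_gen R \<Longrightarrow> p + q \<in> ideal_gen R"
  by (induction rule: ideal_gen.induct) (auto simp: add.assoc intro: ideal_gen.intros)

lemma ideal_gen_mult:
  assumes "p \<in> ideal_gen R"
  shows "x * p * y \<in> ideal_gen R"
  using assms
proof induction
  case (add_gen r p a b)
  have "x * (a * r * b + p) * y = (x * a) * r * (b * y) + x * p * y"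
    by (simp add: algebra_simps)
  then show ?case using add_gen by (auto intro: ideal_gen.intros)
qed (auto intro: ideal_gen.intros)

lemma ideal_gen_uminus: "p \<in> ideal_gen R \<Longrightarrow> - p \<in> ideal_gen R"
  using ideal_gen_mult[of p R "-1" 1] by simp

lemma equivp_ideal: "equivp (\<lambda>p q. p - q \<in> ideal_gen R)"
proof (rule equivpI)
  show "reflp (\<lambda>p q. p - q \<in> ideal_gen R)" by (auto simp: reflp_def ideal_gen.zero)
  show "symp (\<lambda>p q. p - q \<in> ideal_gen R)"
    using ideal_gen_uminus[where R = R] by (fastforce simp: symp_def)
  show "transp (\<lambda>p q. p - q \<in> ideal_gen R)"
    unfolding transp_def
    by (metis (no_types, lifting) ideal_gen_add add_diff_eq diff_add_cancel)
qed

lemma ideal_gen_mult_cong: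
  assumes "p - p' \<in> ideal_gen R" "q - q' \<in> ideal_gen R"
  shows "p * q - p' * q' \<in> ideal_gen R"
proof -
  have "p * q - p' * q' = 1 * (p - p') * q + p' * (q - q') * 1" by (simp add: algebra_simps)
  also have "\<dots> \<in> ideal_gen R" using assms by (intro ideal_gen_add ideal_gen_mult)
  finally show ?thesis .
qed

text \<open>Words form a monoid under concatenation, so that \<^typ>\<open>'a list \<Rightarrow>\<^sub>0 complex\<close> is the free
  associative unital algebra on the set \<^typ>\<open>'a\<close>, while \<^typ>\<open>'a multiset \<Rightarrow>\<^sub>0 complex\<close> is the
  polynomial algebra on that set.\<close>

instantiation list :: (type) monoid_add
begin
definition zero_list :: "'a list" where "zero_list = []"
definition plus_list :: "'a list \<Rightarrow> 'a list \<Rightarrow> 'a list" where "plus_list = (@)"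
instance by standard (auto simp: zero_list_def plus_list_def)
end

abbreviation word :: "'a list \<Rightarrow> ('a list \<Rightarrow>\<^sub>0 complex)"
  where "word w \<equiv> Poly_Mapping.single w 1"

abbreviation monomial :: "'a multiset \<Rightarrow> ('a multiset \<Rightarrow>\<^sub>0 complex)"
  where "monomial M \<equiv> Poly_Mapping.single M 1"

inductive_set uea_relators :: "('a::complex_lie list \<Rightarrow>\<^sub>0 complex) set" where
  "word [x + y] - word [x] - word [y] \<in> uea_relators"
| "word [c *\<^sub>C x] - c *\<^sub>C word [x] \<in> uea_relators"
| "word [x] * word [y] - word [y] * word [x] - word [lie x y] \<in> uea_relators"

quotient_type (overloaded) 'a uea =
  "'a::complex_lie list \<Rightarrow>\<^sub>0 complex" / "\<lambda>p q. p - q \<in> ideal_gen uea_relators"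
  by (rule equivp_ideal)

inductive_set sym_relators :: "('a::complex_vector multiset \<Rightarrow>\<^sub>0 complex) set" where
  "monomial {#x + y#} - monomial {#x#} - monomial {#y#} \<in> sym_relators"
| "monomial {#c *\<^sub>C x#} - c *\<^sub>C monomial {#x#} \<in> sym_relators"

quotient_type (overloaded) 'a sym =
  "'a::complex_vector multiset \<Rightarrow>\<^sub>0 complex" / "\<lambda>p q. p - q \<in> ideal_gen sym_relators"
  by (rule equivp_ideal)

lemma ideal_gen_diff_add:
  "p - p' \<in> ideal_gen R \<Longrightarrow> q - q' \<in> ideal_gen R \<Longrightarrow> (p + q) - (p' + q') \<in> ideal_gen R"
  using ideal_gen_add[of "p - p'" R "q - q'"] by (simp add: algebra_simps)

lemma ideal_gen_diff_diff:
  "p - p' \<in> ideal_gen R \<Longrightarrow> q - q' \<in> ideal_gen R \<Longrightarrow> (p - q) - (p' - q') \<in> ideal_gen R"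
  using ideal_gen_add[OF _ ideal_gen_uminus, of "p - p'" R "q - q'"] by (simp add: algebra_simps)

lemma ideal_gen_diff_uminus:
  "p - p' \<in> ideal_gen R \<Longrightarrow> (- p) - (- p') \<in> ideal_gen R"
  using ideal_gen_uminus[of "p - p'" R] by (simp add: algebra_simps)

lemma ideal_gen_diff_cscale:
  fixes p :: "'r::complex_algebra"
  assumes "p - p' \<in> ideal_gen R"
  shows "(c *\<^sub>C p) - (c *\<^sub>C p') \<in> ideal_gen R"
  using ideal_gen_mult[OF assms, of "c *\<^sub>C 1" 1] by (simp add: cscale_diff_right)


text \<open>The coefficient of the empty word (or monomial) is multiplicative; hence the quotients are
  nontrivial.\<close>

lemma lookup_zero_mult:
  fixes p q :: "'k::monoid_add \<Rightarrow>\<^sub>0 complex"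
  assumes "\<And>a b::'k. a + b = 0 \<longleftrightarrow> a = 0 \<and> b = 0"
  shows "Poly_Mapping.lookup (p * q) 0 = Poly_Mapping.lookup p 0 * Poly_Mapping.lookup q 0"
proof (induction p rule: pm_induct)
  case (single k c)
  show ?case
    by (induction q rule: pm_induct)
      (auto simp: lookup_add lookup_single when_def mult_single assms distrib_left)
qed (auto simp: lookup_add distrib_right)

lemma lookup_zero_ideal:
  fixes p :: "'k::monoid_add \<Rightarrow>\<^sub>0 complex"
  assumes "p \<in> ideal_gen R" "\<And>r. r \<in> R \<Longrightarrow> Poly_Mapping.lookup r 0 = 0"
    and "\<And>a b::'k. a + b = 0 \<longleftrightarrow> a = 0 \<and> b = 0"
  shows "Poly_Mapping.lookup p 0 = 0"
  using assms(1)
  by induction (auto simp: lookup_add lookup_zero_mult[OF assms(3)] assms(2))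

instantiation uea :: (complex_lie) complex_algebra
begin
lift_definition zero_uea :: "'a uea" is 0 .
lift_definition one_uea :: "'a uea" is 1 .
lift_definition plus_uea :: "'a uea \<Rightarrow> 'a uea \<Rightarrow> 'a uea" is "(+)" by (rule ideal_gen_diff_add)
lift_definition minus_uea :: "'a uea \<Rightarrow> 'a uea \<Rightarrow> 'a uea" is "(-)" by (rule ideal_gen_diff_diff)
lift_definition uminus_uea :: "'a uea \<Rightarrow> 'a uea" is uminus by (rule ideal_gen_diff_uminus)
lift_definition times_uea :: "'a uea \<Rightarrow> 'a uea \<Rightarrow> 'a uea" is "(*)" by (rule ideal_gen_mult_cong)
lift_definition cscale_uea :: "complex \<Rightarrow> 'a uea \<Rightarrow> 'a uea" is cscale by (rule ideal_gen_diff_cscale)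

instance
proof
  show "(0::'a uea) \<noteq> 1"
  proof (transfer, rule notI)
    assume "(0::'a list \<Rightarrow>\<^sub>0 complex) - 1 \<in> ideal_gen uea_relators"
    then have "Poly_Mapping.lookup ((0::'a list \<Rightarrow>\<^sub>0 complex) - 1) 0 = 0"
    proof (rule lookup_zero_ideal)
      fix r :: "'a list \<Rightarrow>\<^sub>0 complex" assume "r \<in> uea_relators"
      then show "Poly_Mapping.lookup r 0 = 0"
        by cases (auto simp: lookup_minus lookup_single when_def mult_single plus_list_def zero_list_def)
    qed (auto simp: zero_list_def plus_list_def)
    then show False by (simp add: lookup_minus)
  qed
qed (transfer; simp add: algebra_simps cscale_add_left cscale_add_right ideal_gen.zero)+
end

instantiation sym :: (complex_vector) "{complex_algebra, comm_ring_1}"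
begin
lift_definition zero_sym :: "'a sym" is 0 .
lift_definition one_sym :: "'a sym" is 1 .
lift_definition plus_sym :: "'a sym \<Rightarrow> 'a sym \<Rightarrow> 'a sym" is "(+)" by (rule ideal_gen_diff_add)
lift_definition minus_sym :: "'a sym \<Rightarrow> 'a sym \<Rightarrow> 'a sym" is "(-)" by (rule ideal_gen_diff_diff)
lift_definition uminus_sym :: "'a sym \<Rightarrow> 'a sym" is uminus by (rule ideal_gen_diff_uminus)
lift_definition times_sym :: "'a sym \<Rightarrow> 'a sym \<Rightarrow> 'a sym" is "(*)" by (rule ideal_gen_mult_cong)
lift_definition cscale_sym :: "complex \<Rightarrow> 'a sym \<Rightarrow> 'a sym" is cscale by (rule ideal_gen_diff_cscale)
instance
proof
  show "(0::'a sym) \<noteq> 1"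
  proof (transfer, rule notI)
    assume "(0::'a multiset \<Rightarrow>\<^sub>0 complex) - 1 \<in> ideal_gen sym_relators"
    then have "Poly_Mapping.lookup ((0::'a multiset \<Rightarrow>\<^sub>0 complex) - 1) 0 = 0"
    proof (rule lookup_zero_ideal)
      fix r :: "'a multiset \<Rightarrow>\<^sub>0 complex" assume "r \<in> sym_relators"
      then show "Poly_Mapping.lookup r 0 = 0"
        by cases (auto simp: lookup_minus lookup_single when_def)
    qed auto
    then show False by (simp add: lookup_minus)
  qed
qed (transfer; simp add: algebra_simps cscale_add_left cscale_add_right ideal_gen.zero)+
end

lift_definition uea_gen :: "'a::complex_lie \<Rightarrow> 'a uea" is "\<lambda>x. word [x]" .

lift_definition sym_gen :: "'a::complex_vector \<Rightarrow> 'a sym" is "\<lambda>x. monomial {#x#}" .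

lemma uea_eq_iff: "abs_uea p = abs_uea q \<longleftrightarrow> p - q \<in> ideal_gen uea_relators"
  by (rule uea.abs_eq_iff)

lemma uea_gen_add: "uea_gen (x + y) = uea_gen x + uea_gen y"
  by transfer (use ideal_gen_gen[OF uea_relators.intros(1)] in \<open>simp add: algebra_simps\<close>)

lemma uea_gen_cscale: "uea_gen (c *\<^sub>C x) = c *\<^sub>C uea_gen x"
  by transfer (simp only: ideal_gen_gen[OF uea_relators.intros(2)])

lemma uea_gen_lie: "uea_gen (lie x y) = uea_gen x * uea_gen y - uea_gen y * uea_gen x"
  by transfer (use ideal_gen_uminus[OF ideal_gen_gen[OF uea_relators.intros(3)]]
      in \<open>simp only: minus_diff_eq\<close>)

lemma sym_gen_add: "sym_gen (x + y) = sym_gen x + sym_gen y"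
  by transfer (use ideal_gen_gen[OF sym_relators.intros(1)] in \<open>simp add: algebra_simps\<close>)

lemma sym_gen_cscale: "sym_gen (c *\<^sub>C x) = c *\<^sub>C sym_gen x"
  by transfer (simp only: ideal_gen_gen[OF sym_relators.intros(2)])


lemma linext_mult:
  fixes f :: "'k::monoid_add \<Rightarrow> 'b::complex_algebra"
  assumes "\<And>a b. f (a + b) = f a * f b"
  shows "linext f (p * q) = linext f p * linext f q"
proof (induction p rule: pm_induct)
  case (single k c)
  show ?case
    by (induction q rule: pm_induct)
      (auto simp: linext_add mult_single assms distrib_left mult.commute)
qed (auto simp: linext_add distrib_right)

lemma linext_sandwich_zero:
  fixes f :: "'k::monoid_add \<Rightarrow> 'b::complex_vector"
  assumes "\<And>k l. linext f (Poly_Mapping.single k 1 * r * Poly_Mapping.single l 1) = 0"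
  shows "linext f (a * r * b) = 0"
proof (induction a rule: pm_induct)
  case (single k c)
  show ?case
  proof (induction b rule: pm_induct)
    case (single l d)
    have "Poly_Mapping.single k c * r * Poly_Mapping.single l d =
      c *\<^sub>C d *\<^sub>C (Poly_Mapping.single k 1 * r * Poly_Mapping.single l 1)"
    proof -
      have "Poly_Mapping.single j e = e *\<^sub>C Poly_Mapping.single j 1" for j :: 'k and e :: complex
        by (simp add: cscale_complex_def)
      then show ?thesis
        by (metis cscale_mult_left cscale_mult_right)
    qed
    then show ?case by (simp only: linext_cscale assms cscale_zero_right)
  qed (auto simp: linext_add distrib_left)
qed (auto simp: linext_add distrib_right)

lemma linext_ideal_zero:
  assumes "p \<in> ideal_gen R" "\<And>r a b. r \<in> R \<Longrightarrow> linext f (a * r * b) = 0"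
  shows "linext f p = 0"
  using assms(1) by induction (auto simp: linext_add assms(2))

lemma uea_word: "abs_uea (word w) = prod_list (map uea_gen w)"
proof (induction w)
  case Nil
  then show ?case
    by (metis list.simps(8) one_uea.abs_eq prod_list.Nil single_one zero_list_def)
next
  case (Cons x w)
  have "word (x # w) = word [x] * word w"
    by (simp add: mult_single plus_list_def)
  then show ?case
    using Cons by (simp add: times_uea.abs_eq[symmetric] uea_gen.abs_eq)
qed

lemma abs_uea_linext: "abs_uea p = linext (\<lambda>w. prod_list (map uea_gen w)) p"
proof (induction p rule: pm_induct)
  case zero
  then show ?case by (simp add: zero_uea.abs_eq[symmetric])
next
  case (single k c)
  have "Poly_Mapping.single k c = c *\<^sub>C word k" by (simp add: cscale_complex_def)
  then have "abs_uea (Poly_Mapping.single k c) = c *\<^sub>C abs_uea (word k)"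
    by (simp only: cscale_uea.abs_eq)
  then show ?case by (simp add: uea_word)
next
  case (add p q)
  then show ?case by (simp add: plus_uea.abs_eq[symmetric] linext_add)
qed

lemma uea_induct [case_names zero cscale_word add]:
  assumes "P 0" "\<And>c w. P (c *\<^sub>C prod_list (map uea_gen w))"
    and "\<And>p q. P p \<Longrightarrow> P q \<Longrightarrow> P (p + q)"
  shows "P u"
proof -
  have "P (abs_uea p)" for p
    by (induction p rule: pm_induct)
      (use assms in \<open>simp_all add: abs_uea_linext linext_add\<close>)
  then show ?thesis by (induction u rule: uea.abs_induct)
qed

lemma sym_monomial: "abs_sym (monomial (mset xs)) = prod_list (map sym_gen xs)"
proof (induction xs)
  case Nil
  then show ?case
    by (metis list.simps(8) mset.simps(1) one_sym.abs_eq prod_list.Nil single_one)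
next
  case (Cons x xs)
  have "monomial (mset (x # xs)) = monomial {#x#} * monomial (mset xs)"
    by (simp add: mult_single)
  then show ?case
    using Cons by (simp add: times_sym.abs_eq[symmetric] sym_gen.abs_eq)
qed

text \<open>The symmetrization map \<open>\<varpi> : S(\<aa>) \<rightarrow> U(\<aa>)\<close>.\<close>

definition symmetrized_product :: "'a::complex_lie list \<Rightarrow> 'a uea" where
  "symmetrized_product xs = (1 / fact (length xs)) *\<^sub>C
     (\<Sum>\<sigma> | \<sigma> permutes {..<length xs}.
        prod_list (map (\<lambda>k. uea_gen (xs ! \<sigma> k)) [0..<length xs]))"

lemma symmetrized_product_cong:
  assumes "mset xs = mset ys"
  shows "symmetrized_product xs = symmetrized_product ys"
proof -
  obtain \<pi> where \<pi>: "\<pi> permutes {..<length ys}" "permute_list \<pi> ys = xs"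
    using assms mset_eq_permutation by blast
  have len: "length xs = length ys" using assms by (metis size_mset)
  have xs: "xs ! k = ys ! \<pi> k" if "k < length ys" for k
    using \<pi> that permute_list_nth by blast
  have "(\<Sum>\<sigma> | \<sigma> permutes {..<length ys}. prod_list (map (\<lambda>k. uea_gen (xs ! \<sigma> k)) [0..<length ys]))
    = (\<Sum>\<sigma> | \<sigma> permutes {..<length ys}. prod_list (map (\<lambda>k. uea_gen (ys ! (\<pi> \<circ> \<sigma>) k)) [0..<length ys]))"
  proof (rule sum.cong, goal_cases)
    case (2 \<sigma>)
    then have "\<sigma> k < length ys" if "k < length ys" for k
      using that permutes_in_image[of \<sigma> "{..<length ys}" k] by auto
    then show ?case by (auto intro!: arg_cong[of _ _ prod_list] simp: xs)
  qed auto
  also have "\<dots> = (\<Sum>\<sigma> | \<sigma> permutes {..<length ys}. prod_list (map (\<lambda>k. uea_gen (ys ! \<sigma> k)) [0..<length ys]))"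
    by (rule setum_permutations_compose_left[OF \<pi>(1), symmetric])
  finally show ?thesis by (simp add: symmetrized_product_def len)
qed

lemma symmetrized_product_linear:
  assumes "\<sigma> permutes {..<length (x # cs)}"
  shows "\<exists>P Q. \<forall>z. prod_list (map (\<lambda>k. uea_gen ((z # cs) ! \<sigma> k)) [0..<length (x # cs)])
            = P * uea_gen z * (Q :: 'a::complex_lie uea)"
proof -
  define n where "n = length (x # cs)"
  have \<sigma>: "\<sigma> permutes {..<n}" using assms by (simp add: n_def)
  obtain k where k0: "\<sigma> k = 0" using permutes_surj[OF \<sigma>] by (metis surjD)
  have k: "\<sigma> k = 0" "k < n"
    using k0 permutes_in_image[OF \<sigma>, of k] by (auto simp: n_def)
  have ne: "\<sigma> j \<noteq> 0" if "j \<noteq> k" for j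
    using that k permutes_inj[OF \<sigma>] by (metis injD)
  have split: "[0..<n] = [0..<k] @ k # [Suc k..<n]"
    using k(2) using upt_add_eq_append[of 0 k "n - k"] by (simp add: upt_conv_Cons)
  let ?g = "\<lambda>j. uea_gen (cs ! (\<sigma> j - 1))"
  have "prod_list (map (\<lambda>k. uea_gen ((z # cs) ! \<sigma> k)) [0..<n])
      = prod_list (map ?g [0..<k]) * uea_gen z * prod_list (map ?g [Suc k..<n])" for z
  proof -
    have 1: "map (\<lambda>k. uea_gen ((z # cs) ! \<sigma> k)) [0..<k] = map ?g [0..<k]"
    proof (rule map_cong[OF refl])
      fix j assume "j \<in> set [0..<k]"
      then have "\<sigma> j \<noteq> 0" by (intro ne) auto
      then show "uea_gen ((z # cs) ! \<sigma> j) = ?g j" by (simp add: nth_Cons')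
    qed
    have 2: "map (\<lambda>k. uea_gen ((z # cs) ! \<sigma> k)) [Suc k..<n] = map ?g [Suc k..<n]"
    proof (rule map_cong[OF refl])
      fix j assume "j \<in> set [Suc k..<n]"
      then have "\<sigma> j \<noteq> 0" by (intro ne) auto
      then show "uea_gen ((z # cs) ! \<sigma> j) = ?g j" by (simp add: nth_Cons')
    qed
    show ?thesis
      unfolding split map_append list.map prod_list.append prod_list.Cons 1 2
      by (simp add: k(1) mult.assoc)
  qed
  then show ?thesis unfolding n_def by blast
qed

lemma symmetrized_product_add:
  "symmetrized_product ((x + y) # cs) = symmetrized_product (x # cs) + symmetrized_product (y # cs)"
proof -
  have "(\<Sum>\<sigma> | \<sigma> permutes {..<Suc (length cs)}. prod_list (map (\<lambda>k. uea_gen (((x + y) # cs) ! \<sigma> k)) [0..<Suc (length cs)]))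
    = (\<Sum>\<sigma> | \<sigma> permutes {..<Suc (length cs)}. prod_list (map (\<lambda>k. uea_gen ((x # cs) ! \<sigma> k)) [0..<Suc (length cs)])
        + prod_list (map (\<lambda>k. uea_gen ((y # cs) ! \<sigma> k)) [0..<Suc (length cs)]))"
  proof (rule sum.cong, goal_cases)
    case (2 \<sigma>)
    then obtain P Q where "\<And>z. prod_list (map (\<lambda>k. uea_gen ((z # cs) ! \<sigma> k)) [0..<Suc (length cs)])
            = P * uea_gen z * Q"
      using symmetrized_product_linear[of \<sigma> x cs] by auto
    then show ?case by (simp only: uea_gen_add distrib_left distrib_right)
  qed auto
  then show ?thesis
    by (simp add: symmetrized_product_def sum.distrib cscale_add_right del: upt_Suc)
qed

lemma symmetrized_product_cscale:
  "symmetrized_product ((c *\<^sub>C x) # cs) = c *\<^sub>C symmetrized_product (x # cs)"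
proof -
  have "(\<Sum>\<sigma> | \<sigma> permutes {..<Suc (length cs)}. prod_list (map (\<lambda>k. uea_gen (((c *\<^sub>C x) # cs) ! \<sigma> k)) [0..<Suc (length cs)]))
    = (\<Sum>\<sigma> | \<sigma> permutes {..<Suc (length cs)}. c *\<^sub>C prod_list (map (\<lambda>k. uea_gen ((x # cs) ! \<sigma> k)) [0..<Suc (length cs)]))"
  proof (rule sum.cong, goal_cases)
    case (2 \<sigma>)
    then obtain P Q where "\<And>z. prod_list (map (\<lambda>k. uea_gen ((z # cs) ! \<sigma> k)) [0..<Suc (length cs)])
            = P * uea_gen z * Q"
      using symmetrized_product_linear[of \<sigma> x cs] by auto
    then show ?case by (simp only: uea_gen_cscale cscale_mult_left cscale_mult_right)
  qed auto
  then show ?thesis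
    by (simp add: symmetrized_product_def cscale_sum_right[symmetric] mult.commute del: upt_Suc)
qed

definition symmetrized_monomial :: "'a::complex_lie multiset \<Rightarrow> 'a uea" where
  "symmetrized_monomial M = symmetrized_product (SOME xs. mset xs = M)"

lemma symmetrized_monomial_mset: "symmetrized_monomial (mset xs) = symmetrized_product xs"
  unfolding symmetrized_monomial_def
  by (rule symmetrized_product_cong, rule someI[of "\<lambda>ys. mset ys = mset xs"]) simp

lemma symmetrized_monomial_add_mset:
  "symmetrized_monomial (add_mset (x + y) M) = symmetrized_monomial (add_mset x M) + symmetrized_monomial (add_mset y M)"
  "symmetrized_monomial (add_mset (c *\<^sub>C x) M) = c *\<^sub>C symmetrized_monomial (add_mset x M)"
proof -
  obtain cs where "M = mset cs" by (metis ex_mset)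
  then have *: "symmetrized_monomial (add_mset z M) = symmetrized_product (z # cs)" for z
    using symmetrized_monomial_mset[of "z # cs"] by simp
  show "symmetrized_monomial (add_mset (x + y) M) = symmetrized_monomial (add_mset x M) + symmetrized_monomial (add_mset y M)"
    "symmetrized_monomial (add_mset (c *\<^sub>C x) M) = c *\<^sub>C symmetrized_monomial (add_mset x M)"
    by (simp_all only: * symmetrized_product_add symmetrized_product_cscale)
qed

lift_definition symmetrization :: "'a::complex_lie sym \<Rightarrow> 'a uea" is
  "linext symmetrized_monomial"
proof -
  fix p q :: "'a multiset \<Rightarrow>\<^sub>0 complex"
  assume "p - q \<in> ideal_gen sym_relators"
  then have "linext symmetrized_monomial (p - q) = 0"
  proof (rule linext_ideal_zero)
    fix r a b :: "'a multiset \<Rightarrow>\<^sub>0 complex"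
    assume "r \<in> sym_relators"
    then have "linext symmetrized_monomial (monomial k * r * monomial l) = 0" for k l
      by cases
        (simp_all add: right_diff_distrib left_diff_distrib mult_single linext_diff
          cscale_complex_def symmetrized_monomial_add_mset)
    then show "linext symmetrized_monomial (a * r * b) = 0"
      by (rule linext_sandwich_zero)
  qed
  then show "linext symmetrized_monomial p = linext symmetrized_monomial q"
    by (simp add: linext_diff)
qed

lemma symmetrization_prod_list:
  "symmetrization (prod_list (map sym_gen xs)) = symmetrized_product xs"
  by (simp add: sym_monomial[symmetric] symmetrization.abs_eq symmetrized_monomial_mset)


section \<open>The orthogonal Lie algebra\<close>

text \<open>Matrices over \<open>\<complex>\<close> of size \<open>N\<close> are functions of two indices in \<open>1, \<dots>, N\<close>, extended by zero.\<close>

definition matrix_unit :: "nat \<Rightarrow> nat \<Rightarrow> nat \<Rightarrow> nat \<Rightarrow> complex" where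
  "matrix_unit i j k l = (if k = i \<and> l = j then 1 else 0)"

definition reflect :: "nat \<Rightarrow> nat \<Rightarrow> nat" where
  "reflect N i = N - i + 1"

definition so_matrix :: "nat \<Rightarrow> nat \<Rightarrow> nat \<Rightarrow> nat \<Rightarrow> nat \<Rightarrow> complex" where
  "so_matrix N i j k l = matrix_unit i j k l - matrix_unit (reflect N j) (reflect N i) k l"

definition so_carrier :: "nat \<Rightarrow> (nat \<Rightarrow> nat \<Rightarrow> complex) set" where
  "so_carrier N = range (\<lambda>c k l. \<Sum>i=1..N. \<Sum>j=1..N. c i j * so_matrix N i j k l)"

definition commutator :: "nat \<Rightarrow> (nat \<Rightarrow> nat \<Rightarrow> complex) \<Rightarrow> (nat \<Rightarrow> nat \<Rightarrow> complex) \<Rightarrow> nat \<Rightarrow> nat \<Rightarrow> complex" where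
  "commutator N A B k l = (\<Sum>p=1..N. A k p * B p l) - (\<Sum>p=1..N. B k p * A p l)"

lemma reflect_in: "i \<in> {1..N} \<Longrightarrow> reflect N i \<in> {1..N}"
  by (auto simp: reflect_def)

lemma reflect_reflect: "i \<in> {1..N} \<Longrightarrow> reflect N (reflect N i) = i"
  by (auto simp: reflect_def)

lemma bij_reflect: "bij_betw (reflect N) {1..N} {1..N}"
  by (rule bij_betwI[of _ _ _ "reflect N"]) (auto simp: reflect_def)

lemma so_matrix_outside:
  assumes "i \<in> {1..N}" "j \<in> {1..N}" "\<not> (k \<in> {1..N} \<and> l \<in> {1..N})"
  shows "so_matrix N i j k l = 0"
proof -
  have "\<not> (k = i \<and> l = j)" using assms by blast
  then have 1: "matrix_unit i j k l = 0" unfolding matrix_unit_def by (rule if_not_P)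
  have "\<not> (k = reflect N j \<and> l = reflect N i)" using assms reflect_in by blast
  then have 2: "matrix_unit (reflect N j) (reflect N i) k l = 0"
    unfolding matrix_unit_def by (rule if_not_P)
  show ?thesis by (simp only: so_matrix_def 1 2 diff_zero)
qed

lemma so_carrier_iff:
  "A \<in> so_carrier N \<longleftrightarrow>
     (\<forall>k l. \<not> (k \<in> {1..N} \<and> l \<in> {1..N}) \<longrightarrow> A k l = 0) \<and>
     (\<forall>k\<in>{1..N}. \<forall>l\<in>{1..N}. A (reflect N l) (reflect N k) = - A k l)"
  (is "_ \<longleftrightarrow> ?supp \<and> ?skew")
proof
  assume "A \<in> so_carrier N"
  then obtain c where A: "A = (\<lambda>k l. \<Sum>i=1..N. \<Sum>j=1..N. c i j * so_matrix N i j k l)"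
    unfolding so_carrier_def by (rule imageE)
  have c: "A k l = (\<Sum>i=1..N. \<Sum>j=1..N. c i j * so_matrix N i j k l)" for k l
    by (simp only: A)
  have ?supp
  proof (intro allI impI)
    fix k l assume kl: "\<not> (k \<in> {1..N} \<and> l \<in> {1..N})"
    show "A k l = 0" unfolding c
      by (intro sum.neutral ballI) (simp only: so_matrix_outside[OF _ _ kl] mult_zero_right)
  qed
  moreover have ?skew
  proof (intro ballI)
    fix k l assume kl: "k \<in> {1..N}" "l \<in> {1..N}"
    have "so_matrix N i j (reflect N l) (reflect N k) = - so_matrix N i j k l"
      if "i \<in> {1..N}" "j \<in> {1..N}" for i j
    proof -
      have "reflect N l = i \<longleftrightarrow> l = reflect N i" "reflect N k = j \<longleftrightarrow> k = reflect N j"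
        "reflect N l = reflect N j \<longleftrightarrow> l = j" "reflect N k = reflect N i \<longleftrightarrow> k = i"
        using kl that reflect_reflect by metis+
      then show ?thesis unfolding so_matrix_def matrix_unit_def by (simp add: conj_commute)
    qed
    then show "A (reflect N l) (reflect N k) = - A k l"
      unfolding c sum_negf[symmetric] by (intro sum.cong) simp_all
  qed
  ultimately show "?supp \<and> ?skew" by blast
next
  assume A: "?supp \<and> ?skew"
  have *: "A k l = (\<Sum>i=1..N. \<Sum>j=1..N. A i j / 2 * so_matrix N i j k l)" for k l
  proof (cases "k \<in> {1..N} \<and> l \<in> {1..N}")
    case True
    have 1: "(\<Sum>i=1..N. \<Sum>j=1..N. A i j / 2 * matrix_unit i j k l) = A k l / 2"
    proof -
      have "(\<Sum>i=1..N. \<Sum>j=1..N. A i j / 2 * matrix_unit i j k l)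
          = (\<Sum>i=1..N. \<Sum>j=1..N. if j = l then (if i = k then A k l / 2 else 0) else 0)"
        by (intro sum.cong) (auto simp: matrix_unit_def)
      also have "\<dots> = A k l / 2" using True by (simp add: sum.delta)
      finally show ?thesis .
    qed
    have 2: "(\<Sum>i=1..N. \<Sum>j=1..N. A i j / 2 * matrix_unit (reflect N j) (reflect N i) k l)
        = A (reflect N l) (reflect N k) / 2"
    proof -
      have "(\<Sum>i=1..N. \<Sum>j=1..N. A i j / 2 * matrix_unit (reflect N j) (reflect N i) k l)
          = (\<Sum>i=1..N. \<Sum>j=1..N. if j = reflect N k then
               (if i = reflect N l then A (reflect N l) (reflect N k) / 2 else 0) else 0)"
      proof (intro sum.cong refl)
        fix i j assume ij: "i \<in> {1..N}" "j \<in> {1..N}"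
        have "k = reflect N j \<longleftrightarrow> j = reflect N k" "l = reflect N i \<longleftrightarrow> i = reflect N l"
          using True ij reflect_reflect by metis+
        then show "A i j / 2 * matrix_unit (reflect N j) (reflect N i) k l =
          (if j = reflect N k then
               (if i = reflect N l then A (reflect N l) (reflect N k) / 2 else 0) else 0)"
          by (auto simp: matrix_unit_def)
      qed
      also have "\<dots> = A (reflect N l) (reflect N k) / 2"
        using True reflect_in[of k N] reflect_in[of l N] by (simp add: sum.delta)
      finally show ?thesis .
    qed
    have "(\<Sum>i=1..N. \<Sum>j=1..N. A i j / 2 * so_matrix N i j k l)
        = A k l / 2 - A (reflect N l) (reflect N k) / 2"
      by (simp only: so_matrix_def right_diff_distrib sum_subtractf 1 2)
    with A True show ?thesis by simp
  next
    case False
    have "(\<Sum>i=1..N. \<Sum>j=1..N. A i j / 2 * so_matrix N i j k l) = 0"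
      by (intro sum.neutral ballI) (simp only: so_matrix_outside[OF _ _ False] mult_zero_right)
    then show ?thesis using A False by (simp only:) blast
  qed
  show "A \<in> so_carrier N" unfolding so_carrier_def
    by (rule range_eqI[of _ _ "\<lambda>i j. A i j / 2"], intro ext) (rule *)
qed

lemma so_matrix_in_carrier:
  assumes "i \<in> {1..N}" "j \<in> {1..N}"
  shows "so_matrix N i j \<in> so_carrier N"
proof -
  have "so_matrix N i j k l =
    (\<Sum>p=1..N. \<Sum>q=1..N. (if q = j then if p = i then 1 else 0 else 0) * so_matrix N p q k l)" for k l
  proof -
    have "(\<Sum>p=1..N. \<Sum>q=1..N. (if q = j then if p = i then 1 else 0 else 0) * so_matrix N p q k l)
      = (\<Sum>p=1..N. \<Sum>q=1..N. (if q = j then if p = i then so_matrix N i j k l else 0 else 0))"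
      by (intro sum.cong) auto
    then show ?thesis using assms by (simp add: sum.delta)
  qed
  then show ?thesis
    unfolding so_carrier_def
    by (intro range_eqI[of _ _ "\<lambda>p q. if q = j then if p = i then 1 else 0 else 0"] ext)
qed

lemma commutator_closed:
  assumes "A \<in> so_carrier N" "B \<in> so_carrier N"
  shows "commutator N A B \<in> so_carrier N"
  unfolding so_carrier_iff
proof (intro conjI allI impI ballI)
  fix k l assume "\<not> (k \<in> {1..N} \<and> l \<in> {1..N})"
  then have *: "A k p * B p l = 0" "B k p * A p l = 0" for p
    using assms unfolding so_carrier_iff by auto
  show "commutator N A B k l = 0" by (simp only: commutator_def *) simp
next
  fix k l assume kl: "k \<in> {1..N}" "l \<in> {1..N}"
  have *: "(\<Sum>p=1..N. A (reflect N l) p * B p (reflect N k)) = (\<Sum>p=1..N. B k p * A p l)"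
    if A: "A \<in> so_carrier N" "B \<in> so_carrier N" for A B
  proof -
    have "(\<Sum>p=1..N. A (reflect N l) p * B p (reflect N k))
        = (\<Sum>p=1..N. A (reflect N l) (reflect N p) * B (reflect N p) (reflect N k))"
      using sum.reindex_bij_betw[OF bij_reflect[of N],
          of "\<lambda>p. A (reflect N l) p * B p (reflect N k)"] by simp
    also have "\<dots> = (\<Sum>p=1..N. B k p * A p l)"
      using A kl unfolding so_carrier_iff by (intro sum.cong) auto
    finally show ?thesis .
  qed
  show "commutator N A B (reflect N l) (reflect N k) = - commutator N A B k l"
    by (simp only: commutator_def *[OF assms] *[OF assms(2,1)] minus_diff_eq)
qed

text \<open>The type \<^typ>\<open>'n\<close> only serves to carry the number \<open>N = CARD('n)\<close>, which can be any positive
  integer.\<close>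

typedef (overloaded) ('n::finite) orth = "so_carrier CARD('n)"
  by (rule exI[of _ "\<lambda>_ _. 0"]) (simp add: so_carrier_iff)

setup_lifting type_definition_orth

instantiation orth :: (finite) complex_lie
begin
lift_definition zero_orth :: "'a orth" is "\<lambda>_ _. 0" by (simp add: so_carrier_iff)
lift_definition plus_orth :: "'a orth \<Rightarrow> 'a orth \<Rightarrow> 'a orth" is "\<lambda>A B k l. A k l + B k l"
  by (auto simp: so_carrier_iff)
lift_definition minus_orth :: "'a orth \<Rightarrow> 'a orth \<Rightarrow> 'a orth" is "\<lambda>A B k l. A k l - B k l"
  by (auto simp: so_carrier_iff)
lift_definition uminus_orth :: "'a orth \<Rightarrow> 'a orth" is "\<lambda>A k l. - A k l"
  by (auto simp: so_carrier_iff)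
lift_definition cscale_orth :: "complex \<Rightarrow> 'a orth \<Rightarrow> 'a orth" is "\<lambda>c A k l. c * A k l"
  by (auto simp: so_carrier_iff)
lift_definition lie_orth :: "'a orth \<Rightarrow> 'a orth \<Rightarrow> 'a orth" is "commutator CARD('a)"
  by (rule commutator_closed)

lemma commutator_jacobi:
  "commutator N A (commutator N B C) k l + commutator N B (commutator N C A) k l
     + commutator N C (commutator N A B) k l = 0"
proof -
  have assoc: "(\<Sum>p=Suc 0..N. \<Sum>q=Suc 0..N. X k p * (Y p q * Z q l))
      = (\<Sum>p=Suc 0..N. \<Sum>q=Suc 0..N. X k q * Y q p * Z p l)"
    for X Y Z :: "nat \<Rightarrow> nat \<Rightarrow> complex"
    by (subst sum.swap) (simp add: mult.assoc)
  show ?thesis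
    by (simp add: commutator_def right_diff_distrib left_diff_distrib sum_subtractf
        sum_distrib_left sum_distrib_right assoc)
qed

instance
proof
  fix x y z :: "'a orth"
  show "lie x (lie y z) + lie y (lie z x) + lie z (lie x y) = 0"
    by transfer (simp add: fun_eq_iff commutator_jacobi)
qed (transfer; simp add: fun_eq_iff commutator_def algebra_simps sum.distrib sum_distrib_left)+
end

lift_definition so_gen :: "nat \<Rightarrow> nat \<Rightarrow> 'n::finite orth" is
  "\<lambda>i j. if i \<in> {1..CARD('n)} \<and> j \<in> {1..CARD('n)} then so_matrix CARD('n) i j else (\<lambda>_ _. 0)"
  by (auto simp: so_matrix_in_carrier so_carrier_iff[of "\<lambda>_ _. 0"])


section \<open>The Lie algebra \<open>\<complex>T \<oplus> t\<^sup>-\<^sup>1\<gg>[t\<^sup>-\<^sup>1]\<close>\<close>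

text \<open>A Laurent polynomial \<open>\<Sum>\<^sub>r X\<^sub>r t\<^sup>r\<close> is the finitely supported function \<open>r \<mapsto> X\<^sub>r\<close>.\<close>

definition laurent_lie :: "(int \<Rightarrow>\<^sub>0 'g::complex_lie) \<Rightarrow> (int \<Rightarrow>\<^sub>0 'g) \<Rightarrow> (int \<Rightarrow>\<^sub>0 'g)" where
  "laurent_lie p q = addext (\<lambda>r x. addext (\<lambda>s y. Poly_Mapping.single (r + s) (lie x y)) q) p"

text \<open>The derivation \<open>-d/dt\<close>.\<close>

definition laurent_deriv :: "(int \<Rightarrow>\<^sub>0 'g::complex_lie) \<Rightarrow> (int \<Rightarrow>\<^sub>0 'g)" where
  "laurent_deriv p = addext (\<lambda>r x. Poly_Mapping.single (r - 1) ((- of_int r) *\<^sub>C x)) p"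

lemma laurent_lie_inner_add:
  "addext (\<lambda>s y. Poly_Mapping.single (r + s) (lie x y)) (p + q) =
    addext (\<lambda>s y. Poly_Mapping.single (r + s) (lie x y)) p +
    addext (\<lambda>s y. Poly_Mapping.single (r + s) (lie (x::'g::complex_lie) y)) q"
  by (rule addext_add) (simp_all add: lie_add_right single_add)

lemma laurent_lie_single:
  "laurent_lie (Poly_Mapping.single r x) (Poly_Mapping.single s y) = Poly_Mapping.single (r + s) (lie x y)"
  by (simp add: laurent_lie_def addext_single)

lemma laurent_lie_zero [simp]: "laurent_lie p 0 = 0" "laurent_lie 0 p = 0"
  by (simp_all add: laurent_lie_def addext_def)

lemma laurent_lie_add_left: "laurent_lie (p + q) u = laurent_lie p u + laurent_lie q u"
  unfolding laurent_lie_def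
proof (rule addext_add)
  show "addext (\<lambda>s y. Poly_Mapping.single (k + s) (lie (x + x') y)) u =
    addext (\<lambda>s y. Poly_Mapping.single (k + s) (lie x y)) u +
    addext (\<lambda>s y. Poly_Mapping.single (k + s) (lie x' y)) u" for k x x'
    by (simp add: addext_def lie_add_left single_add sum.distrib)
qed (simp add: addext_def)

lemma laurent_lie_add_right: "laurent_lie u (p + q) = laurent_lie u p + laurent_lie u q"
  unfolding laurent_lie_def by (simp add: addext_def[of _ u] laurent_lie_inner_add sum.distrib)

lemma laurent_lie_cscale_left: "laurent_lie (c *\<^sub>C p) q = c *\<^sub>C laurent_lie p q"
proof (induction p rule: pm_induct)
  case (single k x)
  show ?case
    by (induction q rule: pm_induct)
      (simp_all add: laurent_lie_single laurent_lie_add_right cscale_add_right lie_cscale_left)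
qed (simp_all add: cscale_add_right laurent_lie_add_left)

lemma laurent_lie_skew: "laurent_lie p q = - laurent_lie q p"
proof (induction p rule: pm_induct)
  case (single k x)
  show ?case
  proof (induction q rule: pm_induct)
    case (single l y)
    show ?case
      using lie_skew[of x y] by (simp add: laurent_lie_single add.commute single_uminus)
  qed (simp_all add: laurent_lie_add_left laurent_lie_add_right)
qed (simp_all add: laurent_lie_add_left laurent_lie_add_right)

lemma laurent_lie_cscale_right: "laurent_lie q (c *\<^sub>C p) = c *\<^sub>C laurent_lie q p"
  using laurent_lie_skew[of q "c *\<^sub>C p"] laurent_lie_skew[of q p]
  by (simp add: laurent_lie_cscale_left)

lemma eq_uminus_imp_zero:
  assumes "x = - (x::'a::complex_vector)"
  shows "x = 0"
proof -
  have "2 *\<^sub>C x = x + x" using cscale_add_left[of 1 1 x] by simp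
  also have "\<dots> = 0" using assms by (metis add.right_inverse)
  finally have "(1/2) *\<^sub>C 2 *\<^sub>C x = 0" by (simp only: cscale_zero_right)
  then show ?thesis by simp
qed

lemma laurent_lie_jacobi:
  fixes p q u :: "int \<Rightarrow>\<^sub>0 'g::complex_lie"
  shows "laurent_lie p (laurent_lie q u) + laurent_lie q (laurent_lie u p) + laurent_lie u (laurent_lie p q) = 0"
proof -
  define J where "J p q u = laurent_lie p (laurent_lie q u) + laurent_lie q (laurent_lie u p)
    + laurent_lie u (laurent_lie p q)" for p q u :: "int \<Rightarrow>\<^sub>0 'g"
  have J_add: "J (p + p') q u = J p q u + J p' q u" "J p (q + q') u = J p q u + J p q' u"
    "J p q (u + u') = J p q u + J p q u'" for p p' q q' u u'
    by (simp_all add: J_def laurent_lie_add_left laurent_lie_add_right add_ac)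
  have J_zero: "J 0 q u = 0" "J p 0 u = 0" "J p q 0 = 0" for p q u
    by (simp_all add: J_def)
  have J_single: "J (Poly_Mapping.single k x) (Poly_Mapping.single l y) (Poly_Mapping.single m z) = 0"
    for k x l y m z
  proof -
    have "l + (m + k) = k + (l + m)" "m + (k + l) = k + (l + m)" by simp_all
    then show ?thesis
      by (simp only: J_def laurent_lie_single single_add[symmetric] lie_jacobi single_zero)
  qed
  have "J p q u = 0"
  proof (induction p rule: pm_induct)
    case (single k x)
    show ?case
    proof (induction q rule: pm_induct)
      case (single l y)
      show ?case by (induction u rule: pm_induct) (simp_all add: J_add J_zero J_single)
    qed (simp_all add: J_add J_zero)
  qed (simp_all add: J_add J_zero)
  then show ?thesis by (simp add: J_def)
qed

lemma laurent_deriv_add: "laurent_deriv (p + q) = laurent_deriv p + laurent_deriv q"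
  unfolding laurent_deriv_def
  by (rule addext_add) (simp_all only: cscale_add_right single_add cscale_zero_right single_zero)

lemma laurent_deriv_zero [simp]: "laurent_deriv 0 = 0"
  by (simp add: laurent_deriv_def)

lemma laurent_deriv_single:
  "laurent_deriv (Poly_Mapping.single r x) = Poly_Mapping.single (r - 1) ((- of_int r) *\<^sub>C x)"
  unfolding laurent_deriv_def by (rule addext_single) simp

lemma laurent_deriv_cscale: "laurent_deriv (c *\<^sub>C p) = c *\<^sub>C laurent_deriv p"
  by (induction p rule: pm_induct)
    (simp_all add: laurent_deriv_add laurent_deriv_single cscale_add_right mult.commute single_uminus)

lemma laurent_deriv_lie:
  "laurent_deriv (laurent_lie p q) = laurent_lie (laurent_deriv p) q + laurent_lie p (laurent_deriv q)"
proof (induction p rule: pm_induct)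
  case (single k x)
  show ?case
  proof (induction q rule: pm_induct)
    case (single l y)
    have "(- of_int (k + l)) *\<^sub>C lie x y =
        lie ((- of_int k) *\<^sub>C x) y + lie x ((- of_int l) *\<^sub>C y)"
      by (simp only: lie_cscale_left lie_cscale_right cscale_add_left[symmetric]) simp
    then show ?case
      by (simp only: laurent_lie_single laurent_deriv_single)
        (simp add: single_add[symmetric] algebra_simps)
  qed (simp_all add: laurent_lie_add_right laurent_deriv_add add_ac)
qed (simp_all add: laurent_lie_add_left laurent_deriv_add add_ac)

lemma laurent_lie_negative:
  assumes "\<forall>r\<ge>0. Poly_Mapping.lookup p r = 0" "\<forall>r\<ge>0. Poly_Mapping.lookup q r = 0" "n \<ge> 0"
  shows "Poly_Mapping.lookup (laurent_lie p q) n = 0"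
proof -
  have "r < 0" if "r \<in> Poly_Mapping.keys p" for r
    using assms(1) that by (metis in_keys_iff not_le)
  moreover have "s < 0" if "s \<in> Poly_Mapping.keys q" for s
    using assms(2) that by (metis in_keys_iff not_le)
  ultimately have "r + s \<noteq> n" if "r \<in> Poly_Mapping.keys p" "s \<in> Poly_Mapping.keys q" for r s
    using that \<open>n \<ge> 0\<close> by (smt (verit))
  then show "Poly_Mapping.lookup (laurent_lie p q) n = 0"
    by (auto simp: laurent_lie_def addext_def lookup_sum lookup_single when_def intro!: sum.neutral)
qed

lemma laurent_deriv_negative:
  assumes "\<forall>r\<ge>0. Poly_Mapping.lookup p r = 0" "n \<ge> 0"
  shows "Poly_Mapping.lookup (laurent_deriv p) n = 0"
proof -
  have "r < 0" if "r \<in> Poly_Mapping.keys p" for r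
    using assms(1) that by (metis in_keys_iff not_le)
  then have "r - 1 \<noteq> n" if "r \<in> Poly_Mapping.keys p" for r
    using that \<open>n \<ge> 0\<close> by (smt (verit))
  then show "Poly_Mapping.lookup (laurent_deriv p) n = 0"
    by (auto simp: laurent_deriv_def addext_def lookup_sum lookup_single when_def intro!: sum.neutral)
qed

text \<open>\<open>t\<^sup>-\<^sup>1\<gg>[t\<^sup>-\<^sup>1]\<close>: only negative powers of \<open>t\<close> occur.\<close>

typedef (overloaded) 'g loop = "{p :: int \<Rightarrow>\<^sub>0 'g::complex_lie. \<forall>r\<ge>0. Poly_Mapping.lookup p r = 0}"
  by (rule exI[of _ 0]) simp

setup_lifting type_definition_loop

instantiation loop :: (complex_lie) complex_lie
begin
lift_definition zero_loop :: "'a loop" is 0 by simp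
lift_definition plus_loop :: "'a loop \<Rightarrow> 'a loop \<Rightarrow> 'a loop" is "(+)" by (simp add: lookup_add)
lift_definition minus_loop :: "'a loop \<Rightarrow> 'a loop \<Rightarrow> 'a loop" is "(-)" by (simp add: lookup_minus)
lift_definition uminus_loop :: "'a loop \<Rightarrow> 'a loop" is uminus by simp
lift_definition cscale_loop :: "complex \<Rightarrow> 'a loop \<Rightarrow> 'a loop" is cscale by simp
lift_definition lie_loop :: "'a loop \<Rightarrow> 'a loop \<Rightarrow> 'a loop" is laurent_lie
  by (simp add: laurent_lie_negative)
instance
proof
  fix x y z :: "'a loop" and c :: complex
  show "lie x x = 0"
    by transfer (rule eq_uminus_imp_zero, rule laurent_lie_skew)
  show "lie x (lie y z) + lie y (lie z x) + lie z (lie x y) = 0"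
    by transfer (rule laurent_lie_jacobi)
qed (transfer; simp add: laurent_lie_add_left laurent_lie_add_right laurent_lie_cscale_left
    laurent_lie_cscale_right cscale_add_left cscale_add_right algebra_simps)+
end

lift_definition loop_deriv :: "'g::complex_lie loop \<Rightarrow> 'g loop" is laurent_deriv
  by (simp add: laurent_deriv_negative)

text \<open>\<open>X[r] = X t\<^sup>r\<close>, for negative \<open>r\<close>.\<close>

lift_definition loop_elt :: "'g::complex_lie \<Rightarrow> int \<Rightarrow> 'g loop" is
  "\<lambda>X r. if r < 0 then Poly_Mapping.single r X else 0"
  by (simp add: lookup_single when_def)

lemma loop_elt_add: "loop_elt (X + Y) r = loop_elt X r + loop_elt Y r"
  by transfer (simp add: single_add)

lemma loop_elt_cscale: "loop_elt (c *\<^sub>C X) r = c *\<^sub>C loop_elt X r"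
  by transfer simp

lemma lie_loop_elt:
  "r < 0 \<Longrightarrow> s < 0 \<Longrightarrow> lie (loop_elt X r) (loop_elt Y s) = loop_elt (lie X Y) (r + s)"
  by transfer (simp add: laurent_lie_single)

lemma loop_deriv_elt: "r < 0 \<Longrightarrow> loop_deriv (loop_elt X r) = (- of_int r) *\<^sub>C loop_elt X (r - 1)"
  by transfer (simp add: laurent_deriv_single)

lemma loop_deriv_add: "loop_deriv (X + Y) = loop_deriv X + loop_deriv Y"
  by transfer (rule laurent_deriv_add)

lemma loop_deriv_cscale: "loop_deriv (c *\<^sub>C X) = c *\<^sub>C loop_deriv X"
  by transfer (rule laurent_deriv_cscale)

lemma loop_deriv_diff: "loop_deriv (X - Y) = loop_deriv X - loop_deriv Y"
  using loop_deriv_add[of "X - Y" Y] by (simp add: algebra_simps)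

lemma loop_deriv_lie: "loop_deriv (lie X Y) = lie (loop_deriv X) Y + lie X (loop_deriv Y)"
  by transfer (rule laurent_deriv_lie)

text \<open>\<open>Ext c X\<close> stands for \<open>cT + X\<close>.\<close>

context
  notes [[typedef_overloaded]]
begin
datatype 'g ext = Ext (T_part: complex) (loop_part: "'g::complex_lie loop")
end

instantiation ext :: (complex_lie) complex_lie
begin
definition zero_ext :: "'a ext" where "zero_ext = Ext 0 0"
definition plus_ext :: "'a ext \<Rightarrow> 'a ext \<Rightarrow> 'a ext"
  where "plus_ext x y = Ext (T_part x + T_part y) (loop_part x + loop_part y)"
definition minus_ext :: "'a ext \<Rightarrow> 'a ext \<Rightarrow> 'a ext"
  where "minus_ext x y = Ext (T_part x - T_part y) (loop_part x - loop_part y)"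
definition uminus_ext :: "'a ext \<Rightarrow> 'a ext"
  where "uminus_ext x = Ext (- T_part x) (- loop_part x)"
definition cscale_ext :: "complex \<Rightarrow> 'a ext \<Rightarrow> 'a ext"
  where "cscale_ext c x = Ext (c * T_part x) (c *\<^sub>C loop_part x)"
definition lie_ext :: "'a ext \<Rightarrow> 'a ext \<Rightarrow> 'a ext"
  where "lie_ext x y = Ext 0 (T_part x *\<^sub>C loop_deriv (loop_part y)
    - T_part y *\<^sub>C loop_deriv (loop_part x) + lie (loop_part x) (loop_part y))"
instance
proof
  fix x y z :: "'a ext"
  show "lie x (lie y z) + lie y (lie z x) + lie z (lie x y) = 0"
  proof -
    obtain a X b Y c Z where xyz: "x = Ext a X" "y = Ext b Y" "z = Ext c Z"
      by (metis ext.exhaust)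
    have skew: "lie Z (loop_deriv Y) = - lie (loop_deriv Y) Z"
      "lie X (loop_deriv Z) = - lie (loop_deriv Z) X"
      "lie Y (loop_deriv X) = - lie (loop_deriv X) Y"
      by (rule lie_skew)+
    have jac: "lie X (lie Y Z) = - lie Y (lie Z X) - lie Z (lie X Y)"
      using lie_jacobi[of X Y Z] by (simp add: eq_diff_eq eq_neg_iff_add_eq_0 add_ac)
    show ?thesis
      by (simp add: xyz zero_ext_def plus_ext_def lie_ext_def loop_deriv_add loop_deriv_diff
          loop_deriv_cscale loop_deriv_lie lie_add_right lie_diff_right lie_cscale_right
          cscale_add_right cscale_diff_right skew jac)
        (simp add: mult.commute)
  qed
  note defs = zero_ext_def plus_ext_def minus_ext_def uminus_ext_def cscale_ext_def lie_ext_def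
  show "x + y + z = x + (y + z)" "x + y = y + x" "0 + x = x" "- x + x = 0" "x - y = x + - y"
    by (simp_all add: defs ac_simps)
  fix c d
  show "c *\<^sub>C (x + y) = c *\<^sub>C x + c *\<^sub>C y" "(c + d) *\<^sub>C x = c *\<^sub>C x + d *\<^sub>C x"
    "c *\<^sub>C d *\<^sub>C x = (c * d) *\<^sub>C x" "1 *\<^sub>C x = x"
    by (simp_all add: defs cscale_add_left cscale_add_right distrib_left distrib_right)
  show "lie x x = 0" by (simp add: defs)
  show "lie (x + y) z = lie x z + lie y z" "lie x (y + z) = lie x y + lie x z"
    by (simp_all add: defs lie_add_left lie_add_right loop_deriv_add cscale_add_left
        cscale_add_right)
  show "lie (c *\<^sub>C x) y = c *\<^sub>C lie x y" "lie x (c *\<^sub>C y) = c *\<^sub>C lie x y"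
    by (simp_all add: defs lie_cscale_left lie_cscale_right loop_deriv_cscale
        cscale_add_right cscale_diff_right mult.commute)
qed
end

abbreviation T_ext :: "'g::complex_lie ext" where "T_ext \<equiv> Ext 1 0"


section \<open>Application to \<open>1\<close>\<close>

lemma abs_uea_mult: "abs_uea (p * q) = abs_uea p * abs_uea q"
  by (simp add: times_uea.abs_eq)

lemma abs_uea_relator: "r \<in> uea_relators \<Longrightarrow> abs_uea r = 0"
  by (simp add: zero_uea_def uea_eq_iff ideal_gen_gen)

text \<open>The extension of \<open>-d/dt\<close> to a derivation of \<open>U(t\<^sup>-\<^sup>1\<gg>[t\<^sup>-\<^sup>1])\<close>.\<close>

primrec deriv_word :: "'g::complex_lie loop list \<Rightarrow> 'g loop uea" where
  "deriv_word [] = 0"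
| "deriv_word (x # w) =
    uea_gen (loop_deriv x) * prod_list (map uea_gen w) + uea_gen x * deriv_word w"

lemma deriv_word_append:
  "deriv_word (u @ v) = deriv_word u * prod_list (map uea_gen v) + prod_list (map uea_gen u) * deriv_word v"
  by (induction u) (simp_all add: algebra_simps)

lemma linext_deriv_word_mult:
  "linext deriv_word (p * q) = linext deriv_word p * abs_uea q + abs_uea p * linext deriv_word q"
proof (induction p rule: pm_induct)
  case (single k c)
  show ?case
    by (induction q rule: pm_induct)
      (simp_all add: abs_uea_linext linext_add mult_single plus_list_def deriv_word_append
        cscale_add_right distrib_left mult.commute add_ac)
qed (simp_all add: abs_uea_linext linext_add distrib_right add_ac)

lemma linext_deriv_relator:
  assumes "r \<in> uea_relators"
  shows "linext deriv_word r = 0"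
  using assms
proof cases
  case (1 x y)
  then show ?thesis by (simp add: linext_diff loop_deriv_add uea_gen_add)
next
  case (2 c x)
  then show ?thesis by (simp add: linext_diff cscale_complex_def loop_deriv_cscale uea_gen_cscale)
next
  case (3 x y)
  then show ?thesis
    by (simp add: linext_diff mult_single plus_list_def loop_deriv_lie uea_gen_add uea_gen_lie)
qed

lift_definition uea_deriv :: "'g::complex_lie loop uea \<Rightarrow> 'g loop uea" is "linext deriv_word"
proof -
  fix p q :: "'g loop list \<Rightarrow>\<^sub>0 complex"
  assume "p - q \<in> ideal_gen uea_relators"
  then have "linext deriv_word (p - q) = 0"
    by (rule linext_ideal_zero)
      (simp add: linext_deriv_word_mult abs_uea_mult linext_deriv_relator abs_uea_relator)
  then show "linext deriv_word p = linext deriv_word q" by (simp add: linext_diff)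
qed

lemma uea_deriv_add: "uea_deriv (u + v) = uea_deriv u + uea_deriv v"
  by transfer (rule linext_add)

lemma uea_deriv_cscale: "uea_deriv (c *\<^sub>C u) = c *\<^sub>C uea_deriv u"
  by transfer (rule linext_cscale)

lemma uea_deriv_zero [simp]: "uea_deriv 0 = 0"
  by transfer simp

lemma uea_deriv_mult: "uea_deriv (u * v) = uea_deriv u * v + u * uea_deriv v"
proof (induction u rule: uea.abs_induct)
  case (1 p)
  show ?case
  proof (induction v rule: uea.abs_induct)
    case (1 q)
    show ?case
      by (simp add: abs_uea_mult[symmetric] uea_deriv.abs_eq linext_deriv_word_mult)
  qed
qed

lemma uea_deriv_gen: "uea_deriv (uea_gen X) = uea_gen (loop_deriv X)"
  by (simp add: uea_gen.abs_eq uea_deriv.abs_eq)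

lemma uea_deriv_one [simp]: "uea_deriv 1 = 0"
  using uea_deriv_mult[of 1 1] by simp

text \<open>\<open>U(\<complex>T \<oplus> t\<^sup>-\<^sup>1\<gg>[t\<^sup>-\<^sup>1])\<close> acts on \<open>U(t\<^sup>-\<^sup>1\<gg>[t\<^sup>-\<^sup>1])\<close>: moving \<open>T\<close> to the right past \<open>Z\<close> gives
  \<open>TZ = ZT + T(Z)\<close>, so, as \<open>T1 = 0\<close>, the element \<open>T\<close> acts as the derivation
  \<^const>\<open>uea_deriv\<close>, while \<open>X[r]\<close> acts by left multiplication.\<close>

definition ext_act :: "'g::complex_lie ext \<Rightarrow> 'g loop uea \<Rightarrow> 'g loop uea" where
  "ext_act x Z = T_part x *\<^sub>C uea_deriv Z + uea_gen (loop_part x) * Z"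

lemma ext_act_linear:
  "ext_act x (Z + Z') = ext_act x Z + ext_act x Z'"
  "ext_act x (c *\<^sub>C Z) = c *\<^sub>C ext_act x Z"
  "ext_act x 0 = 0"
  by (simp_all add: ext_act_def uea_deriv_add uea_deriv_cscale cscale_add_right distrib_left
      mult.commute add_ac)

lemma foldr_ext_act_linear:
  "foldr ext_act w (Z + Z') = foldr ext_act w Z + foldr ext_act w Z'"
  "foldr ext_act w (c *\<^sub>C Z) = c *\<^sub>C foldr ext_act w Z"
  "foldr ext_act w 0 = 0"
  by (induction w) (simp_all add: ext_act_linear)

lemma linext_ext_act_mult:
  "linext (\<lambda>w. foldr ext_act w Z) (p * q) =
    linext (\<lambda>w. foldr ext_act w (linext (\<lambda>w. foldr ext_act w Z) q)) p"
proof (induction p rule: pm_induct)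
  case (single k c)
  show ?case
    by (induction q rule: pm_induct)
      (simp_all add: linext_add mult_single plus_list_def foldr_ext_act_linear distrib_left
        cscale_add_right mult.commute)
qed (simp_all add: linext_add distrib_right)

lemma linext_ext_act_zero: "linext (\<lambda>w. foldr ext_act w 0) p = 0"
  by (simp add: foldr_ext_act_linear linext_def addext_def)

lemma linext_ext_act_relator:
  assumes "r \<in> uea_relators"
  shows "linext (\<lambda>w. foldr ext_act w Z) r = 0"
  using assms
proof cases
  case (1 x y)
  then show ?thesis
    by (simp add: linext_diff ext_act_def plus_ext_def uea_gen_add cscale_add_left distrib_right)
next
  case (2 c x)
  then show ?thesis
    by (simp add: linext_diff cscale_complex_def ext_act_def cscale_ext_def uea_gen_cscale
        cscale_add_right)
next
  case (3 x y)
  have diff: "uea_gen (X - Y) = uea_gen X - uea_gen Y" for X Y :: "'a loop"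
    using uea_gen_add[of "X - Y" Y] by (simp add: algebra_simps)
  have zero: "uea_gen (0 :: 'a loop) = 0"
    using uea_gen_add[of 0 "0 :: 'a loop"] by simp
  from 3 show ?thesis
    by (simp add: linext_diff mult_single plus_list_def ext_act_def lie_ext_def uea_deriv_add
        uea_deriv_cscale uea_deriv_mult uea_deriv_gen uea_gen_lie uea_gen_add diff uea_gen_cscale
        cscale_add_right distrib_left distrib_right left_diff_distrib mult.assoc)
      (simp add: mult.commute)
qed

text \<open>The map \<open>Y \<mapsto> Y1\<close>.\<close>

lift_definition apply_to_one :: "'g::complex_lie ext uea \<Rightarrow> 'g loop uea" is
  "linext (\<lambda>w. foldr ext_act w 1)"
proof -
  fix p q :: "'g ext list \<Rightarrow>\<^sub>0 complex"
  assume "p - q \<in> ideal_gen uea_relators"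
  then have "linext (\<lambda>w. foldr ext_act w 1) (p - q) = 0"
    by (rule linext_ideal_zero)
      (simp add: linext_ext_act_mult linext_ext_act_relator linext_ext_act_zero)
  then show "linext (\<lambda>w. foldr ext_act w 1) p = linext (\<lambda>w. foldr ext_act w 1) q"
    by (simp add: linext_diff)
qed

text \<open>The inclusion \<open>U(t\<^sup>-\<^sup>1\<gg>[t\<^sup>-\<^sup>1]) \<rightarrow> U(\<complex>T \<oplus> t\<^sup>-\<^sup>1\<gg>[t\<^sup>-\<^sup>1])\<close>. The element \<open>Y1\<close> is the unique \<open>Z\<close> with
  \<open>Y = Z + WT\<close> for some \<open>W\<close>.\<close>

lift_definition uea_incl :: "'g::complex_lie loop uea \<Rightarrow> 'g ext uea" is
  "linext (\<lambda>w. prod_list (map (\<lambda>X. uea_gen (Ext 0 X)) w))"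
proof -
  fix p q :: "'g loop list \<Rightarrow>\<^sub>0 complex"
  let ?f = "\<lambda>w :: 'g loop list. prod_list (map (\<lambda>X. uea_gen (Ext 0 X)) w)"
  have ext: "Ext 0 (X + Y) = Ext 0 X + Ext 0 Y" "Ext 0 (c *\<^sub>C X) = c *\<^sub>C Ext 0 X"
    "Ext 0 (lie X Y) = lie (Ext 0 X) (Ext 0 Y)" for X Y :: "'g loop" and c
    by (simp_all add: plus_ext_def cscale_ext_def lie_ext_def)
  have mult: "linext ?f (u * v) = linext ?f u * linext ?f v" for u v
    by (rule linext_mult) (simp add: plus_list_def)
  have rel: "linext ?f r = 0" if "r \<in> uea_relators" for r
    using that
    by cases (simp_all add: linext_diff mult cscale_complex_def ext uea_gen_add uea_gen_cscale uea_gen_lie)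
  assume "p - q \<in> ideal_gen uea_relators"
  then have "linext ?f (p - q) = 0"
    by (rule linext_ideal_zero) (simp add: mult rel)
  then show "linext ?f p = linext ?f q" by (simp add: linext_diff)
qed

lemma uea_incl_linear: "uea_incl (u + v) = uea_incl u + uea_incl v"
  "uea_incl (c *\<^sub>C u) = c *\<^sub>C uea_incl u" "uea_incl 0 = 0"
  by (transfer; simp add: linext_add linext_cscale)+

lemma uea_incl_word: "uea_incl (prod_list (map uea_gen w)) = prod_list (map (\<lambda>X. uea_gen (Ext 0 X)) w)"
  by (simp add: uea_word[symmetric] uea_incl.abs_eq)

lemma uea_incl_gen: "uea_incl (uea_gen X) = uea_gen (Ext 0 X)"
  using uea_incl_word[of "[X]"] by simp

lemma uea_incl_one: "uea_incl 1 = 1"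
  using uea_incl_word[of "[]"] by simp

lemma uea_incl_mult: "uea_incl (u * v) = uea_incl u * uea_incl v"
proof (induction u rule: uea_induct)
  case (cscale_word c w)
  have *: "uea_incl (prod_list (map uea_gen w) * v) = uea_incl (prod_list (map uea_gen w)) * uea_incl v"
  proof (induction v rule: uea_induct)
    case (cscale_word d w')
    have "prod_list (map uea_gen w) * prod_list (map uea_gen w') = prod_list (map uea_gen (w @ w'))"
      by simp
    then show ?case
      by (simp only: cscale_mult_right uea_incl_linear uea_incl_word) simp
  qed (simp_all add: uea_incl_linear distrib_left)
  show ?case by (simp add: uea_incl_linear *)
qed (simp_all add: uea_incl_linear distrib_right)

lemma apply_to_one_linear: "apply_to_one (u + v) = apply_to_one u + apply_to_one v"
  "apply_to_one (c *\<^sub>C u) = c *\<^sub>C apply_to_one u" "apply_to_one 0 = 0"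
  by (transfer; simp add: linext_add linext_cscale)+

lemma apply_to_one_word:
  "apply_to_one (prod_list (map uea_gen w)) = foldr ext_act w 1"
  by (simp add: uea_word[symmetric] apply_to_one.abs_eq)

lemma apply_to_one_incl: "apply_to_one (uea_incl u) = u"
proof (induction u rule: uea_induct)
  case (cscale_word c w)
  have "apply_to_one (prod_list (map (\<lambda>X. uea_gen (Ext 0 X)) w)) = prod_list (map uea_gen w)"
  proof -
    have "foldr ext_act (map (Ext 0) w) 1 = prod_list (map uea_gen w)"
      by (induction w) (simp_all add: ext_act_def)
    then show ?thesis using apply_to_one_word[of "map (Ext 0) w"] by (simp add: o_def)
  qed
  then show ?case by (simp only: uea_incl_linear uea_incl_word apply_to_one_linear)
qed (simp_all add: uea_incl_linear apply_to_one_linear)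

lemma apply_to_one_mult_T: "apply_to_one (u * uea_gen (T_ext)) = 0"
proof (induction u rule: uea_induct)
  case (cscale_word c w)
  have zero: "uea_gen (0 :: 'a loop) = 0"
    using uea_gen_add[of 0 "0 :: 'a loop"] by simp
  have "prod_list (map uea_gen w) * uea_gen (T_ext) = prod_list (map uea_gen (w @ [T_ext]))"
    by simp
  then have "apply_to_one (prod_list (map uea_gen w) * uea_gen (T_ext)) = 0"
    by (simp only: apply_to_one_word) (simp add: ext_act_def zero foldr_ext_act_linear)
  then show ?case by (simp add: apply_to_one_linear)
qed (simp_all add: apply_to_one_linear distrib_right)

lemma apply_to_one_unique:
  "Y = uea_incl Z + W * uea_gen (T_ext) \<Longrightarrow> apply_to_one Y = Z"
  by (simp add: apply_to_one_linear apply_to_one_incl apply_to_one_mult_T)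

lemma T_mult_incl:
  "uea_gen (T_ext) * uea_incl Z = uea_incl Z * uea_gen (T_ext) + uea_incl (uea_deriv Z)"
proof (induction Z rule: uea_induct)
  case (cscale_word c w)
  have "uea_gen (T_ext) * uea_incl (prod_list (map uea_gen w)) =
    uea_incl (prod_list (map uea_gen w)) * uea_gen (T_ext) + uea_incl (uea_deriv (prod_list (map uea_gen w)))"
  proof (induction w)
    case Nil
    show ?case by (simp add: uea_incl_linear uea_incl_one)
  next
    case (Cons X w)
    let ?T = "uea_gen (T_ext) :: 'a ext uea" and ?X = "uea_gen (Ext 0 X)"
    let ?w = "prod_list (map uea_gen w)"
    have "lie (T_ext) (Ext 0 X) = Ext 0 (loop_deriv X)"
      by (simp add: lie_ext_def)
    then have comm: "?T * ?X = ?X * ?T + uea_gen (Ext 0 (loop_deriv X))"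
      using uea_gen_lie[of "T_ext" "Ext 0 X"] by (simp add: algebra_simps)
    have "?T * uea_incl (uea_gen X * ?w) = (?T * ?X) * uea_incl ?w"
      by (simp add: uea_incl_mult uea_incl_gen mult.assoc)
    also have "\<dots> = ?X * (?T * uea_incl ?w) + uea_gen (Ext 0 (loop_deriv X)) * uea_incl ?w"
      by (simp add: comm distrib_right mult.assoc)
    also have "\<dots> = uea_incl (uea_gen X * ?w) * ?T + uea_incl (uea_deriv (uea_gen X * ?w))"
      by (simp add: Cons uea_deriv_mult uea_deriv_gen uea_incl_linear uea_incl_mult uea_incl_gen
          algebra_simps)
    finally show ?case by simp
  qed
  then show ?case
    by (simp add: uea_incl_linear uea_deriv_cscale cscale_add_right)
qed (simp_all add: uea_incl_linear uea_deriv_add distrib_left distrib_right add_ac)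

lemma apply_to_one_decomposition: "\<exists>W. Y = uea_incl (apply_to_one Y) + W * uea_gen (T_ext)"
proof -
  have "\<exists>Z W. Y = uea_incl Z + W * uea_gen (T_ext)"
  proof (induction Y rule: uea_induct)
    case zero
    show ?case by (rule exI[of _ 0], rule exI[of _ 0]) (simp add: uea_incl_linear)
  next
    case (cscale_word c w)
    have "\<exists>Z W. prod_list (map uea_gen w) = uea_incl Z + W * (uea_gen (T_ext) :: 'a ext uea)"
    proof (induction w)
      case Nil
      show ?case
        by (intro exI[of _ 1] exI[of _ 0]) (simp add: uea_incl_one)
    next
      case (Cons x w)
      then obtain Z W where ZW: "prod_list (map uea_gen w) = uea_incl Z + W * (uea_gen (T_ext) :: 'a ext uea)"
        by blast
      obtain c X where x: "x = Ext c X" by (cases x)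
      have "x = c *\<^sub>C T_ext + Ext 0 X" by (simp add: x plus_ext_def cscale_ext_def)
      then have gx: "uea_gen x = c *\<^sub>C uea_gen (T_ext) + uea_incl (uea_gen X)"
        by (simp add: uea_gen_add uea_gen_cscale uea_incl_gen)
      have "prod_list (map uea_gen (x # w)) =
          uea_incl (c *\<^sub>C uea_deriv Z + uea_gen X * Z) +
          (c *\<^sub>C uea_incl Z + uea_gen x * W) * uea_gen (T_ext)"
        by (simp add: ZW gx distrib_left distrib_right T_mult_incl uea_incl_linear uea_incl_mult
            cscale_add_right mult.assoc add_ac)
      then show ?case by blast
    qed
    then obtain Z W where "prod_list (map uea_gen w) = uea_incl Z + W * (uea_gen (T_ext) :: 'a ext uea)"
      by blast
    then have "c *\<^sub>C prod_list (map uea_gen w) = uea_incl (c *\<^sub>C Z) + (c *\<^sub>C W) * uea_gen (T_ext)"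
      by (simp add: uea_incl_linear cscale_add_right)
    then show ?case by blast
  next
    case (add p q)
    then obtain Z W Z' W' where "p = uea_incl Z + W * uea_gen (T_ext)"
      "q = uea_incl Z' + W' * uea_gen (T_ext)" by blast
    then have "p + q = uea_incl (Z + Z') + (W + W') * uea_gen (T_ext)"
      by (simp add: uea_incl_linear distrib_right add_ac)
    then show ?case by blast
  qed
  then show ?thesis using apply_to_one_unique by metis
qed


section \<open>The elements \<open>\<Phi>\<^sub>k\<close>\<close>

lemma linext_sym_zero:
  fixes f :: "'a::complex_vector \<Rightarrow> 'b::complex_vector"
  assumes "\<And>x y. f (x + y) = f x + f y" "\<And>c x. f (c *\<^sub>C x) = c *\<^sub>C f x"
    and "p - q \<in> ideal_gen sym_relators"
  shows "linext (\<lambda>M. \<Prod>x\<in>#M. sym_gen (f x)) p = linext (\<lambda>M. \<Prod>x\<in>#M. sym_gen (f x)) q"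
proof -
  let ?f = "\<lambda>M. \<Prod>x\<in>#M. sym_gen (f x)"
  have mult: "linext ?f (u * v) = linext ?f u * linext ?f v" for u v
    by (rule linext_mult) simp
  have rel: "linext ?f r = 0" if "r \<in> sym_relators" for r
    using that
    by cases (simp_all add: linext_diff cscale_complex_def assms(1,2) sym_gen_add sym_gen_cscale)
  have "linext ?f (p - q) = 0"
    using assms(3) by (rule linext_ideal_zero) (simp add: mult rel)
  then show ?thesis by (simp add: linext_diff)
qed

text \<open>The embedding \<open>S \<mapsto> S[-1]\<close> of \<open>S(\<gg>)\<close> into \<open>S(t\<^sup>-\<^sup>1\<gg>[t\<^sup>-\<^sup>1])\<close>.\<close>

lift_definition sym_shift :: "'g::complex_lie sym \<Rightarrow> 'g loop sym" is
  "linext (\<lambda>M. \<Prod>X\<in>#M. sym_gen (loop_elt X (-1)))"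
  by (rule linext_sym_zero[OF loop_elt_add loop_elt_cscale])

text \<open>The inclusion \<open>S(t\<^sup>-\<^sup>1\<gg>[t\<^sup>-\<^sup>1]) \<rightarrow> S(\<complex>T \<oplus> t\<^sup>-\<^sup>1\<gg>[t\<^sup>-\<^sup>1])\<close>.\<close>

lift_definition sym_incl :: "'g::complex_lie loop sym \<Rightarrow> 'g ext sym" is
  "linext (\<lambda>M. \<Prod>X\<in>#M. sym_gen (Ext 0 X))"
  by (rule linext_sym_zero) (simp_all add: plus_ext_def cscale_ext_def)

lemma sym_shift_prod_list:
  "sym_shift (prod_list (map sym_gen xs)) = prod_list (map (\<lambda>X. sym_gen (loop_elt X (-1))) xs)"
  by (simp add: sym_monomial[symmetric] sym_shift.abs_eq prod_mset_prod_list flip: mset_map)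

lemma sym_incl_prod_list:
  "sym_incl (prod_list (map sym_gen xs)) = prod_list (map (\<lambda>X. sym_gen (Ext 0 X)) xs)"
  by (simp add: sym_monomial[symmetric] sym_incl.abs_eq prod_mset_prod_list flip: mset_map)

text \<open>Matrices of \<^theory>\<open>Jordan_Normal_Form.Matrix\<close> are indexed from 0. The constant term of
  \<open>det(1 - qF)\<close> is 1, so that \<open>fps_right_inverse\<close> with second argument 1 is its inverse.\<close>

definition so_charpoly :: "'n::finite itself \<Rightarrow> 'n orth sym fps" where
  "so_charpoly _ = det (1\<^sub>m CARD('n) -
     mat CARD('n) CARD('n) (\<lambda>(i, j). fps_X * fps_const (sym_gen (so_gen (i + 1) (j + 1)))))"

definition Phi :: "nat \<Rightarrow> 'n::finite orth sym" where
  "Phi k = fps_nth (fps_right_inverse (so_charpoly TYPE('n)) 1) k"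


section \<open>The Brauer algebra\<close>

datatype dot = Top nat | Bottom nat

type_synonym diagram = "dot set set"

definition dots :: "nat \<Rightarrow> dot set" where
  "dots m = Top ` {1..m} \<union> Bottom ` {1..m}"

definition diagrams :: "nat \<Rightarrow> diagram set" where
  "diagrams m = {d. (\<forall>e\<in>d. e \<subseteq> dots m \<and> card e = 2) \<and> (\<forall>v\<in>dots m. \<exists>!e. e \<in> d \<and> v \<in> e)}"

text \<open>To multiply \<open>d\<close> and \<open>d'\<close> the diagram \<open>d\<close> is placed under \<open>d'\<close>. The pair \<open>(l, a)\<close> is the dot \<open>a\<close> on
  level \<open>l\<close>: level 2 is the top row of \<open>d'\<close>, level 1 is the bottom row of \<open>d'\<close> identified
  with the top row of \<open>d\<close>, level 0 is the bottom row of \<open>d\<close>.\<close>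

fun place :: "nat \<Rightarrow> nat \<Rightarrow> dot \<Rightarrow> nat \<times> nat" where
  "place t b (Top a) = (t, a)"
| "place t b (Bottom a) = (b, a)"

definition connected_in_stack :: "diagram \<Rightarrow> diagram \<Rightarrow> ((nat \<times> nat) \<times> (nat \<times> nat)) set" where
  "connected_in_stack d d' = {(u, v). {u, v} \<in> (`) (place 1 0) ` d \<union> (`) (place 2 1) ` d'}\<^sup>*"

definition diagram_mult :: "nat \<Rightarrow> diagram \<Rightarrow> diagram \<Rightarrow> diagram" where
  "diagram_mult m d d' = {{u, v} | u v. u \<in> dots m \<and> v \<in> dots m \<and> u \<noteq> v \<and>
     (place 2 0 u, place 2 0 v) \<in> connected_in_stack d d'}"

text \<open>The closed loops are the connected components contained in the middle row.\<close>

definition closed_loops :: "nat \<Rightarrow> diagram \<Rightarrow> diagram \<Rightarrow> nat" where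
  "closed_loops m d d' =
     card {C. \<exists>a\<in>{1..m}. C = connected_in_stack d d' `` {(1, a)} \<and> C \<subseteq> {1} \<times> {1..m}}"

type_synonym brauer = "diagram \<Rightarrow>\<^sub>0 complex"

definition brauer_carrier :: "nat \<Rightarrow> brauer set" where
  "brauer_carrier m = {x. Poly_Mapping.keys x \<subseteq> diagrams m}"

definition brauer_mult :: "complex \<Rightarrow> nat \<Rightarrow> brauer \<Rightarrow> brauer \<Rightarrow> brauer" where
  "brauer_mult \<omega> m x y = (\<Sum>d\<in>Poly_Mapping.keys x. \<Sum>d'\<in>Poly_Mapping.keys y.
     Poly_Mapping.single (diagram_mult m d d')
       (Poly_Mapping.lookup x d * Poly_Mapping.lookup y d' * \<omega> ^ closed_loops m d d'))"

definition perm_diagram :: "nat \<Rightarrow> (nat \<Rightarrow> nat) \<Rightarrow> diagram" where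
  "perm_diagram m \<sigma> = {{Top a, Bottom (\<sigma> a)} | a. a \<in> {1..m}}"

definition brauer_one :: "nat \<Rightarrow> brauer" where
  "brauer_one m = Poly_Mapping.single (perm_diagram m id) 1"

definition brauer_s :: "nat \<Rightarrow> nat \<Rightarrow> nat \<Rightarrow> brauer" where
  "brauer_s m a b = Poly_Mapping.single (perm_diagram m (transpose a b)) 1"

definition brauer_eps :: "nat \<Rightarrow> nat \<Rightarrow> nat \<Rightarrow> brauer" where
  "brauer_eps m a b = Poly_Mapping.single
     ({{Top a, Top b}, {Bottom a, Bottom b}} \<union> {{Top c, Bottom c} | c. c \<in> {1..m} - {a, b}}) 1"

definition top_horizontal :: "diagram \<Rightarrow> nat" where
  "top_horizontal d = card {e \<in> d. e \<subseteq> range Top}"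

definition symmetrizer :: "complex \<Rightarrow> nat \<Rightarrow> brauer" where
  "symmetrizer \<omega> m = (1 / fact m) *\<^sub>C (\<Sum>r=0..m div 2.
     ((-1) ^ r / ((\<omega> / 2 + of_nat m - 2) gchoose r)) *\<^sub>C
       (\<Sum>d | d \<in> diagrams m \<and> top_horizontal d = r. Poly_Mapping.single d 1))"

definition gamma_factor :: "nat \<Rightarrow> complex \<Rightarrow> complex" where
  "gamma_factor m \<omega> = (\<omega> + of_nat m - 2) / (\<omega> + 2 * of_nat m - 2)"


section \<open>Operators on \<open>(\<complex>\<^sup>N)\<^bsup>\<otimes>m\<^esup>\<close>\<close>

text \<open>An element of \<open>(End \<complex>\<^sup>N)\<^bsup>\<otimes>m\<^esup> \<otimes> \<A>\<close> is given by its \<open>\<A>\<close>-valued entries, indexed by two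
  multi-indices in \<open>{1, \<dots>, N}\<^bsup>{1, \<dots>, m}\<^esup>\<close> (row and column); its values elsewhere are irrelevant.\<close>

type_synonym 'r tensor_op = "(nat \<Rightarrow> nat) \<Rightarrow> (nat \<Rightarrow> nat) \<Rightarrow> 'r"

definition multi_indices :: "nat \<Rightarrow> nat \<Rightarrow> (nat \<Rightarrow> nat) set" where
  "multi_indices N m = {1..m} \<rightarrow>\<^sub>E {1..N}"

definition op_one :: "'r::zero_neq_one tensor_op" where
  "op_one I J = (if I = J then 1 else 0)"

definition op_mult :: "nat \<Rightarrow> nat \<Rightarrow> 'r::semiring_0 tensor_op \<Rightarrow> 'r tensor_op \<Rightarrow> 'r tensor_op" where
  "op_mult N m A B I J = (\<Sum>K\<in>multi_indices N m. A I K * B K J)"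

definition op_trace :: "nat \<Rightarrow> nat \<Rightarrow> 'r::comm_monoid_add tensor_op \<Rightarrow> 'r" where
  "op_trace N m A = (\<Sum>I\<in>multi_indices N m. A I I)"

text \<open>The simple tensor \<open>M\<^sub>1 \<otimes> \<dots> \<otimes> M\<^sub>m\<close>.\<close>

definition simple_tensor :: "nat \<Rightarrow> (nat \<Rightarrow> nat \<Rightarrow> nat \<Rightarrow> complex) \<Rightarrow> complex tensor_op" where
  "simple_tensor m M I J = (\<Prod>a=1..m. M a (I a) (J a))"

definition identity_matrix :: "nat \<Rightarrow> nat \<Rightarrow> complex" where
  "identity_matrix k l = (if k = l then 1 else 0)"

text \<open>\<open>A \<otimes> x\<close> for an operator \<open>A\<close> and an element \<open>x\<close> of the coefficient algebra.\<close>

definition op_tensor :: "complex tensor_op \<Rightarrow> 'r::complex_algebra \<Rightarrow> 'r tensor_op" where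
  "op_tensor A x I J = A I J *\<^sub>C x"

definition P_op :: "nat \<Rightarrow> nat \<Rightarrow> nat \<Rightarrow> complex tensor_op" where
  "P_op m a b I J = (if \<forall>c\<in>{1..m}. I c = J (transpose a b c) then 1 else 0)"

definition Q_op :: "nat \<Rightarrow> nat \<Rightarrow> nat \<Rightarrow> nat \<Rightarrow> complex tensor_op" where
  "Q_op N m a b I J = (\<Sum>i=1..N. \<Sum>j=1..N. simple_tensor m
     ((\<lambda>_. identity_matrix)(a := matrix_unit i j, b := matrix_unit (reflect N i) (reflect N j))) I J)"

definition op_eq :: "nat \<Rightarrow> nat \<Rightarrow> 'r tensor_op \<Rightarrow> 'r tensor_op \<Rightarrow> bool" where
  "op_eq N m A B \<longleftrightarrow> (\<forall>I\<in>multi_indices N m. \<forall>J\<in>multi_indices N m. A I J = B I J)"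

text \<open>\<open>\<rho>\<close> is the homomorphism of the Brauer algebra with \<open>\<omega> = N\<close> to \<open>End (\<complex>\<^sup>N)\<^bsup>\<otimes>m\<^esup>\<close> with
  \<open>s\<^sub>a\<^sub>b \<mapsto> P\<^sub>a\<^sub>b\<close> and \<open>\<epsilon>\<^sub>a\<^sub>b \<mapsto> Q\<^sub>a\<^sub>b\<close>. It exists, and as these elements generate the algebra, it
  is unique (on the carrier, and up to irrelevant values).\<close>

definition brauer_action :: "nat \<Rightarrow> nat \<Rightarrow> (brauer \<Rightarrow> complex tensor_op) \<Rightarrow> bool" where
  "brauer_action N m \<rho> \<longleftrightarrow>
     (\<forall>x\<in>brauer_carrier m. \<forall>y\<in>brauer_carrier m.
        op_eq N m (\<rho> (x + y)) (\<lambda>I J. \<rho> x I J + \<rho> y I J)) \<and>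
     (\<forall>c. \<forall>x\<in>brauer_carrier m. op_eq N m (\<rho> (c *\<^sub>C x)) (\<lambda>I J. c * \<rho> x I J)) \<and>
     (\<forall>x\<in>brauer_carrier m. \<forall>y\<in>brauer_carrier m.
        op_eq N m (\<rho> (brauer_mult (of_nat N) m x y)) (op_mult N m (\<rho> x) (\<rho> y))) \<and>
     op_eq N m (\<rho> (brauer_one m)) op_one \<and>
     (\<forall>a\<in>{1..m}. \<forall>b\<in>{1..m}. a < b \<longrightarrow>
        op_eq N m (\<rho> (brauer_s m a b)) (P_op m a b) \<and>
        op_eq N m (\<rho> (brauer_eps m a b)) (Q_op N m a b))"


section \<open>Segal--Sugawara vectors\<close>

text \<open>\<open>F[r]\<^sub>a\<close>, with entries in \<open>U(\<complex>T \<oplus> t\<^sup>-\<^sup>1\<oo>\<^sub>N[t\<^sup>-\<^sup>1])\<close>.\<close>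

definition F_op :: "nat \<Rightarrow> int \<Rightarrow> nat \<Rightarrow> 'n::finite orth ext uea tensor_op" where
  "F_op m r a I J = (\<Sum>i=1..CARD('n). \<Sum>j=1..CARD('n).
     op_tensor (simple_tensor m ((\<lambda>_. identity_matrix)(a := matrix_unit i j)))
       (uea_gen (Ext 0 (loop_elt (so_gen i j) r))) I J)"

text \<open>\<open>T + F[-1]\<^sub>a\<close>, where \<open>T\<close> stands for \<open>1 \<otimes> T\<close>.\<close>

definition T_plus_F :: "nat \<Rightarrow> nat \<Rightarrow> 'n::finite orth ext uea tensor_op" where
  "T_plus_F m a I J = op_tensor op_one (uea_gen (T_ext)) I J + F_op m (-1) a I J"

text \<open>\<open>(T + F[-1]\<^sub>1) \<dots> (T + F[-1]\<^sub>m)\<close>.\<close>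

definition T_plus_F_product :: "nat \<Rightarrow> 'n::finite orth ext uea tensor_op" where
  "T_plus_F_product m = foldr (\<lambda>a. op_mult CARD('n) m (T_plus_F m a)) [1..<m + 1] op_one"

definition segal_sugawara ::
    "(brauer \<Rightarrow> complex tensor_op) \<Rightarrow> nat \<Rightarrow> 'n::finite orth loop uea" where
  "segal_sugawara \<rho> m = gamma_factor m (of_nat CARD('n)) *\<^sub>C apply_to_one
     (op_trace CARD('n) m (op_mult CARD('n) m
        (op_tensor (\<rho> (symmetrizer (of_nat CARD('n)) m)) 1) (T_plus_F_product m)))"

end

theory Submission
  imports Defs
begin

text \<open>In the basis of \<open>(\<complex>\<^sup>N)\<^bsup>\<otimes>m\<^esup>\<close> a Brauer diagram acts by the matrix whose entry at the row index \<open>I\<close>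
  and the column index \<open>J\<close> is 1 if all edges are compatible with \<open>I\<close> and \<open>J\<close>, and 0 otherwise. This is
  forced by the values on the generators (\<open>brauer_action_diagram\<close>). Therefore the entries
  \<open>S\<^sub>I\<^sub>J\<close> of \<open>S\<^bsup>(m)\<^esup>\<close> do not change when the same permutation is applied to the positions in \<open>I\<close> and in
  \<open>J\<close>, and in the trace \<open>\<Sum> S\<^sub>I\<^sub>J Y(J\<^sub>1, I\<^sub>1) \<dots> Y(J\<^sub>m, I\<^sub>m)\<close>, where \<open>Y = T + F[-1]\<close>, every product may be
  replaced by its symmetrization (\<open>sum_symmetrized\<close>). The vector is thus \<open>\<varpi>(P)1\<close>, where \<open>P\<close> is \<open>\<gamma>\<^sub>m(N)\<close>
  times the same trace over the commutative algebra \<open>S(\<complex>T \<oplus> t\<^sup>-\<^sup>1\<oo>\<^sub>N[t\<^sup>-\<^sup>1])\<close>, and it suffices to show that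
  \<open>P\<close> is the sum of \<open>\<Sum>\<^sub>l binom(N+m-2, m-2l) T\<^bsup>m-2l\<^esup> \<Phi>\<^sub>2\<^sub>l[-1]\<close> over \<open>l \<ge> 1\<close> and of a scalar multiple of
  \<open>T\<^sup>m\<close>, which is killed by the application to 1 (\<open>normalized_value_shifted_power\<close>).

  Over a commutative algebra a sum over all diagrams is a Gaussian moment. Take variables
  \<open>y\<^sub>1, \<dots>, y\<^sub>N\<close> for the top dots and \<open>x\<^sub>1, \<dots>, x\<^sub>N\<close> for the bottom dots, and let \<open>E\<close> be the linear
  functional that sums over all pairings of the variables of a monomial, where \<open>y\<^sub>i\<close> pairs with \<open>x\<^sub>i\<close>,
  \<open>x\<^sub>i\<close> with \<open>x\<^sub>i\<^sub>'\<close>, and \<open>y\<^sub>i\<close> with \<open>y\<^sub>i\<^sub>'\<close> at the price of a factor \<open>u\<close>. With \<open>q\<^sub>A = \<Sum> A\<^sub>j\<^sub>i y\<^sub>j x\<^sub>i\<close> the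
  moment \<open>E[q\<^sub>A\<^sup>m]\<close> is the sum of \<open>u\<^sup>r tr(d A\<^sub>1 \<dots> A\<^sub>m)\<close> over all diagrams \<open>d\<close>, where \<open>r\<close> is the number of
  horizontal edges of \<open>d\<close> in the top row. The trace with the symmetrizer arises by substituting \<open>(-1)\<^sup>r / binom(N/2+m-2, r)\<close> for
  \<open>u\<^sup>r\<close> and dividing by \<open>m!\<close>. Two computations with \<open>E\<close> give the result.

  First, \<open>E[q\<^sub>F\<^bsup>2l\<^esup>] = (2l)! (1-u)\<^sup>l \<Phi>\<^sub>2\<^sub>l\<close> if \<open>F\<close> is skew with respect to the form, and the odd moments
  vanish. Following the cycle of contractions through one factor one picks up
  a factor \<open>1-u\<close> in every two steps, and the resulting recursion is Newton's identity for
  \<open>det(1-qF)\<^sup>-\<^sup>1\<close>. After the substitution the factor \<open>(1-u)\<^sup>l\<close> turns into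
  \<open>\<Sum>\<^sub>r binom(l, r) / binom(N/2+2l-2, r) = \<gamma>\<^sub>2\<^sub>l(N)\<^sup>-\<^sup>1\<close>.

  Second, \<open>E[q\<^sub>1 f] = (N + (m-1)(1+u)) E[f] + 2u(1-u) (d/du)E[f]\<close> if \<open>f\<close> has degree \<open>m-1\<close> in both kinds of
  variables. After the substitution this says that replacing one factor by the identity costs
  \<open>(N+m-2)/m\<close> in \<open>\<gamma>\<^sub>m tr S\<^bsup>(m)\<^esup>\<close> and leaves \<open>\<gamma>\<^sub>m\<^sub>-\<^sub>1 tr S\<^bsup>(m-1)\<^esup>\<close>. Iteration and the binomial expansion of
  \<open>(T q\<^sub>1 + q\<^sub>F)\<^sup>m\<close> produce the binomial coefficients of the formula.\<close>

section \<open>Perfect matchings and hafnians\<close>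

definition perfect_matchings :: "'v set \<Rightarrow> 'v set set set" where
  "perfect_matchings V =
     {d. (\<forall>e\<in>d. e \<subseteq> V \<and> card e = 2) \<and> (\<forall>v\<in>V. \<exists>!e. e \<in> d \<and> v \<in> e)}"

lemma perfect_matchingI:
  assumes "\<And>e. e \<in> d \<Longrightarrow> e \<subseteq> V \<and> card e = 2"
    and "\<And>v. v \<in> V \<Longrightarrow> \<exists>!e. e \<in> d \<and> v \<in> e"
  shows "d \<in> perfect_matchings V"
  using assms by (simp add: perfect_matchings_def)

lemma perfect_matching_edgeD:
  assumes "d \<in> perfect_matchings V" "e \<in> d"
  shows "e \<subseteq> V" "card e = 2"
  using assms by (auto simp: perfect_matchings_def)

lemma perfect_matching_ex1:
  "d \<in> perfect_matchings V \<Longrightarrow> v \<in> V \<Longrightarrow> \<exists>!e. e \<in> d \<and> v \<in> e"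
  by (simp add: perfect_matchings_def)

lemma perfect_matching_unique:
  assumes "d \<in> perfect_matchings V" "e \<in> d" "e' \<in> d" "v \<in> e" "v \<in> e'"
  shows "e = e'"
  using assms perfect_matching_ex1[OF assms(1), of v] perfect_matching_edgeD[OF assms(1)] by blast

lemma perfect_matching_partner:
  assumes "d \<in> perfect_matchings V" "v \<in> V"
  obtains x where "x \<in> V - {v}" "{v, x} \<in> d"
proof -
  obtain e where e: "e \<in> d" "v \<in> e" using perfect_matching_ex1[OF assms] by blast
  then obtain a b where ab: "e = {a, b}" "a \<noteq> b"
    using perfect_matching_edgeD[OF assms(1)] by (metis card_2_iff)
  then have "e \<subseteq> V" using perfect_matching_edgeD[OF assms(1)] e by blast
  show thesis
  proof (cases "v = a")
    case True
    then show thesis using that[of b] ab e \<open>e \<subseteq> V\<close> by auto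
  next
    case False
    then show thesis using that[of a] ab e \<open>e \<subseteq> V\<close> by (auto simp: insert_commute)
  qed
qed

lemma finite_perfect_matchings: "finite V \<Longrightarrow> finite (perfect_matchings V)"
  by (rule finite_subset[of _ "Pow (Pow V)"]) (auto simp: perfect_matchings_def)

lemma finite_perfect_matching:
  assumes "finite V" "d \<in> perfect_matchings V"
  shows "finite d"
  by (rule finite_subset[of _ "Pow V"]) (use assms in \<open>auto simp: perfect_matchings_def\<close>)

lemma perfect_matchings_empty [simp]: "perfect_matchings {} = {{}}"
  by (fastforce simp: perfect_matchings_def)

lemma perfect_matching_insert:
  assumes "d \<in> perfect_matchings (V - {v, x})" "v \<in> V" "x \<in> V - {v}"
  shows "insert {v, x} d \<in> perfect_matchings V" "{v, x} \<notin> d"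
proof -
  have sub: "e \<subseteq> V - {v, x}" "card e = 2" if "e \<in> d" for e
    using perfect_matching_edgeD[OF assms(1) that] by auto
  then show "{v, x} \<notin> d" by blast
  have ex1: "\<exists>!e. e \<in> insert {v, x} d \<and> u \<in> e" if "u \<in> V" for u
  proof (cases "u \<in> {v, x}")
    case True
    then show ?thesis using sub by blast
  next
    case False
    then have "\<exists>!e. e \<in> d \<and> u \<in> e" using perfect_matching_ex1[OF assms(1), of u] that by blast
    then show ?thesis using False by blast
  qed
  have "e \<subseteq> V \<and> card e = 2" if "e \<in> insert {v, x} d" for e
    using that sub[of e] assms(2,3) by auto
  then show "insert {v, x} d \<in> perfect_matchings V"
    using ex1 by (rule perfect_matchingI)
qed

lemma perfect_matching_remove:
  assumes "d \<in> perfect_matchings V" "{v, x} \<in> d"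
  shows "d - {{v, x}} \<in> perfect_matchings (V - {v, x})"
proof -
  have disj: "e \<inter> {v, x} = {}" if "e \<in> d - {{v, x}}" for e
    using perfect_matching_unique[OF assms(1) _ assms(2)] that by blast
  have ex1: "\<exists>!e. e \<in> d - {{v, x}} \<and> u \<in> e" if "u \<in> V - {v, x}" for u
    using perfect_matching_ex1[OF assms(1), of u] that by blast
  have "e \<subseteq> V - {v, x} \<and> card e = 2" if "e \<in> d - {{v, x}}" for e
    using disj[OF that] perfect_matching_edgeD[OF assms(1), of e] that by blast
  then show ?thesis using ex1 by (rule perfect_matchingI)
qed

text \<open>An edge is an unordered pair of dots; for a symmetric function of two dots both orders of the dots
  give the same value, which is the one described here.\<close>

definition edge_weight :: "('v \<Rightarrow> 'v \<Rightarrow> 'r) \<Rightarrow> 'v set \<Rightarrow> 'r" where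
  "edge_weight \<kappa> e = (THE c. \<exists>x y. x \<noteq> y \<and> e = {x, y} \<and> c = \<kappa> x y)"

lemma edge_weight_pair:
  assumes "\<And>x y. \<kappa> x y = \<kappa> y x" "x \<noteq> y"
  shows "edge_weight \<kappa> {x, y} = \<kappa> x y"
  unfolding edge_weight_def
proof (rule the_equality)
  show "\<exists>x' y'. x' \<noteq> y' \<and> {x, y} = {x', y'} \<and> \<kappa> x y = \<kappa> x' y'" using assms(2) by blast
  show "c = \<kappa> x y" if "\<exists>x' y'. x' \<noteq> y' \<and> {x, y} = {x', y'} \<and> c = \<kappa> x' y'" for c
    using that assms(1) by (auto simp: doubleton_eq_iff)
qed

definition hafnian :: "('v \<Rightarrow> 'v \<Rightarrow> 'r::comm_ring_1) \<Rightarrow> 'v set \<Rightarrow> 'r" where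
  "hafnian \<kappa> V = (\<Sum>d\<in>perfect_matchings V. \<Prod>e\<in>d. edge_weight \<kappa> e)"

lemma hafnian_empty [simp]: "hafnian \<kappa> {} = 1"
  by (simp add: hafnian_def)

text \<open>Perfect matchings of \<open>V\<close> are classified by the partner \<open>x\<close> of the fixed dot \<open>v\<close>; removing the edge
  leaves an arbitrary perfect matching of the other dots.\<close>

lemma hafnian_expand:
  assumes sym: "\<And>x y. \<kappa> x y = \<kappa> y x" and V: "finite V" "v \<in> V"
  shows "hafnian \<kappa> V = (\<Sum>x\<in>V - {v}. \<kappa> v x * hafnian \<kappa> (V - {v, x}))"
proof -
  let ?PM = "perfect_matchings" and ?w = "\<lambda>d. \<Prod>e\<in>d. edge_weight \<kappa> e"
  have "(\<Sum>x\<in>V - {v}. \<kappa> v x * hafnian \<kappa> (V - {v, x})) =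
      (\<Sum>x\<in>V - {v}. \<Sum>d\<in>?PM (V - {v, x}). \<kappa> v x * ?w d)"
    by (simp add: hafnian_def sum_distrib_left)
  also have "\<dots> = (\<Sum>(x, d)\<in>(SIGMA x:V - {v}. ?PM (V - {v, x})). \<kappa> v x * ?w d)"
    by (rule sum.Sigma) (use V in \<open>auto simp: finite_perfect_matchings\<close>)
  also have "\<dots> = (\<Sum>p\<in>(SIGMA x:V - {v}. ?PM (V - {v, x})). ?w (case p of (x, d) \<Rightarrow> insert {v, x} d))"
  proof (rule sum.cong[OF refl])
    fix p assume p: "p \<in> (SIGMA x:V - {v}. ?PM (V - {v, x}))"
    obtain x d where pq: "p = (x, d)" by (metis surj_pair)
    have "finite d" using p V(1) finite_perfect_matching[of "V - {v, x}" d] by (simp add: pq)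
    moreover have "{v, x} \<notin> d" using perfect_matching_insert(2)[of d V v x] p V(2) by (simp add: pq)
    moreover have "edge_weight \<kappa> {v, x} = \<kappa> v x"
      by (rule edge_weight_pair) (use sym p pq in auto)
    ultimately show "(case p of (x, d) \<Rightarrow> \<kappa> v x * ?w d) = ?w (case p of (x, d) \<Rightarrow> insert {v, x} d)"
      by (simp add: pq)
  qed
  also have "\<dots> = (\<Sum>d\<in>?PM V. ?w d)"
  proof (rule sum.reindex_bij_betw, rule bij_betwI')
    fix p q
    assume p: "p \<in> (SIGMA x:V - {v}. ?PM (V - {v, x}))"
      and q: "q \<in> (SIGMA x:V - {v}. ?PM (V - {v, x}))"
    obtain x d y d' where pq: "p = (x, d)" "q = (y, d')" by (metis surj_pair)
    have x: "x \<in> V - {v}" "d \<in> ?PM (V - {v, x})" and y: "y \<in> V - {v}" "d' \<in> ?PM (V - {v, y})"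
      using p q by (simp_all add: pq)
    have "p = q" if eq: "insert {v, x} d = insert {v, y} d'"
    proof -
      note 1 = perfect_matching_insert[OF x(2) V(2) x(1)]
      have "{v, x} = {v, y}"
        by (rule perfect_matching_unique[OF 1(1), of _ _ v]) (use eq in auto)
      then have "x = y" using x(1) y(1) by (auto simp: doubleton_eq_iff)
      moreover have "d = d'"
        using 1(2) perfect_matching_insert(2)[OF y(2) V(2) y(1)] eq \<open>x = y\<close>
        by (metis Diff_insert_absorb)
      ultimately show ?thesis by (simp add: pq)
    qed
    then show "((case p of (x, d) \<Rightarrow> insert {v, x} d) = (case q of (x, d) \<Rightarrow> insert {v, x} d)) = (p = q)"
      by (auto simp: pq)
  next
    fix p assume p: "p \<in> (SIGMA x:V - {v}. ?PM (V - {v, x}))"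
    obtain x d where pq: "p = (x, d)" by (metis surj_pair)
    show "(case p of (x, d) \<Rightarrow> insert {v, x} d) \<in> ?PM V"
      using perfect_matching_insert(1)[of d V v x] p V(2) by (simp add: pq)
  next
    fix d assume d: "d \<in> ?PM V"
    obtain x where x: "x \<in> V - {v}" "{v, x} \<in> d" by (rule perfect_matching_partner[OF d V(2)])
    show "\<exists>p\<in>(SIGMA x:V - {v}. ?PM (V - {v, x})). d = (case p of (x, d) \<Rightarrow> insert {v, x} d)"
      using perfect_matching_remove[OF d x(2)] x
      by (intro bexI[of _ "(x, d - {{v, x}})"]) (auto simp: insert_absorb)
  qed
  finally show ?thesis by (simp add: hafnian_def)
qed

text \<open>Expand both sides at dots with the same label. By induction the hafnians of the remaining dots
  depend on the removed partner only through its label, so both expansions are the same sum over a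
  multiset of labels. This allows to attach a hafnian to a multiset of labels.\<close>

lemma hafnian_label_cong:
  fixes lab' :: "'u \<Rightarrow> 'w" and lab :: "'v \<Rightarrow> 'w"
  assumes sym: "\<And>p q. w p q = (w q p :: 'r::comm_ring_1)"
  shows "finite V \<Longrightarrow> finite V' \<Longrightarrow> image_mset lab (mset_set V) = image_mset lab' (mset_set V') \<Longrightarrow>
    hafnian (\<lambda>x y. w (lab x) (lab y)) V = hafnian (\<lambda>x y. w (lab' x) (lab' y)) V'"
proof (induction "card V" arbitrary: V V' rule: less_induct)
  case less
  let ?h = "hafnian (\<lambda>x y. w (lab x) (lab y))" and ?h' = "hafnian (\<lambda>x y. w (lab' x) (lab' y))"
  show ?case
  proof (cases "V = {}")
    case True
    then have "image_mset lab' (mset_set V') = {#}" using less.prems(3) by (metis image_mset_empty mset_set.empty)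
    then have "V' = {}" using less.prems(2) by (simp add: mset_set_empty_iff)
    with True show ?thesis by simp
  next
    case False
    then obtain v where v: "v \<in> V" by blast
    then have "lab v \<in># image_mset lab (mset_set V)" using less.prems(1) by simp
    then have "lab v \<in># image_mset lab' (mset_set V')" by (simp only: less.prems(3))
    then obtain v' where v': "v' \<in> V'" "lab' v' = lab v" using less.prems(2) by auto
    have rem: "image_mset lab (mset_set (V - {v})) = image_mset lab' (mset_set (V' - {v'}))"
      using less.prems v v' by (simp add: mset_set_Diff image_mset_Diff)
    have step: "?h (V - {v, x}) = ?h' (V' - {v', x'})"
      if "x \<in> V - {v}" "x' \<in> V' - {v'}" "lab x = lab' x'" for x x'
    proof (rule less.hyps)
      have "V - {v, x} \<subset> V" using v by blast
      then show "card (V - {v, x}) < card V" using less.prems(1) by (rule psubset_card_mono[rotated])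
      have "V - {v, x} = (V - {v}) - {x}" "V' - {v', x'} = (V' - {v'}) - {x'}" by blast+
      then show "image_mset lab (mset_set (V - {v, x})) = image_mset lab' (mset_set (V' - {v', x'}))"
        using that rem less.prems by (simp only: mset_set_Diff finite_Diff) (simp add: mset_set_Diff image_mset_Diff)
    qed (use less.prems in auto)
    define G where "G p = ?h' (V' - {v', SOME x'. x' \<in> V' - {v'} \<and> lab' x' = p})" for p
    have labels: "\<exists>x'. x' \<in> V' - {v'} \<and> lab' x' = lab x" if "x \<in> V - {v}" for x
    proof -
      have "lab x \<in># image_mset lab' (mset_set (V' - {v'}))"
        using that less.prems(1) by (simp flip: rem)
      then show ?thesis using less.prems(2) by auto
    qed
    have labels': "\<exists>x. x \<in> V - {v} \<and> lab x = lab' x'" if "x' \<in> V' - {v'}" for x'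
    proof -
      have "lab' x' \<in># image_mset lab (mset_set (V - {v}))"
        using that less.prems(2) by (simp add: rem)
      then show ?thesis using less.prems(1) by auto
    qed
    have G: "?h (V - {v, x}) = G (lab x)" if "x \<in> V - {v}" for x
      unfolding G_def using someI_ex[OF labels[OF that]] by (intro step that) auto
    have G': "?h' (V' - {v', x'}) = G (lab' x')" if x': "x' \<in> V' - {v'}" for x'
    proof -
      obtain x where x: "x \<in> V - {v}" "lab x = lab' x'" using labels'[OF x'] by blast
      then show ?thesis using step[OF x(1) x' x(2)] G[OF x(1)] by simp
    qed
    have "?h V = (\<Sum>x\<in>V - {v}. w (lab v) (lab x) * ?h (V - {v, x}))"
      by (rule hafnian_expand[OF _ less.prems(1) v]) (rule sym)
    also have "\<dots> = (\<Sum>x\<in>V - {v}. w (lab v) (lab x) * G (lab x))"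
      by (intro sum.cong refl) (simp only: G)
    also have "\<dots> = \<Sum>\<^sub># (image_mset (\<lambda>p. w (lab v) p * G p) (image_mset lab (mset_set (V - {v}))))"
      by (simp add: sum_unfold_sum_mset multiset.map_comp o_def)
    also have "\<dots> = (\<Sum>x\<in>V' - {v'}. w (lab v) (lab' x) * G (lab' x))"
      by (simp add: rem sum_unfold_sum_mset multiset.map_comp o_def)
    also have "\<dots> = (\<Sum>x\<in>V' - {v'}. w (lab' v') (lab' x) * ?h' (V' - {v', x}))"
      by (intro sum.cong refl) (simp only: G' v')
    also have "\<dots> = ?h' V'"
      by (rule hafnian_expand[symmetric, OF _ less.prems(2) v'(1)]) (rule sym)
    finally show ?thesis .
  qed
qed

text \<open>The dots with label \<open>x\<close> are realized as the pairs \<open>(x, i)\<close> with \<open>i\<close> below the multiplicity of \<open>x\<close>, which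
  avoids the choice of an order of the labels.\<close>

definition wick :: "('w \<Rightarrow> 'w \<Rightarrow> 'r::comm_ring_1) \<Rightarrow> 'w multiset \<Rightarrow> 'r" where
  "wick w M = hafnian (\<lambda>p q. w (fst p) (fst q)) (SIGMA x:set_mset M. {..<count M x})"

lemma copies_mset: "image_mset fst (mset_set (SIGMA x:set_mset M. {..<count M x})) = M"
proof (rule multiset_eqI)
  fix y
  define C where "C = (SIGMA x:set_mset M. {..<count M x})"
  have "finite C" by (simp add: C_def)
  then have "count (image_mset fst (mset_set C)) y = (\<Sum>p\<in>fst -` {y} \<inter> C. count (mset_set C) p)"
    by (simp add: count_image_mset)
  also have "\<dots> = (\<Sum>p\<in>fst -` {y} \<inter> C. 1)"
    by (rule sum.cong) (use \<open>finite C\<close> in auto)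
  also have "fst -` {y} \<inter> C = Pair y ` {..<count M y}"
  proof (rule Set.set_eqI)
    fix p
    have "i < count M y \<Longrightarrow> y \<in># M" for i by (metis count_inI less_nat_zero_code)
    then show "p \<in> fst -` {y} \<inter> C \<longleftrightarrow> p \<in> Pair y ` {..<count M y}"
      by (cases p) (auto simp: C_def)
  qed
  finally show "count (image_mset fst (mset_set (SIGMA x:set_mset M. {..<count M x}))) y = count M y"
    by (simp add: card_image inj_on_def C_def)
qed

lemma hafnian_eq_wick:
  assumes "\<And>p q. w p q = w q p" "finite V"
  shows "hafnian (\<lambda>x y. w (lab x) (lab y)) V = wick w (image_mset lab (mset_set V))"
  unfolding wick_def
proof (rule hafnian_label_cong[OF assms])
  show "image_mset lab (mset_set V) = image_mset fst (mset_set (SIGMA x:set_mset (image_mset lab (mset_set V)).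
      {..<count (image_mset lab (mset_set V)) x}))"
    by (rule copies_mset[symmetric])
qed simp

lemma wick_empty [simp]: "wick w {#} = 1"
  by (simp add: wick_def)

lemma wick_add:
  assumes sym: "\<And>p q. w p q = w q p"
  shows "wick w (add_mset p M) = (\<Sum>x\<in>#M. w p x * wick w (M - {#x#}))"
proof -
  define C where "C = (SIGMA x:set_mset M. {..<count M x})"
  define v where "v = (p, count M p)"
  let ?h = "hafnian (\<lambda>p q. w (fst p) (fst q))"
  have fin: "finite C" by (simp add: C_def)
  have vC: "v \<notin> C" by (simp add: C_def v_def)
  have lab: "image_mset fst (mset_set C) = M" by (simp add: C_def copies_mset)
  have rest: "?h (C - {c}) = wick w (M - {#fst c#})" if "c \<in> C" for c
  proof -
    have "?h (C - {c}) = wick w (image_mset fst (mset_set (C - {c})))"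
      by (rule hafnian_eq_wick[OF sym]) (use fin in simp)
    also have "image_mset fst (mset_set (C - {c})) = M - {#fst c#}"
      using that fin lab by (simp add: mset_set_Diff image_mset_Diff)
    finally show ?thesis .
  qed
  have "wick w (add_mset p M) = ?h (insert v C)"
  proof -
    have "image_mset fst (mset_set (insert v C)) = add_mset p M"
      using fin vC lab by (simp add: v_def)
    then show ?thesis using hafnian_eq_wick[of w "insert v C" fst] sym fin by simp
  qed
  also have "\<dots> = (\<Sum>c\<in>insert v C - {v}. w (fst v) (fst c) * ?h (insert v C - {v, c}))"
    by (rule hafnian_expand) (use sym fin in auto)
  also have "\<dots> = (\<Sum>c\<in>C. w p (fst c) * wick w (M - {#fst c#}))"
  proof (rule sum.cong)
    fix c assume "c \<in> C"
    moreover have "insert v C - {v, c} = C - {c}" using vC by blast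
    ultimately show "w (fst v) (fst c) * ?h (insert v C - {v, c}) = w p (fst c) * wick w (M - {#fst c#})"
      by (simp add: rest) (simp add: v_def)
  qed (use vC in auto)
  also have "\<dots> = \<Sum>\<^sub># (image_mset (\<lambda>x. w p x * wick w (M - {#x#})) (image_mset fst (mset_set C)))"
    by (simp add: sum_unfold_sum_mset multiset.map_comp o_def)
  finally show ?thesis by (simp add: lab)
qed

section \<open>Gaussian functionals on polynomial algebras\<close>

text \<open>Monomials are finite multisets of variables, so that \<^typ>\<open>'w multiset \<Rightarrow>\<^sub>0 'a\<close> is the algebra of
  polynomials over \<^typ>\<open>'a\<close> in the variables \<^typ>\<open>'w\<close>.\<close>

definition var :: "'w \<Rightarrow> ('w multiset \<Rightarrow>\<^sub>0 'a::comm_ring_1)" where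
  "var p = Poly_Mapping.single {#p#} 1"

definition const :: "'a::comm_ring_1 \<Rightarrow> ('w multiset \<Rightarrow>\<^sub>0 'a)" where
  "const c = Poly_Mapping.single {#} c"

text \<open>The partial derivative with respect to the variable \<open>p\<close>.\<close>

definition pd :: "'w \<Rightarrow> ('w multiset \<Rightarrow>\<^sub>0 'a::comm_ring_1) \<Rightarrow> ('w multiset \<Rightarrow>\<^sub>0 'a)" where
  "pd p = addext (\<lambda>M c. Poly_Mapping.single (M - {#p#}) (of_nat (count M p) * c))"

text \<open>The \<^typ>\<open>'a\<close>-linear functional whose moments are the hafnians. The covariance \<open>w\<close> and the values may
  depend on a mark \<open>u\<close>, the variable \<^const>\<open>fps_X\<close> of the power series.\<close>

definition gaussian ::
    "('w \<Rightarrow> 'w \<Rightarrow> 'a fps) \<Rightarrow> ('w multiset \<Rightarrow>\<^sub>0 'a::comm_ring_1) \<Rightarrow> 'a fps" where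
  "gaussian w = addext (\<lambda>M c. fps_const c * wick w M)"

lemma const_0 [simp]: "const 0 = 0" by (simp add: const_def)
lemma const_1 [simp]: "const 1 = 1"
  by (simp add: const_def flip: single_one)
lemma const_add: "const (a + b) = const a + const b" by (simp add: const_def single_add)
lemma const_mult: "const (a * b) = const a * const b" by (simp add: const_def mult_single)

lemma const_of_nat: "const (of_nat n) = of_nat n"
  by (induction n) (simp_all add: const_add)

lemma const_sum: "const (\<Sum>i\<in>A. f i) = (\<Sum>i\<in>A. const (f i))"
  by (induction A rule: infinite_finite_induct) (simp_all add: const_add)

lemma pd_single: "pd p (Poly_Mapping.single M c) = Poly_Mapping.single (M - {#p#}) (of_nat (count M p) * c)"
  unfolding pd_def by (rule addext_single) simp

lemma pd_zero [simp]: "pd p 0 = 0"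
  by (simp add: pd_def)

lemma pd_add: "pd p (f + g) = pd p f + pd p g"
  unfolding pd_def by (rule addext_add) (simp_all add: algebra_simps single_add)

lemma pd_sum: "pd p (\<Sum>i\<in>A. f i) = (\<Sum>i\<in>A. pd p (f i))"
  by (induction A rule: infinite_finite_induct) (simp_all add: pd_add)

lemma pd_mult: "pd p (f * g) = pd p f * g + f * pd p g"
proof (induction f rule: pm_induct)
  case (single M c)
  show ?case
  proof (induction g rule: pm_induct)
    case (single K d)
    have 1: "Poly_Mapping.single (M + K - {#p#}) (of_nat (count M p) * (c * d)) =
        Poly_Mapping.single (M - {#p#} + K) (of_nat (count M p) * (c * d))"
      by (cases "p \<in># M") (simp_all add: not_in_iff)
    have 2: "Poly_Mapping.single (M + K - {#p#}) (of_nat (count K p) * (c * d)) =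
        Poly_Mapping.single (M + (K - {#p#})) (of_nat (count K p) * (c * d))"
      by (cases "p \<in># K") (simp_all add: not_in_iff)
    have "pd p (Poly_Mapping.single M c * Poly_Mapping.single K d) =
        Poly_Mapping.single (M + K - {#p#}) (of_nat (count M p) * (c * d)) +
        Poly_Mapping.single (M + K - {#p#}) (of_nat (count K p) * (c * d))"
      by (simp add: pd_single mult_single distrib_right flip: single_add)
    also have "\<dots> = pd p (Poly_Mapping.single M c) * Poly_Mapping.single K d +
        Poly_Mapping.single M c * pd p (Poly_Mapping.single K d)"
      by (simp add: 1 2 pd_single mult_single mult.assoc mult.left_commute[of c])
    finally show ?case .
  qed (simp_all add: pd_add distrib_left add_ac)
qed (simp_all add: pd_add distrib_right add_ac)

lemma pd_const [simp]: "pd p (const c) = 0"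
  by (simp add: const_def pd_single)

lemma pd_one [simp]: "pd p 1 = 0"
  using pd_const[of p 1] by simp

lemma pd_var: "pd p (var q) = (if p = q then 1 else 0)"
  by (auto simp: var_def pd_single simp flip: single_one)

lemma pd_power: "pd p (f ^ n) = of_nat n * (f ^ (n - 1) * pd p f)"
proof (induction n)
  case (Suc n)
  then show ?case by (cases n) (simp_all add: pd_mult algebra_simps)
qed simp

lemma pd_commute: "pd p (pd q f) = pd q (pd p f)"
proof (induction f rule: pm_induct)
  case (single M c)
  show ?case
    by (cases "p = q") (simp_all add: pd_single add_mset_commute mult_ac)
qed (simp_all add: pd_add)

lemma gaussian_single: "gaussian w (Poly_Mapping.single M c) = fps_const c * wick w M"
  unfolding gaussian_def by (rule addext_single) simp

lemma gaussian_zero [simp]: "gaussian w 0 = 0"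
  by (simp add: gaussian_def)

lemma gaussian_add: "gaussian w (f + g) = gaussian w f + gaussian w g"
  unfolding gaussian_def by (rule addext_add) (simp_all add: distrib_right flip: fps_const_add)

lemma gaussian_sum: "gaussian w (\<Sum>i\<in>A. f i) = (\<Sum>i\<in>A. gaussian w (f i))"
  by (induction A rule: infinite_finite_induct) (simp_all add: gaussian_add)

lemma gaussian_const_mult: "gaussian w (const c * f) = fps_const c * gaussian w f"
  by (induction f rule: pm_induct)
    (simp_all add: const_def mult_single gaussian_single gaussian_add distrib_left mult.assoc flip: fps_const_mult)

lemma gaussian_of_nat_mult: "gaussian w (of_nat n * f) = of_nat n * gaussian w f"
  using gaussian_const_mult[of w "of_nat n" f] by (simp add: const_of_nat flip: fps_of_nat)

lemma gaussian_one [simp]: "gaussian w 1 = 1"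
  using gaussian_single[of w "{#}" 1] by (simp flip: single_one)

lemma sum_mset_eq_sum_count:
  fixes f :: "'w \<Rightarrow> 'r::comm_semiring_1"
  assumes W: "finite W" "\<And>q. q \<notin> W \<Longrightarrow> f q = 0"
  shows "(\<Sum>q\<in>#M. f q) = (\<Sum>q\<in>W. of_nat (count M q) * f q)"
proof (induction M)
  case (add x M)
  have "(\<Sum>q\<in>W. of_nat (count (add_mset x M) q) * f q) =
      (\<Sum>q\<in>W. (if q = x then f q else 0) + of_nat (count M q) * f q)"
    by (intro sum.cong refl) (simp add: distrib_right)
  also have "\<dots> = (\<Sum>q\<in>W. if q = x then f q else 0) + (\<Sum>q\<in>W. of_nat (count M q) * f q)"
    by (rule sum.distrib)
  also have "(\<Sum>q\<in>W. if q = x then f q else 0) = f x"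
    using W by (simp add: sum.delta)
  finally show ?case using add by simp
qed simp

text \<open>Gaussian integration by parts. For a monomial it is the expansion of the hafnian at the dot that
  carries \<open>p\<close>: the variable \<open>q\<close> serves as its partner as many times as it occurs, which is also the
  factor produced by the derivative.\<close>

lemma gaussian_var_mult:
  assumes sym: "\<And>p q. w p q = w q p" and W: "finite W" "\<And>q. q \<notin> W \<Longrightarrow> w p q = 0"
  shows "gaussian w (var p * f) = (\<Sum>q\<in>W. w p q * gaussian w (pd q f))"
proof (induction f rule: pm_induct)
  case (single M c)
  have "wick w (add_mset p M) = (\<Sum>q\<in>#M. w p q * wick w (M - {#q#}))"
    by (rule wick_add) (rule sym)
  also have "\<dots> = (\<Sum>q\<in>W. of_nat (count M q) * (w p q * wick w (M - {#q#})))"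
    by (rule sum_mset_eq_sum_count) (use W in simp_all)
  finally have *: "wick w (add_mset p M) = (\<Sum>q\<in>W. of_nat (count M q) * (w p q * wick w (M - {#q#})))" .
  have "gaussian w (var p * Poly_Mapping.single M c) = fps_const c * wick w (add_mset p M)"
    by (simp add: var_def mult_single gaussian_single)
  also have "\<dots> = (\<Sum>q\<in>W. w p q * (fps_const (of_nat (count M q) * c) * wick w (M - {#q#})))"
    unfolding * sum_distrib_left
    by (intro sum.cong refl) (simp add: mult_ac flip: fps_of_nat fps_const_mult)
  finally show ?case by (simp add: pd_single gaussian_single)
qed (simp_all add: gaussian_add pd_add distrib_left sum.distrib)

text \<open>The variable \<open>Top i\<close> is called \<open>y\<^sub>i\<close> and stands for a top dot with index \<open>i\<close>, the variable
  \<open>Bottom i\<close> is called \<open>x\<^sub>i\<close> and stands for a bottom dot. Only edges within the top row are marked by \<open>u\<close>, as the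
  symmetrizer counts the horizontal edges of this row.\<close>

fun form_weight :: "nat \<Rightarrow> dot \<Rightarrow> dot \<Rightarrow> 'a::comm_ring_1 fps" where
  "form_weight N (Top i) (Top j) = (if i \<in> {1..N} \<and> j = reflect N i then fps_X else 0)"
| "form_weight N (Top i) (Bottom j) = (if i \<in> {1..N} \<and> j = i then 1 else 0)"
| "form_weight N (Bottom i) (Top j) = (if i \<in> {1..N} \<and> j = i then 1 else 0)"
| "form_weight N (Bottom i) (Bottom j) = (if i \<in> {1..N} \<and> j = reflect N i then 1 else 0)"

lemma form_weight_sym: "form_weight N p q = form_weight N q p"
proof -
  have "i \<in> {1..N} \<and> j = reflect N i \<longleftrightarrow> j \<in> {1..N} \<and> i = reflect N j" for i j
    using reflect_in reflect_reflect by metis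
  then show ?thesis by (cases p; cases q) auto
qed

abbreviation expect :: "nat \<Rightarrow> (dot multiset \<Rightarrow>\<^sub>0 'a::comm_ring_1) \<Rightarrow> 'a fps" where
  "expect N \<equiv> gaussian (form_weight N)"

lemma expect_Top:
  assumes "i \<in> {1..N}"
  shows "expect N (var (Top i) * f) =
    expect N (pd (Bottom i) f) + fps_X * expect N (pd (Top (reflect N i)) f)"
proof -
  have "expect N (var (Top i) * f) =
      (\<Sum>q\<in>{Bottom i, Top (reflect N i)}. form_weight N (Top i) q * expect N (pd q f))"
  proof (rule gaussian_var_mult[OF form_weight_sym])
    show "form_weight N (Top i) q = 0" if "q \<notin> {Bottom i, Top (reflect N i)}" for q
      using that by (cases q) auto
  qed simp
  then show ?thesis using assms by simp
qed

lemma expect_Bottom: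
  assumes "i \<in> {1..N}"
  shows "expect N (var (Bottom i) * f) =
    expect N (pd (Top i) f) + expect N (pd (Bottom (reflect N i)) f)"
proof -
  have "expect N (var (Bottom i) * f) =
      (\<Sum>q\<in>{Top i, Bottom (reflect N i)}. form_weight N (Bottom i) q * expect N (pd q f))"
  proof (rule gaussian_var_mult[OF form_weight_sym])
    show "form_weight N (Bottom i) q = 0" if "q \<notin> {Top i, Bottom (reflect N i)}" for q
      using that by (cases q) auto
  qed simp
  then show ?thesis using assms by simp
qed

lemma expect_outside:
  fixes f :: "dot multiset \<Rightarrow>\<^sub>0 'a::comm_ring_1"
  assumes "i \<notin> {1..N}"
  shows "expect N (var (Top i) * f) = 0" "expect N (var (Bottom i) * f) = 0"
proof -
  have *: "expect N (var p * f) = 0" if "\<And>q. form_weight N p q = (0 :: 'a fps)" for p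
  proof -
    have "expect N (var p * f) = (\<Sum>q\<in>{}. form_weight N p q * expect N (pd q f))"
      by (rule gaussian_var_mult[OF form_weight_sym]) (use that in auto)
    then show ?thesis by simp
  qed
  have "form_weight N (Top i) q = (0 :: 'a fps)" "form_weight N (Bottom i) q = (0 :: 'a fps)" for q
    using assms by (cases q; auto)+
  then show "expect N (var (Top i) * f) = 0" "expect N (var (Bottom i) * f) = 0"
    by (simp_all only: *)
qed

lemma sum_reflect: "(\<Sum>i=1..N. g (reflect N i)) = (\<Sum>i=1..N. g i)"
  by (rule sum.reindex_bij_betw[OF bij_reflect])

section \<open>Tracing out one tensor factor\<close>

definition laplace :: "nat \<Rightarrow> (dot multiset \<Rightarrow>\<^sub>0 'a::comm_ring_1) \<Rightarrow> (dot multiset \<Rightarrow>\<^sub>0 'a)" where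
  "laplace N f = (\<Sum>i=1..N. pd (Top i) (pd (Top (reflect N i)) f))"

lemma laplace_add: "laplace N (f + g) = laplace N f + laplace N g"
  by (simp add: laplace_def pd_add sum.distrib)

lemma laplace_pd: "laplace N (pd p f) = pd p (laplace N f)"
  unfolding laplace_def pd_sum
  by (intro sum.cong refl) (metis pd_commute)

lemma laplace_Top:
  assumes i: "i \<in> {1..N}"
  shows "laplace N (var (Top i) * f) = var (Top i) * laplace N f + 2 * pd (Top (reflect N i)) f"
proof -
  have eq: "reflect N k = i \<longleftrightarrow> k = reflect N i" if "k \<in> {1..N}" for k
    using that i reflect_reflect by metis
  have "pd (Top k) (pd (Top (reflect N k)) (var (Top i) * f)) =
      (if k = reflect N i then pd (Top (reflect N i)) f else 0) +
      (if k = i then pd (Top (reflect N i)) f else 0) +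
      var (Top i) * pd (Top k) (pd (Top (reflect N k)) f)" if "k \<in> {1..N}" for k
    by (simp add: pd_mult pd_var pd_add eq[OF that] add_ac)
  then have "laplace N (var (Top i) * f) =
      (\<Sum>k=1..N. (if k = reflect N i then pd (Top (reflect N i)) f else 0) +
      (if k = i then pd (Top (reflect N i)) f else 0) +
      var (Top i) * pd (Top k) (pd (Top (reflect N k)) f))"
    unfolding laplace_def by (intro sum.cong refl)
  also have "\<dots> = pd (Top (reflect N i)) f + pd (Top (reflect N i)) f + var (Top i) * laplace N f"
    using i reflect_in[OF i] by (simp add: sum.distrib laplace_def sum_distrib_left sum.delta)
  finally show ?thesis
    by (simp only: mult_2 add.commute[of "var (Top i) * laplace N f"])
qed

lemma laplace_other:
  assumes "\<And>i. i \<in> {1..N} \<Longrightarrow> p \<noteq> Top i"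
  shows "laplace N (var p * f) = var p * laplace N f"
proof -
  have *: "pd (Top i) (var p) = 0" if "i \<in> {1..N}" for i
    using assms[OF that] by (auto simp: pd_var)
  have "pd (Top i) (pd (Top (reflect N i)) (var p * f)) =
      var p * pd (Top i) (pd (Top (reflect N i)) f)" if "i \<in> {1..N}" for i
    by (simp add: pd_mult *[OF that] *[OF reflect_in[OF that]])
  then show ?thesis
    unfolding laplace_def sum_distrib_left by (rule sum.cong[OF refl])
qed

text \<open>Only the covariance of two top variables depends on \<open>u\<close>, hence the derivative with respect to \<open>u\<close>
  carries out one contraction of two top variables. The Laplace operator sees every unordered pair
  twice. The proof is an induction on the degree by means of integration by parts.\<close>

lemma expect_laplace:
  fixes f :: "dot multiset \<Rightarrow>\<^sub>0 'a::comm_ring_1"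
  shows "expect N (laplace N f) = 2 * fps_deriv (expect N f)"
proof -
  have single: "expect N (laplace N (Poly_Mapping.single M c)) =
      2 * fps_deriv (expect N (Poly_Mapping.single M c))" for M and c :: 'a
  proof (induction "size M" arbitrary: M c rule: less_induct)
    case less
    show ?case
    proof (cases M)
      case empty
      have "wick (form_weight N) {#} = (1 :: 'a fps)" by simp
      then show ?thesis
        by (simp add: empty laplace_def pd_single gaussian_single )
    next
      case (add p K)
      define f where "f = Poly_Mapping.single K c"
      have M: "Poly_Mapping.single M c = var p * f"
        by (simp add: f_def var_def mult_single add)
      have IH: "expect N (pd q (laplace N f)) = 2 * fps_deriv (expect N (pd q f))" for q
      proof -
        have "size (K - {#q#}) < size M"
          by (simp add: add less_Suc_eq_le size_Diff1_le)
        from less.hyps[OF this] show ?thesis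
          by (simp add: f_def pd_single flip: laplace_pd)
      qed
      show ?thesis
      proof (cases p)
        case (Top i)
        show ?thesis
        proof (cases "i \<in> {1..N}")
          case True
          let ?a = "expect N (pd (Bottom i) f)" and ?b = "expect N (pd (Top (reflect N i)) f)"
          have "expect N (laplace N (var (Top i) * f)) =
              2 * fps_deriv ?a + fps_X * (2 * fps_deriv ?b) + 2 * ?b"
            unfolding laplace_Top[OF True] gaussian_add mult_2[of "pd (Top (reflect N i)) f"]
            by (simp only: expect_Top[OF True] IH mult_2[of ?b])
          also have "\<dots> = 2 * fps_deriv (?a + fps_X * ?b)"
            by (simp only: fps_deriv_add fps_deriv_mult fps_deriv_fps_X distrib_left mult_1_left
                add.assoc mult.left_commute[of fps_X])
          finally show ?thesis by (simp only: M Top expect_Top[OF True])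
        next
          case False
          then have "laplace N (var (Top i) * f) = var (Top i) * laplace N f"
            by (intro laplace_other) auto
          with False show ?thesis by (simp add: M Top expect_outside)
        qed
      next
        case (Bottom i)
        have lap: "laplace N (var (Bottom i) * f) = var (Bottom i) * laplace N f"
          by (rule laplace_other) simp
        show ?thesis
          by (cases "i \<in> {1..N}")
            (simp_all only: M Bottom lap expect_Bottom expect_outside IH fps_deriv_add distrib_left
              fps_deriv_0 mult_zero_right not_False_eq_True)
      qed
    qed
  qed
  have "laplace N (0 :: dot multiset \<Rightarrow>\<^sub>0 'a) = 0"
    by (simp add: laplace_def)
  then show ?thesis
    by (induction f rule: pm_induct)
      (simp_all only: laplace_add gaussian_add gaussian_zero fps_deriv_add single distrib_left
        fps_deriv_0 mult_zero_right)
qed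

definition identity_form :: "nat \<Rightarrow> (dot multiset \<Rightarrow>\<^sub>0 'a::comm_ring_1)" where
  "identity_form N = (\<Sum>i=1..N. var (Top i) * var (Bottom i))"

text \<open>Contract \<open>y\<^sub>i\<close> and then \<open>x\<^sub>i\<close> in \<open>\<Sum> y\<^sub>i x\<^sub>i f\<close>. Two expressions with second derivatives of \<open>f\<close> remain: one
  is the Laplace operator, which is a derivative with respect to \<open>u\<close>, and the other is
  eliminated by the Euler identity in the top variables. In terms of diagrams, a node carrying the identity matrix
  is inserted into an edge of a diagram with one node fewer, and the result depends on whether this
  edge is vertical or horizontal.\<close>

lemma expect_identity_form:
  fixes f :: "dot multiset \<Rightarrow>\<^sub>0 'a::comm_ring_1"
  assumes top: "(\<Sum>i=1..N. var (Top i) * pd (Top i) f) = of_nat n * f"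
    and bottom: "(\<Sum>i=1..N. var (Bottom i) * pd (Bottom i) f) = of_nat n * f"
  shows "expect N (identity_form N * f) =
    (of_nat N + of_nat n * (1 + fps_X)) * expect N f
      + 2 * fps_X * (1 - fps_X) * fps_deriv (expect N f)"
proof -
  define u :: "'a fps" where "u = fps_X"
  define C where "C = (\<Sum>i=1..N. pd (Top i) (pd (Bottom i) f))"
  have eTop: "expect N (var (Top i) * g) = expect N (pd (Bottom i) g) + u * expect N (pd (Top (reflect N i)) g)"
    if "i \<in> {1..N}" for i g
    unfolding u_def by (rule expect_Top[OF that])
  have "of_nat n * expect N f = (\<Sum>i=1..N. expect N (var (Top i) * pd (Top i) f))"
    by (simp only: gaussian_sum[symmetric] top gaussian_of_nat_mult)
  also have "\<dots> = (\<Sum>i=1..N. expect N (pd (Bottom i) (pd (Top i) f))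
      + u * expect N (pd (Top (reflect N i)) (pd (Top i) f)))"
    by (intro sum.cong refl) (simp add: eTop)
  also have "\<dots> = expect N C + u * expect N (laplace N f)"
    by (simp add: C_def laplace_def gaussian_sum sum.distrib sum_distrib_left pd_commute)
  finally have euler: "of_nat n * expect N f = expect N C + u * expect N (laplace N f)" .
  have "expect N (identity_form N * f) =
      (\<Sum>i=1..N. expect N (var (Top i) * (var (Bottom i) * f)))"
    by (simp add: identity_form_def sum_distrib_right gaussian_sum mult.assoc)
  also have "\<dots> = (\<Sum>i=1..N. expect N f + expect N (var (Bottom i) * pd (Bottom i) f)
      + u * (expect N (pd (Top i) (pd (Top (reflect N i)) f))
           + expect N (pd (Bottom (reflect N i)) (pd (Top (reflect N i)) f))))"
    by (intro sum.cong refl) (simp add: eTop pd_mult pd_var gaussian_add expect_Bottom)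
  also have "\<dots> = of_nat N * expect N f + of_nat n * expect N f
      + u * (expect N (laplace N f) + expect N C)"
  proof -
    have "(\<Sum>i=1..N. expect N (var (Bottom i) * pd (Bottom i) f)) = of_nat n * expect N f"
      by (simp only: gaussian_sum[symmetric] bottom gaussian_of_nat_mult)
    moreover have "(\<Sum>i=1..N. expect N (pd (Bottom (reflect N i)) (pd (Top (reflect N i)) f))) = expect N C"
      unfolding sum_reflect[of "\<lambda>i. expect N (pd (Bottom i) (pd (Top i) f))"]
      by (simp add: C_def gaussian_sum pd_commute)
    ultimately show ?thesis
      by (simp only: sum.distrib sum_distrib_left[symmetric]) (simp add: laplace_def gaussian_sum)
  qed
  also have "\<dots> = (of_nat N + of_nat n * (1 + u)) * expect N f + u * (1 - u) * expect N (laplace N f)"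
  proof -
    have C: "expect N C = of_nat n * expect N f - u * expect N (laplace N f)"
      by (simp add: euler)
    show ?thesis unfolding C by (simp add: algebra_simps)
  qed
  finally show ?thesis unfolding expect_laplace u_def by (simp only: mult_ac)
qed

section \<open>Newton's identity for the inverse of a characteristic polynomial\<close>

definition mat_prod :: "nat \<Rightarrow> (nat \<Rightarrow> nat \<Rightarrow> 'a::semiring_1) \<Rightarrow> (nat \<Rightarrow> nat \<Rightarrow> 'a) \<Rightarrow> nat \<Rightarrow> nat \<Rightarrow> 'a" where
  "mat_prod N A B i j = (\<Sum>p=1..N. A i p * B p j)"

primrec mat_pow :: "nat \<Rightarrow> (nat \<Rightarrow> nat \<Rightarrow> 'a::semiring_1) \<Rightarrow> nat \<Rightarrow> nat \<Rightarrow> nat \<Rightarrow> 'a" where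
  "mat_pow N A 0 = (\<lambda>i j. if i = j then 1 else 0)"
| "mat_pow N A (Suc k) = mat_prod N A (mat_pow N A k)"

definition mat_trace :: "nat \<Rightarrow> (nat \<Rightarrow> nat \<Rightarrow> 'a::semiring_1) \<Rightarrow> 'a" where
  "mat_trace N A = (\<Sum>i=1..N. A i i)"

lemma fps_deriv_prod:
  fixes f :: "'i \<Rightarrow> 'a::comm_ring_1 fps"
  assumes "finite S"
  shows "fps_deriv (\<Prod>i\<in>S. f i) = (\<Sum>i\<in>S. fps_deriv (f i) * (\<Prod>k\<in>S - {i}. f k))"
  using assms
proof (induction S)
  case (insert a S)
  have "(\<Prod>k\<in>insert a S - {i}. f k) = f a * (\<Prod>k\<in>S - {i}. f k)" if "i \<in> S" for i
  proof -
    have "insert a S - {i} = insert a (S - {i})" using that insert.hyps by blast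
    then show ?thesis using insert.hyps by simp
  qed
  then have "(\<Sum>i\<in>S. fps_deriv (f i) * (\<Prod>k\<in>insert a S - {i}. f k)) =
      f a * (\<Sum>i\<in>S. fps_deriv (f i) * (\<Prod>k\<in>S - {i}. f k))"
    unfolding sum_distrib_left by (intro sum.cong refl) (simp add: mult.left_commute)
  moreover have "insert a S - {a} = S" using insert.hyps by blast
  ultimately show ?case using insert by (simp add: add.commute)
qed simp

text \<open>Jacobi's formula: the determinant is differentiated row by row, and the determinant with the
  differentiated row is expanded along this row, where it has the cofactors of the original matrix.\<close>

lemma fps_deriv_det:
  fixes A :: "'a::comm_ring_1 fps mat"
  assumes A: "A \<in> carrier_mat n n"
  shows "fps_deriv (det A) = (\<Sum>i<n. \<Sum>j<n. fps_deriv (A $$ (i, j)) * cofactor A i j)"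
proof -
  define B where "B i = mat n n (\<lambda>(k, j). if k = i then fps_deriv (A $$ (i, j)) else A $$ (k, j))" for i
  have B: "B i \<in> carrier_mat n n" for i by (simp add: B_def)
  have sign: "fps_deriv (signof p * g) = signof p * fps_deriv g" for p :: "nat \<Rightarrow> nat" and g :: "'a fps"
    by (simp add: sign_def)
  have row: "fps_deriv (\<Prod>i=0..<n. A $$ (i, p i)) = (\<Sum>i<n. \<Prod>k=0..<n. B i $$ (k, p k))"
    if p: "p permutes {0..<n}" for p
  proof -
    have pn: "p k < n" if "k < n" for k using p that permutes_in_image[of p "{0..<n}" k] by simp
    have "fps_deriv (\<Prod>i=0..<n. A $$ (i, p i)) =
        (\<Sum>i\<in>{0..<n}. fps_deriv (A $$ (i, p i)) * (\<Prod>k\<in>{0..<n} - {i}. A $$ (k, p k)))"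
      by (rule fps_deriv_prod) simp
    also have "\<dots> = (\<Sum>i\<in>{0..<n}. \<Prod>k=0..<n. B i $$ (k, p k))"
    proof (rule sum.cong[OF refl])
      fix i assume i: "i \<in> {0..<n}"
      have "(\<Prod>k=0..<n. B i $$ (k, p k)) = B i $$ (i, p i) * (\<Prod>k\<in>{0..<n} - {i}. B i $$ (k, p k))"
        by (rule prod.remove) (use i in auto)
      also have "(\<Prod>k\<in>{0..<n} - {i}. B i $$ (k, p k)) = (\<Prod>k\<in>{0..<n} - {i}. A $$ (k, p k))"
        by (rule prod.cong) (auto simp: B_def pn)
      also have "B i $$ (i, p i) = fps_deriv (A $$ (i, p i))" using i by (simp add: B_def pn)
      finally show "fps_deriv (A $$ (i, p i)) * (\<Prod>k\<in>{0..<n} - {i}. A $$ (k, p k)) =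
          (\<Prod>k=0..<n. B i $$ (k, p k))" by simp
    qed
    finally show ?thesis by (simp add: atLeast0LessThan)
  qed
  have "fps_deriv (det A) =
      (\<Sum>p | p permutes {0..<n}. fps_deriv (signof p * (\<Prod>i=0..<n. A $$ (i, p i))))"
    by (simp add: det_def'[OF A] fps_deriv_sum)
  also have "\<dots> = (\<Sum>p | p permutes {0..<n}. \<Sum>i<n. signof p * (\<Prod>k=0..<n. B i $$ (k, p k)))"
    by (intro sum.cong refl) (simp add: sign row sum_distrib_left)
  also have "\<dots> = (\<Sum>i<n. det (B i))"
    by (subst sum.swap) (simp add: det_def'[OF B])
  also have "\<dots> = (\<Sum>i<n. \<Sum>j<n. fps_deriv (A $$ (i, j)) * cofactor A i j)"
  proof (rule sum.cong[OF refl])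
    fix i assume i: "i \<in> {..<n}"
    have "mat_delete (B i) i j = mat_delete A i j" for j
      using A by (intro eq_matI) (auto simp: mat_delete_def B_def)
    then have cof: "cofactor (B i) i j = cofactor A i j" for j
      by (simp add: cofactor_def)
    have "det (B i) = (\<Sum>j<n. B i $$ (i, j) * cofactor (B i) i j)"
      by (rule laplace_expansion_row[OF B]) (use i in simp)
    also have "\<dots> = (\<Sum>j<n. fps_deriv (A $$ (i, j)) * cofactor A i j)"
      by (rule sum.cong[OF refl]) (use i cof in \<open>simp add: B_def\<close>)
    finally show "det (B i) = (\<Sum>j<n. fps_deriv (A $$ (i, j)) * cofactor A i j)" .
  qed
  finally show ?thesis .
qed

definition char_mat :: "nat \<Rightarrow> (nat \<Rightarrow> nat \<Rightarrow> 'a::comm_ring_1) \<Rightarrow> 'a fps mat" where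
  "char_mat N F = 1\<^sub>m N - mat N N (\<lambda>(i, j). fps_X * fps_const (F (i + 1) (j + 1)))"

lemma char_mat_carrier: "char_mat N F \<in> carrier_mat N N"
  unfolding char_mat_def by (rule minus_carrier_mat) simp

lemma char_mat_index:
  "i < N \<Longrightarrow> j < N \<Longrightarrow>
    char_mat N F $$ (i, j) = (if i = j then 1 else 0) - fps_X * fps_const (F (i + 1) (j + 1))"
  by (simp add: char_mat_def)

lemma det_char_mat_0: "fps_nth (det (char_mat N F)) 0 = 1"
proof -
  interpret comm_ring_hom "\<lambda>f :: 'a fps. fps_nth f 0"
    by standard simp_all
  have "map_mat (\<lambda>f. fps_nth f 0) (char_mat N F) = 1\<^sub>m N"
    by (rule eq_matI) (simp_all add: char_mat_def)
  then show ?thesis using hom_det[of "char_mat N F"] by simp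
qed

lemma sum_shift_index: "(\<Sum>i=0..<N. g (i + 1)) = (\<Sum>i=1..N. g i)" for N :: nat
  by (rule sum.reindex_bij_witness[of _ "\<lambda>i. i - 1" Suc]) auto

text \<open>The geometric series \<open>G = \<Sum> q\<^sup>k F\<^sup>k\<close> is inverse to \<open>1 - qF\<close>, so the adjugate matrix is the determinant times
  \<open>G\<close>, and Jacobi's formula becomes a statement about traces of powers.\<close>

lemma fps_deriv_det_char_mat:
  "fps_deriv (det (char_mat N F)) =
    - det (char_mat N F) * Abs_fps (\<lambda>k. mat_trace N (mat_pow N F (Suc k)))"
proof -
  let ?M = "char_mat N F"
  define G where "G = mat N N (\<lambda>(i, j). Abs_fps (\<lambda>k. mat_pow N F k (i + 1) (j + 1)))"
  have G: "G \<in> carrier_mat N N" by (simp add: G_def)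
  note M = char_mat_carrier[of N F]
  have "?M * G = 1\<^sub>m N"
  proof (rule eq_matI)
    fix i j assume "i < dim_row (1\<^sub>m N :: 'a fps mat)" "j < dim_col (1\<^sub>m N :: 'a fps mat)"
    then have ij: "i < N" "j < N" by simp_all
    have "(?M * G) $$ (i, j) = (\<Sum>p=0..<N. ?M $$ (i, p) * G $$ (p, j))"
      using ij M G by (simp add: scalar_prod_def)
    also have "\<dots> = (\<Sum>p=0..<N. (if i = p then G $$ (p, j) else 0) -
        fps_X * (fps_const (F (i + 1) (p + 1)) * G $$ (p, j)))"
      by (rule sum.cong) (use ij in \<open>auto simp: char_mat_index left_diff_distrib mult.assoc\<close>)
    also have "\<dots> = G $$ (i, j) - fps_X * (\<Sum>p=0..<N. fps_const (F (i + 1) (p + 1)) * G $$ (p, j))"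
      using ij by (simp add: sum_subtractf sum_distrib_left)
    also have "\<dots> = (if i = j then 1 else 0)"
    proof (rule fps_ext)
      fix k
      show "fps_nth (G $$ (i, j) - fps_X * (\<Sum>p=0..<N. fps_const (F (i + 1) (p + 1)) * G $$ (p, j))) k
          = fps_nth (if i = j then 1 else 0) k"
      proof (cases k)
        case 0
        then show ?thesis using ij by (simp add: G_def)
      next
        case (Suc l)
        have "(\<Sum>p=0..<N. F (i + 1) (p + 1) * mat_pow N F l (p + 1) (j + 1)) = mat_pow N F (Suc l) (i + 1) (j + 1)"
          by (subst sum_shift_index) (simp add: mat_prod_def)
        then show ?thesis using ij by (simp add: G_def Suc fps_sum_nth)
      qed
    qed
    finally show "(?M * G) $$ (i, j) = (1\<^sub>m N :: 'a fps mat) $$ (i, j)" using ij by simp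
  qed (use M G in auto)
  then have "adj_mat ?M = (adj_mat ?M * ?M) * G"
    using assoc_mult_mat[OF adj_mat(1)[OF M] M G] adj_mat(1)[OF M] by simp
  also have "\<dots> = det ?M \<cdot>\<^sub>m G"
    using G by (simp add: adj_mat(3)[OF M] mult_smult_assoc_mat[OF one_carrier_mat G])
  finally have adj: "adj_mat ?M = det ?M \<cdot>\<^sub>m G" .
  have cof: "cofactor ?M i j = det ?M * G $$ (j, i)" if "i < N" "j < N" for i j
  proof -
    have "cofactor ?M i j = adj_mat ?M $$ (j, i)"
      using that M by (simp add: adj_mat_def)
    then show ?thesis using that G by (simp add: adj)
  qed
  have "fps_deriv (det ?M) = (\<Sum>i<N. \<Sum>j<N. fps_deriv (?M $$ (i, j)) * cofactor ?M i j)"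
    by (rule fps_deriv_det[OF M])
  also have "\<dots> = (\<Sum>i<N. \<Sum>j<N. - det ?M * (fps_const (F (i + 1) (j + 1)) * G $$ (j, i)))"
    by (intro sum.cong refl) (simp add: char_mat_index cof if_distrib[of fps_deriv] mult.left_commute flip: fps_const_neg)
  also have "\<dots> = - det ?M * (\<Sum>i<N. \<Sum>j<N. fps_const (F (i + 1) (j + 1)) * G $$ (j, i))"
    by (simp only: sum_distrib_left)
  also have "(\<Sum>i<N. \<Sum>j<N. fps_const (F (i + 1) (j + 1)) * G $$ (j, i)) =
      Abs_fps (\<lambda>k. mat_trace N (mat_pow N F (Suc k)))"
  proof (rule fps_ext)
    fix k
    have "fps_nth (\<Sum>i<N. \<Sum>j<N. fps_const (F (i + 1) (j + 1)) * G $$ (j, i)) k =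
        (\<Sum>i=0..<N. \<Sum>j=0..<N. F (i + 1) (j + 1) * mat_pow N F k (j + 1) (i + 1))"
      by (simp add: fps_sum_nth G_def atLeast0LessThan)
    also have "\<dots> = (\<Sum>i=0..<N. \<Sum>j=1..N. F (i + 1) j * mat_pow N F k j (i + 1))"
      by (subst sum_shift_index) simp
    also have "\<dots> = (\<Sum>i=1..N. \<Sum>j=1..N. F i j * mat_pow N F k j i)"
      by (rule sum_shift_index)
    finally show "fps_nth (\<Sum>i<N. \<Sum>j<N. fps_const (F (i + 1) (j + 1)) * G $$ (j, i)) k =
        fps_nth (Abs_fps (\<lambda>k. mat_trace N (mat_pow N F (Suc k)))) k"
      by (simp add: mat_trace_def mat_prod_def)
  qed
  finally show ?thesis .
qed

text \<open>As \<open>h\<close> is the inverse of the determinant, its logarithmic derivative is the series of traces of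
  powers; this is Newton's identity between complete homogeneous functions and power sums.\<close>

lemma newton_identity:
  fixes F :: "nat \<Rightarrow> nat \<Rightarrow> 'a::comm_ring_1" and N :: nat
  defines "h \<equiv> fps_right_inverse (det (char_mat N F)) 1"
  shows "fps_nth h 0 = 1"
    and "of_nat (Suc k) * fps_nth h (Suc k) =
      (\<Sum>i=0..k. fps_nth h i * mat_trace N (mat_pow N F (Suc (k - i))))"
proof -
  let ?D = "det (char_mat N F)" and ?S = "Abs_fps (\<lambda>k. mat_trace N (mat_pow N F (Suc k)))"
  have inv: "?D * h = 1"
    unfolding h_def by (rule fps_right_inverse) (simp add: det_char_mat_0)
  from arg_cong[OF this, of "\<lambda>f. fps_nth f 0"] show "fps_nth h 0 = 1"
    by (simp add: det_char_mat_0)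
  have "fps_deriv (?D * h) = 0" by (simp add: inv)
  then have "?D * fps_deriv h = ?D * (h * ?S)"
    by (simp add: fps_deriv_det_char_mat algebra_simps)
  then have "h * (?D * fps_deriv h) = h * (?D * (h * ?S))" by simp
  then have "(?D * h) * fps_deriv h = (?D * h) * (h * ?S)"
    by (simp only: mult_ac)
  then have "fps_deriv h = h * ?S" by (simp add: inv)
  from arg_cong[OF this, of "\<lambda>f. fps_nth f k"]
  show "of_nat (Suc k) * fps_nth h (Suc k) =
      (\<Sum>i=0..k. fps_nth h i * mat_trace N (mat_pow N F (Suc (k - i))))"
    by (simp add: fps_mult_nth)
qed

section \<open>Moments of a skew form\<close>

definition mixed_form :: "nat \<Rightarrow> (nat \<Rightarrow> nat \<Rightarrow> 'a::comm_ring_1) \<Rightarrow> (dot multiset \<Rightarrow>\<^sub>0 'a)" where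
  "mixed_form N A = (\<Sum>j=1..N. \<Sum>i=1..N. const (A j i) * (var (Top j) * var (Bottom i)))"

text \<open>Contracting the top variables of two mixed forms leaves two bottom variables; a reflection is built
  in so that the contraction of these is again the trace of the matrix.\<close>

definition bottom_form :: "nat \<Rightarrow> (nat \<Rightarrow> nat \<Rightarrow> 'a::comm_ring_1) \<Rightarrow> (dot multiset \<Rightarrow>\<^sub>0 'a)" where
  "bottom_form N B = (\<Sum>i=1..N. \<Sum>p=1..N. const (B i p) * (var (Bottom (reflect N i)) * var (Bottom p)))"

text \<open>Transposition with respect to the form that pairs \<open>i\<close> with \<open>i' = N - i + 1\<close>.\<close>

definition mat_transp :: "nat \<Rightarrow> (nat \<Rightarrow> nat \<Rightarrow> 'a) \<Rightarrow> nat \<Rightarrow> nat \<Rightarrow> 'a" where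
  "mat_transp N A i j = A (reflect N j) (reflect N i)"

lemma sum_delta_range:
  "j \<in> {1..N} \<Longrightarrow> (\<Sum>i=1..N. if i = j then g i else 0) = g j"
  "j \<in> {1..N} \<Longrightarrow> (\<Sum>i=1..N. if j = i then g i else 0) = g j"
  for N :: nat
  by (simp_all only: sum.delta sum.delta' finite_atLeastAtMost if_True)

lemma pd_Top_mixed_form:
  assumes "j \<in> {1..N}"
  shows "pd (Top j) (mixed_form N A) = (\<Sum>i=1..N. const (A j i) * var (Bottom i))"
proof -
  have "pd (Top j) (mixed_form N A) =
      (\<Sum>k=1..N. if k = j then \<Sum>i=1..N. const (A k i) * var (Bottom i) else 0)"
    unfolding mixed_form_def pd_sum
    by (intro sum.cong refl) (auto simp: pd_mult pd_var)
  then show ?thesis by (simp only: sum_delta_range(1)[OF assms])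
qed

lemma pd_Bottom_mixed_form:
  assumes "i \<in> {1..N}"
  shows "pd (Bottom i) (mixed_form N A) = (\<Sum>j=1..N. const (A j i) * var (Top j))"
proof -
  have "pd (Bottom i) (mixed_form N A) =
      (\<Sum>j=1..N. \<Sum>k=1..N. if k = i then const (A j k) * var (Top j) else 0)"
    unfolding mixed_form_def pd_sum
    by (intro sum.cong refl) (auto simp: pd_mult pd_var)
  then show ?thesis by (simp only: sum_delta_range(1)[OF assms])
qed

lemma sum_rotate: "(\<Sum>j\<in>A. \<Sum>i\<in>B. \<Sum>p\<in>C. g j i p) = (\<Sum>p\<in>C. \<Sum>i\<in>B. \<Sum>j\<in>A. g j i p)"
proof -
  have "(\<Sum>j\<in>A. \<Sum>i\<in>B. \<Sum>p\<in>C. g j i p) = (\<Sum>j\<in>A. \<Sum>p\<in>C. \<Sum>i\<in>B. g j i p)"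
    by (intro sum.cong refl) (rule sum.swap)
  also have "\<dots> = (\<Sum>p\<in>C. \<Sum>j\<in>A. \<Sum>i\<in>B. g j i p)" by (rule sum.swap)
  also have "\<dots> = (\<Sum>p\<in>C. \<Sum>i\<in>B. \<Sum>j\<in>A. g j i p)"
    by (intro sum.cong refl) (rule sum.swap)
  finally show ?thesis .
qed

lemma mixed_form_mat_prod:
  "mixed_form N (mat_prod N F A) =
    (\<Sum>j=1..N. \<Sum>i=1..N. const (A j i) * (var (Bottom i) * (\<Sum>p=1..N. const (F p j) * var (Top p))))"
proof -
  have "mixed_form N (mat_prod N F A) =
      (\<Sum>p=1..N. \<Sum>i=1..N. \<Sum>j=1..N. const (A j i) * (var (Bottom i) * (const (F p j) * var (Top p))))"
    unfolding mixed_form_def mat_prod_def const_sum sum_distrib_right const_mult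
    by (intro sum.cong refl) (simp only: mult_ac)
  also have "\<dots> = (\<Sum>j=1..N. \<Sum>i=1..N. \<Sum>p=1..N. const (A j i) * (var (Bottom i) * (const (F p j) * var (Top p))))"
    by (rule sum_rotate)
  finally show ?thesis by (simp only: sum_distrib_left)
qed

lemma bottom_form_transp_prod:
  "bottom_form N (mat_prod N (mat_transp N A) F) =
    (\<Sum>j=1..N. \<Sum>i=1..N. const (A j i) * (var (Bottom i) * (\<Sum>p=1..N. const (F (reflect N j) p) * var (Bottom p))))"
proof -
  let ?g = "\<lambda>j i p. const (A j i) * (var (Bottom i) * (const (F (reflect N j) p) * var (Bottom p)))"
  have "bottom_form N (mat_prod N (mat_transp N A) F) =
      (\<Sum>i=1..N. \<Sum>p=1..N. \<Sum>j=1..N. ?g (reflect N j) (reflect N i) p)"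
    unfolding bottom_form_def mat_prod_def mat_transp_def const_sum sum_distrib_right const_mult
  proof (intro sum.cong refl)
    fix i p j assume "j \<in> {1..N}"
    then show "const (A (reflect N j) (reflect N i)) * const (F j p) *
        (var (Bottom (reflect N i)) * var (Bottom p)) = ?g (reflect N j) (reflect N i) p"
      by (simp only: reflect_reflect mult_ac)
  qed
  also have "\<dots> = (\<Sum>i=1..N. \<Sum>p=1..N. \<Sum>j=1..N. ?g (reflect N j) i p)"
    by (rule sum_reflect[where g = "\<lambda>i. \<Sum>p=1..N. \<Sum>j=1..N. ?g (reflect N j) i p"])
  also have "\<dots> = (\<Sum>i=1..N. \<Sum>p=1..N. \<Sum>j=1..N. ?g j i p)"
  proof (rule sum.cong[OF refl], rule sum.cong[OF refl])
    fix i p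
    show "(\<Sum>j=1..N. ?g (reflect N j) i p) = (\<Sum>j=1..N. ?g j i p)"
      by (rule sum_reflect[where g = "\<lambda>j. ?g j i p"])
  qed
  also have "\<dots> = (\<Sum>i=1..N. \<Sum>j=1..N. \<Sum>p=1..N. ?g j i p)"
    by (rule sum.cong[OF refl], rule sum.swap)
  also have "\<dots> = (\<Sum>j=1..N. \<Sum>i=1..N. \<Sum>p=1..N. ?g j i p)"
    by (rule sum.swap)
  finally show ?thesis by (simp only: sum_distrib_left)
qed

text \<open>The next three lemmas evaluate the contractions of one variable of a quadratic form: with the other
  variable of this form, with a bottom variable of some factor \<open>q\<^sub>F\<close>, or with a top variable of some factor
  \<open>q\<^sub>F\<close>. In the last case the matrix \<open>A\<close> is read backwards and hence transposed.\<close>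

lemma contract_trace:
  fixes g :: "'a::comm_ring_1 fps"
  shows "(\<Sum>j=1..N. \<Sum>i=1..N. fps_const (A j i) * ((if i = j then 1 else 0) * g)) = fps_const (mat_trace N A) * g"
proof -
  have "(\<Sum>j=1..N. \<Sum>i=1..N. fps_const (A j i) * ((if i = j then 1 else 0) * g)) =
      (\<Sum>j=1..N. \<Sum>i=1..N. if i = j then fps_const (A j i) * g else 0)"
    by (intro sum.cong refl) simp
  also have "\<dots> = (\<Sum>j=1..N. fps_const (A j j) * g)"
    by (intro sum.cong refl) (simp only: sum_delta_range)
  also have "\<dots> = (\<Sum>j=1..N. fps_const (A j j)) * g" by (rule sum_distrib_right[symmetric])
  also have "(\<Sum>j=1..N. fps_const (A j j)) = fps_const (mat_trace N A)"
    unfolding mat_trace_def by (rule fps_ext) (simp add: fps_sum_nth sum.If_cases)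
  finally show ?thesis .
qed

lemma contract_Bottom:
  "(\<Sum>j=1..N. \<Sum>i=1..N. fps_const (A j i) * expect N (var (Bottom i) * pd (Bottom j) (mixed_form N F ^ k))) =
      of_nat k * expect N (mixed_form N (mat_prod N F A) * mixed_form N F ^ (k - 1))"
proof -
  have "(\<Sum>j=1..N. \<Sum>i=1..N. fps_const (A j i) * expect N (var (Bottom i) * pd (Bottom j) (mixed_form N F ^ k))) =
     (\<Sum>j=1..N. \<Sum>i=1..N. of_nat k * expect N (const (A j i) * (var (Bottom i) *
        (\<Sum>p=1..N. const (F p j) * var (Top p))) * mixed_form N F ^ (k - 1)))"
  proof (intro sum.cong refl)
    fix j i assume j: "j \<in> {1..N}"
    have "fps_const (A j i) * expect N (var (Bottom i) * pd (Bottom j) (mixed_form N F ^ k)) =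
        expect N (of_nat k * (const (A j i) * (var (Bottom i) * pd (Bottom j) (mixed_form N F)) * mixed_form N F ^ (k - 1)))"
      by (simp only: gaussian_const_mult[symmetric] pd_power mult_ac)
    then show "fps_const (A j i) * expect N (var (Bottom i) * pd (Bottom j) (mixed_form N F ^ k)) =
        of_nat k * expect N (const (A j i) * (var (Bottom i) *
        (\<Sum>p=1..N. const (F p j) * var (Top p))) * mixed_form N F ^ (k - 1))"
      by (simp only: pd_Bottom_mixed_form[OF j] gaussian_of_nat_mult)
  qed
  then show ?thesis
    by (simp only: mixed_form_mat_prod sum_distrib_left[symmetric] sum_distrib_right[symmetric]
        gaussian_sum[symmetric])
qed

lemma contract_Top:
  "(\<Sum>j=1..N. \<Sum>i=1..N. fps_const (A j i) * expect N (var (Bottom i) * pd (Top (reflect N j)) (mixed_form N F ^ k))) =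
      of_nat k * expect N (bottom_form N (mat_prod N (mat_transp N A) F) * mixed_form N F ^ (k - 1))"
proof -
  have "(\<Sum>j=1..N. \<Sum>i=1..N. fps_const (A j i) * expect N (var (Bottom i) * pd (Top (reflect N j)) (mixed_form N F ^ k))) =
     (\<Sum>j=1..N. \<Sum>i=1..N. of_nat k * expect N (const (A j i) * (var (Bottom i) *
        (\<Sum>p=1..N. const (F (reflect N j) p) * var (Bottom p))) * mixed_form N F ^ (k - 1)))"
  proof (intro sum.cong refl)
    fix j i assume j: "j \<in> {1..N}"
    have "fps_const (A j i) * expect N (var (Bottom i) * pd (Top (reflect N j)) (mixed_form N F ^ k)) =
        expect N (of_nat k * (const (A j i) * (var (Bottom i) * pd (Top (reflect N j)) (mixed_form N F)) * mixed_form N F ^ (k - 1)))"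
      by (simp only: gaussian_const_mult[symmetric] pd_power mult_ac)
    then show "fps_const (A j i) * expect N (var (Bottom i) * pd (Top (reflect N j)) (mixed_form N F ^ k)) =
        of_nat k * expect N (const (A j i) * (var (Bottom i) *
        (\<Sum>p=1..N. const (F (reflect N j) p) * var (Bottom p))) * mixed_form N F ^ (k - 1))"
      by (simp only: pd_Top_mixed_form[OF reflect_in[OF j]] gaussian_of_nat_mult)
  qed
  then show ?thesis
    by (simp only: bottom_form_transp_prod sum_distrib_left[symmetric] sum_distrib_right[symmetric]
        gaussian_sum[symmetric])
qed

text \<open>Contract the top variable of the first form. Either the cycle closes and gives a trace, or one of the
  \<open>k\<close> factors \<open>q\<^sub>F\<close> is absorbed into the first form, which remains mixed if the factor is entered at
  its bottom variable and becomes a bottom form, at the price of \<open>u\<close>, otherwise.\<close>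

lemma mixed_form_mult_expect:
  fixes A F :: "nat \<Rightarrow> nat \<Rightarrow> 'a::comm_ring_1"
  shows "expect N (mixed_form N A * mixed_form N F ^ k) =
    fps_const (mat_trace N A) * expect N (mixed_form N F ^ k)
    + of_nat k * expect N (mixed_form N (mat_prod N F A) * mixed_form N F ^ (k - 1))
    + fps_X * (of_nat k * expect N (bottom_form N (mat_prod N (mat_transp N A) F) * mixed_form N F ^ (k - 1)))"
proof -
  let ?q = "mixed_form N F" and ?a = "\<lambda>j i. fps_const (A j i)"
  have "expect N (mixed_form N A * ?q ^ k) =
      (\<Sum>j=1..N. \<Sum>i=1..N. ?a j i * expect N (var (Top j) * (var (Bottom i) * ?q ^ k)))"
    by (simp only: mixed_form_def[of N A] sum_distrib_right gaussian_sum mult.assoc gaussian_const_mult)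
  also have "\<dots> = (\<Sum>j=1..N. \<Sum>i=1..N. fps_const (A j i) * ((if i = j then 1 else 0) * expect N (?q ^ k))
      + ?a j i * expect N (var (Bottom i) * pd (Bottom j) (?q ^ k))
      + fps_X * (?a j i * expect N (var (Bottom i) * pd (Top (reflect N j)) (?q ^ k))))"
  proof (intro sum.cong refl)
    fix j i assume j: "j \<in> {1..N}"
    have "pd (Bottom j) (var (Bottom i) * ?q ^ k) =
        const (if i = j then 1 else 0) * ?q ^ k + var (Bottom i) * pd (Bottom j) (?q ^ k)"
      "pd (Top (reflect N j)) (var (Bottom i) * ?q ^ k) = var (Bottom i) * pd (Top (reflect N j)) (?q ^ k)"
      by (auto simp: pd_mult pd_var)
    moreover have "fps_const (if i = j then 1 else 0) = (if i = j then 1 else 0 :: 'a fps)" by simp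
    ultimately show "?a j i * expect N (var (Top j) * (var (Bottom i) * ?q ^ k)) =
        fps_const (A j i) * ((if i = j then 1 else 0) * expect N (?q ^ k))
      + ?a j i * expect N (var (Bottom i) * pd (Bottom j) (?q ^ k))
      + fps_X * (?a j i * expect N (var (Bottom i) * pd (Top (reflect N j)) (?q ^ k)))"
      by (simp only: expect_Top[OF j] gaussian_add gaussian_const_mult distrib_left
          mult.left_commute[of _ fps_X])
  qed
  also have "\<dots> = fps_const (mat_trace N A) * expect N (?q ^ k)
    + of_nat k * expect N (mixed_form N (mat_prod N F A) * ?q ^ (k - 1))
    + fps_X * (of_nat k * expect N (bottom_form N (mat_prod N (mat_transp N A) F) * ?q ^ (k - 1)))"
    by (simp only: sum.distrib contract_trace contract_Bottom contract_Top sum_distrib_left[symmetric])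
  finally show ?thesis .
qed

text \<open>The analogous step for a bottom form; no contraction of two top variables takes place, so \<open>u\<close> does
  not occur.\<close>

lemma bottom_form_mult_expect:
  fixes B F :: "nat \<Rightarrow> nat \<Rightarrow> 'a::comm_ring_1"
  shows "expect N (bottom_form N B * mixed_form N F ^ k) =
    fps_const (mat_trace N B) * expect N (mixed_form N F ^ k)
    + of_nat k * expect N (bottom_form N (mat_prod N (mat_transp N B) F) * mixed_form N F ^ (k - 1))
    + of_nat k * expect N (mixed_form N (mat_prod N F B) * mixed_form N F ^ (k - 1))"
proof -
  let ?q = "mixed_form N F" and ?b = "\<lambda>i p. fps_const (B i p)"
  have "expect N (bottom_form N B * ?q ^ k) =
      (\<Sum>i=1..N. \<Sum>p=1..N. ?b i p * expect N (var (Bottom (reflect N i)) * (var (Bottom p) * ?q ^ k)))"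
    by (simp only: bottom_form_def[of N B] sum_distrib_right gaussian_sum mult.assoc gaussian_const_mult)
  also have "\<dots> = (\<Sum>i=1..N. \<Sum>p=1..N. ?b i p * ((if p = i then 1 else 0) * expect N (?q ^ k))
      + ?b i p * expect N (var (Bottom p) * pd (Top (reflect N i)) (?q ^ k))
      + ?b i p * expect N (var (Bottom p) * pd (Bottom i) (?q ^ k)))"
  proof (intro sum.cong refl)
    fix i p assume i: "i \<in> {1..N}"
    have "pd (Bottom i) (var (Bottom p) * ?q ^ k) =
        const (if p = i then 1 else 0) * ?q ^ k + var (Bottom p) * pd (Bottom i) (?q ^ k)"
      "pd (Top (reflect N i)) (var (Bottom p) * ?q ^ k) = var (Bottom p) * pd (Top (reflect N i)) (?q ^ k)"
      by (auto simp: pd_mult pd_var)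
    moreover have "fps_const (if p = i then 1 else 0) = (if p = i then 1 else 0 :: 'a fps)" by simp
    ultimately show "?b i p * expect N (var (Bottom (reflect N i)) * (var (Bottom p) * ?q ^ k)) =
        ?b i p * ((if p = i then 1 else 0) * expect N (?q ^ k))
      + ?b i p * expect N (var (Bottom p) * pd (Top (reflect N i)) (?q ^ k))
      + ?b i p * expect N (var (Bottom p) * pd (Bottom i) (?q ^ k))"
      by (simp only: expect_Bottom[OF reflect_in[OF i]] reflect_reflect[OF i] gaussian_add
          gaussian_const_mult distrib_left add_ac)
  qed
  also have "\<dots> = fps_const (mat_trace N B) * expect N (?q ^ k)
    + of_nat k * expect N (bottom_form N (mat_prod N (mat_transp N B) F) * ?q ^ (k - 1))
    + of_nat k * expect N (mixed_form N (mat_prod N F B) * ?q ^ (k - 1))"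
    by (simp only: sum.distrib contract_trace contract_Bottom contract_Top)
  finally show ?thesis .
qed

lemma gaussian_uminus: "gaussian w (- f) = - gaussian w f"
  using gaussian_add[of w f "- f"] by (simp add: eq_neg_iff_add_eq_0 add.commute)

lemma const_uminus: "const (- c) = - const c"
  by (simp add: const_def single_uminus)

lemma mixed_form_cong:
  "(\<And>i j. i \<in> {1..N} \<Longrightarrow> j \<in> {1..N} \<Longrightarrow> A i j = B i j) \<Longrightarrow> mixed_form N A = mixed_form N B"
  unfolding mixed_form_def by (intro sum.cong refl) simp

lemma bottom_form_cong:
  "(\<And>i j. i \<in> {1..N} \<Longrightarrow> j \<in> {1..N} \<Longrightarrow> A i j = B i j) \<Longrightarrow> bottom_form N A = bottom_form N B"
  unfolding bottom_form_def by (intro sum.cong refl) simp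

lemma bottom_form_uminus: "bottom_form N (\<lambda>i j. - B i j) = - bottom_form N B"
  by (simp add: bottom_form_def const_uminus sum_negf)

lemma mat_pow_Suc_right:
  assumes "i \<in> {1..N}" "j \<in> {1..N}"
  shows "mat_prod N (mat_pow N F k) F i j = mat_pow N F (Suc k) i j"
  using assms
proof (induction k arbitrary: i)
  case 0
  have "mat_prod N (mat_pow N F 0) F i j = (\<Sum>p=1..N. if i = p then F p j else 0)"
    unfolding mat_prod_def by (intro sum.cong refl) simp
  also have "\<dots> = (\<Sum>p=1..N. if p = j then F i p else 0)"
    using sum_delta_range(2)[OF 0(1), of "\<lambda>p. F p j"] sum_delta_range(1)[OF 0(2), of "F i"] by (simp only:)
  also have "\<dots> = mat_pow N F (Suc 0) i j"
    unfolding mat_pow.simps mat_prod_def by (intro sum.cong refl) simp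
  finally show ?case .
next
  case (Suc k)
  have "mat_prod N (mat_pow N F (Suc k)) F i j =
      (\<Sum>p=1..N. \<Sum>r=1..N. F i r * (mat_pow N F k r p * F p j))"
    by (simp only: mat_pow.simps mat_prod_def sum_distrib_right mult.assoc)
  also have "\<dots> = (\<Sum>r=1..N. F i r * mat_prod N (mat_pow N F k) F r j)"
    by (subst sum.swap) (simp only: mat_prod_def sum_distrib_left)
  also have "\<dots> = (\<Sum>r=1..N. F i r * mat_pow N F (Suc k) r j)"
    by (intro sum.cong refl) (simp only: Suc.IH Suc.prems)
  finally show ?case by (simp only: mat_pow.simps(2)[of N F "Suc k"] mat_prod_def[of N F])
qed

context
  fixes N :: nat and F :: "nat \<Rightarrow> nat \<Rightarrow> 'a::{complex_algebra, comm_ring_1}"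
  assumes skew: "\<And>i j. i \<in> {1..N} \<Longrightarrow> j \<in> {1..N} \<Longrightarrow> F (reflect N j) (reflect N i) = - F i j"
begin

text \<open>Transposition reverses products and changes the sign of \<open>F\<close>; by \<open>mat_pow_Suc_right\<close> the reversed
  power is the same power.\<close>

lemma mat_transp_mat_pow:
  assumes "i \<in> {1..N}" "j \<in> {1..N}"
  shows "mat_transp N (mat_pow N F k) i j = (-1) ^ k * mat_pow N F k i j"
  using assms
proof (induction k arbitrary: i j)
  case 0
  then have "reflect N j = reflect N i \<longleftrightarrow> i = j" using reflect_reflect by metis
  then show ?case by (simp add: mat_transp_def)
next
  case (Suc k)
  have "mat_transp N (mat_pow N F (Suc k)) i j =
      (\<Sum>p=1..N. F (reflect N j) p * mat_pow N F k p (reflect N i))"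
    by (simp add: mat_transp_def mat_prod_def)
  also have "\<dots> = (\<Sum>p=1..N. F (reflect N j) (reflect N p) * mat_pow N F k (reflect N p) (reflect N i))"
    by (rule sum_reflect[symmetric])
  also have "\<dots> = (\<Sum>p=1..N. (-1) ^ Suc k * (mat_pow N F k i p * F p j))"
  proof (rule sum.cong[OF refl])
    fix p assume p: "p \<in> {1..N}"
    have "mat_pow N F k (reflect N p) (reflect N i) = (-1) ^ k * mat_pow N F k i p"
      using Suc.IH[OF Suc.prems(1) p] by (simp add: mat_transp_def)
    then show "F (reflect N j) (reflect N p) * mat_pow N F k (reflect N p) (reflect N i) =
        (-1) ^ Suc k * (mat_pow N F k i p * F p j)"
      by (simp add: skew[OF p Suc.prems(2)] mult_ac)
  qed
  also have "\<dots> = (-1) ^ Suc k * mat_prod N (mat_pow N F k) F i j"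
    by (simp only: mat_prod_def sum_distrib_left)
  finally show ?case by (simp only: mat_pow_Suc_right[OF Suc.prems])
qed

lemma mat_trace_odd_power:
  assumes "odd k"
  shows "mat_trace N (mat_pow N F k) = 0"
proof (rule eq_uminus_imp_zero)
  have "mat_trace N (mat_pow N F k) = (\<Sum>i=1..N. mat_transp N (mat_pow N F k) i i)"
    unfolding mat_trace_def mat_transp_def
    by (rule sum_reflect[where g = "\<lambda>i. mat_pow N F k i i", symmetric])
  also have "\<dots> = (\<Sum>i=1..N. - mat_pow N F k i i)"
    using assms by (intro sum.cong refl) (simp add: mat_transp_mat_pow)
  finally show "mat_trace N (mat_pow N F k) = - mat_trace N (mat_pow N F k)"
    by (simp add: mat_trace_def sum_negf)
qed

lemma bottom_form_transp_mat_pow: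
  "bottom_form N (mat_prod N (mat_transp N (mat_pow N F k)) F) =
    (if even k then bottom_form N (mat_pow N F (Suc k)) else - bottom_form N (mat_pow N F (Suc k)))"
proof -
  have "mat_prod N (mat_transp N (mat_pow N F k)) F i j = (-1) ^ k * mat_pow N F (Suc k) i j"
    if ij: "i \<in> {1..N}" "j \<in> {1..N}" for i j
  proof -
    have "mat_prod N (mat_transp N (mat_pow N F k)) F i j = (\<Sum>p=1..N. (-1) ^ k * (mat_pow N F k i p * F p j))"
      unfolding mat_prod_def
      by (intro sum.cong refl) (simp only: mat_transp_mat_pow[OF ij(1)] mult.assoc)
    also have "\<dots> = (-1) ^ k * mat_prod N (mat_pow N F k) F i j"
      by (simp only: mat_prod_def sum_distrib_left)
    finally show ?thesis by (simp only: mat_pow_Suc_right[OF ij])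
  qed
  then have "bottom_form N (mat_prod N (mat_transp N (mat_pow N F k)) F) =
      bottom_form N (\<lambda>i j. (-1) ^ k * mat_pow N F (Suc k) i j)"
    by (intro bottom_form_cong)
  then show ?thesis by (simp add: bottom_form_uminus del: mat_pow.simps)
qed

text \<open>Two steps along the cycle. The traces of odd powers vanish, and the minus sign from
  the transposition of an odd power makes the two terms of the first step enter with weights \<open>1\<close> and \<open>-u\<close>; in the
  second step the bottom forms cancel from this combination and the common factor \<open>1-u\<close> remains.\<close>

lemma expect_odd_power_form:
  assumes i: "odd i"
  shows "expect N (mixed_form N (mat_pow N F i) * mixed_form N F ^ k) =
    of_nat k * ((1 - fps_X) * (fps_const (mat_trace N (mat_pow N F (Suc i))) * expect N (mixed_form N F ^ (k - 1))
      + of_nat (k - 1) * expect N (mixed_form N (mat_pow N F (Suc (Suc i))) * mixed_form N F ^ (k - 2))))"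
proof -
  let ?q = "mixed_form N F"
  let ?a = "\<lambda>k i. expect N (mixed_form N (mat_pow N F i) * ?q ^ k)"
  let ?b = "\<lambda>k i. expect N (bottom_form N (mat_pow N F i) * ?q ^ k)"
  let ?t = "\<lambda>i. fps_const (mat_trace N (mat_pow N F i))"
  have "?a k i = of_nat k * ?a (k - 1) (Suc i) - fps_X * (of_nat k * ?b (k - 1) (Suc i))"
    using mixed_form_mult_expect[of N "mat_pow N F i" F k] i
    by (simp add: mat_trace_odd_power bottom_form_transp_mat_pow gaussian_uminus flip: mat_pow.simps(2))
  also have "\<dots> = of_nat k * (?a (k - 1) (Suc i) - fps_X * ?b (k - 1) (Suc i))"
    by (simp only: right_diff_distrib mult.left_commute)
  also have "?a (k - 1) (Suc i) - fps_X * ?b (k - 1) (Suc i) =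
      (1 - fps_X) * (?t (Suc i) * expect N (?q ^ (k - 1)) + of_nat (k - 1) * ?a (k - 2) (Suc (Suc i)))"
  proof -
    have "even (Suc i)" using i by simp
    then have tr: "bottom_form N (mat_prod N (mat_transp N (mat_pow N F (Suc i))) F) =
        bottom_form N (mat_pow N F (Suc (Suc i)))"
      by (simp only: bottom_form_transp_mat_pow if_True)
    have k: "k - 1 - 1 = k - 2" by simp
    have alg: "t + a + fps_X * b - fps_X * (t + b + a) = (1 - fps_X) * (t + a)" for t a b :: "'a fps"
      by (simp add: algebra_simps)
    show ?thesis
      unfolding mixed_form_mult_expect[of N "mat_pow N F (Suc i)" F "k - 1"]
        bottom_form_mult_expect[of N "mat_pow N F (Suc i)" F "k - 1"] tr k mat_pow.simps(2)[symmetric]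
      by (rule alg)
  qed
  finally show ?thesis .
qed

text \<open>Below, \<open>h\<close> is any sequence that satisfies Newton's identity for the even powers of \<open>F\<close>.\<close>

context
  fixes h :: "nat \<Rightarrow> 'a"
  assumes h0: "h 0 = 1"
    and newton: "\<And>n. of_nat (2 * n + 2) * h (2 * n + 2) =
      (\<Sum>j\<le>n. mat_trace N (mat_pow N F (2 * j + 2)) * h (2 * (n - j)))"
begin

lemma mixed_form_power_Suc:
  "mixed_form N F ^ Suc k = mixed_form N (mat_pow N F 1) * mixed_form N F ^ k"
proof -
  have "mixed_form N (mat_pow N F 1) = mixed_form N F"
  proof (rule mixed_form_cong)
    fix i j assume "j \<in> {1..N}"
    have "mat_pow N F 1 i j = (\<Sum>p=1..N. if p = j then F i p else 0)"
      unfolding One_nat_def mat_pow.simps mat_prod_def by (intro sum.cong refl) simp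
    then show "mat_pow N F 1 i j = F i j" by (simp only: sum_delta_range(1)[OF \<open>j \<in> {1..N}\<close>])
  qed
  then show ?thesis by simp
qed

text \<open>Unrolling \<open>expect_odd_power_form\<close> gives the sum on the right-hand side of Newton's identity, and the
  case \<open>i = 1\<close> evaluates the next even moment, which is needed to continue.\<close>

lemma expect_odd_power_form_closed:
  assumes "odd i"
  shows "expect N (mixed_form N (mat_pow N F i) * mixed_form N F ^ (2 * n)) = 0"
    and "expect N (mixed_form N (mat_pow N F i) * mixed_form N F ^ (2 * n + 1)) =
      fps_const (of_nat (fact (2 * n + 1)) * (\<Sum>j\<le>n. mat_trace N (mat_pow N F (i + 1 + 2 * j)) * h (2 * (n - j))))
        * (1 - fps_X) ^ Suc n"
  using assms
proof (induction n arbitrary: i)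
  case 0
  case 1
  then show ?case using expect_odd_power_form[of i 0] by simp
next
  case 0
  case 2
  then show ?case using expect_odd_power_form[of i 1]
    by (simp add: h0 mult.commute del: mat_pow.simps)
next
  case (Suc n)
  have odd_power: "expect N (mixed_form N F ^ (2 * n + 1)) = 0"
    using Suc.IH(1)[of 1] by (simp only: Suc_eq_plus1[symmetric] mixed_form_power_Suc) simp
  case 1
  then show ?case
    using expect_odd_power_form[of i "2 * n + 2"] Suc.IH(1)[of "i + 2"] odd_power by simp
next
  case (Suc n)
  let ?c = "of_nat (fact (2 * n + 1)) :: 'a"
  have "(\<Sum>j\<le>n. mat_trace N (mat_pow N F (1 + 1 + 2 * j)) * h (2 * (n - j))) =
      of_nat (2 * n + 2) * h (2 * n + 2)"
    unfolding newton by (intro sum.cong refl) (simp add: add.commute)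
  then have even_power: "expect N (mixed_form N F ^ (2 * n + 2)) =
      fps_const (?c * (of_nat (2 * n + 2) * h (2 * n + 2))) * (1 - fps_X) ^ Suc n"
    using Suc.IH(2)[of 1] mixed_form_power_Suc[of "2 * n + 1"] by simp
  case 2
  let ?s = "\<Sum>j\<le>n. mat_trace N (mat_pow N F (i + 2 + 1 + 2 * j)) * h (2 * (n - j))"
  have s: "(\<Sum>j\<le>Suc n. mat_trace N (mat_pow N F (i + 1 + 2 * j)) * h (2 * (Suc n - j))) =
      mat_trace N (mat_pow N F (Suc i)) * h (2 * n + 2) + ?s"
    by (subst sum.atMost_Suc_shift) simp
  have "expect N (mixed_form N (mat_pow N F i) * mixed_form N F ^ (2 * n + 3)) =
      of_nat (2 * n + 3) * ((1 - fps_X) *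
        (fps_const (mat_trace N (mat_pow N F (Suc i))) * expect N (mixed_form N F ^ (2 * n + 2))
      + of_nat (2 * n + 2) * expect N (mixed_form N (mat_pow N F (i + 2)) * mixed_form N F ^ (2 * n + 1))))"
    using expect_odd_power_form[of i "2 * n + 3"] 2 by (simp add: numeral_3_eq_3 del: mat_pow.simps)
  also have "\<dots> = fps_const (of_nat (2 * n + 3) * (of_nat (2 * n + 2) * ?c) *
      (mat_trace N (mat_pow N F (Suc i)) * h (2 * n + 2) + ?s)) * (1 - fps_X) ^ Suc (Suc n)"
  proof -
    have *: "expect N (mixed_form N (mat_pow N F (i + 2)) * mixed_form N F ^ (2 * n + 1)) =
        fps_const (?c * ?s) * (1 - fps_X) ^ Suc n"
      by (rule Suc.IH(2)) (use 2 in simp)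
    have nat: "of_nat k = fps_const (of_nat k :: 'a)" for k by (simp add: fps_of_nat)
    have "P * ((1 - X) * (T * (E * X1) + Q * (S * X1))) = (P * (T * E + Q * S)) * (X1 * (1 - X))"
      for P X T E X1 Q S :: "'a fps" by (simp add: algebra_simps)
    then show ?thesis
      unfolding even_power * nat
      by (simp only: fps_const_mult fps_const_add power_Suc2[of "1 - fps_X" "Suc n"])
        (simp add: algebra_simps del: mat_pow.simps of_nat_add)
  qed
  also have "of_nat (2 * n + 3) * (of_nat (2 * n + 2) * ?c) = (of_nat (fact (2 * n + 3)) :: 'a)"
  proof -
    have "2 * n + 3 = Suc (Suc (2 * n + 1))" by simp
    then have "(fact (2 * n + 3) :: nat) = (2 * n + 3) * ((2 * n + 2) * fact (2 * n + 1))"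
      by (simp only: fact_Suc) simp
    then show ?thesis by (simp only: of_nat_mult)
  qed
  finally show ?case unfolding s by (simp add: numeral_3_eq_3 del: mat_pow.simps)
qed

lemma expect_mixed_form_odd_power: "expect N (mixed_form N F ^ (2 * n + 1)) = 0"
  using expect_odd_power_form_closed(1)[of 1 n]
  by (simp only: Suc_eq_plus1[symmetric] mixed_form_power_Suc) simp

lemma expect_mixed_form_even_power:
  "expect N (mixed_form N F ^ (2 * n)) = fps_const (of_nat (fact (2 * n)) * h (2 * n)) * (1 - fps_X) ^ n"
proof (cases n)
  case 0
  then show ?thesis by (simp add: h0)
next
  case (Suc k)
  have "(\<Sum>j\<le>k. mat_trace N (mat_pow N F (1 + 1 + 2 * j)) * h (2 * (k - j))) =
      of_nat (2 * k + 2) * h (2 * k + 2)"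
    unfolding newton by (intro sum.cong refl) (simp add: add.commute)
  then have "expect N (mixed_form N F ^ (2 * k + 2)) =
      fps_const (of_nat (fact (2 * k + 1)) * (of_nat (2 * k + 2) * h (2 * k + 2))) * (1 - fps_X) ^ Suc k"
    using expect_odd_power_form_closed(2)[of 1 k] mixed_form_power_Suc[of "2 * k + 1"] by simp
  moreover have "of_nat (fact (2 * k + 1)) * (of_nat (2 * k + 2) * h (2 * k + 2)) =
      of_nat (fact (2 * k + 2)) * h (2 * k + 2)"
  proof -
    have "2 * k + 2 = Suc (2 * k + 1)" by simp
    then have "(fact (2 * k + 2) :: nat) = (2 * k + 2) * fact (2 * k + 1)"
      by (simp only: fact_Suc) simp
    then show ?thesis by (simp only: of_nat_mult mult_ac)
  qed
  ultimately show ?thesis by (simp add: Suc)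
qed

end

end

section \<open>The coefficients of the symmetrizer\<close>

text \<open>The coefficient, up to \<open>1/m!\<close>, of the diagrams with \<open>r\<close> horizontal edges in the top row.\<close>

definition sym_coeff :: "nat \<Rightarrow> nat \<Rightarrow> nat \<Rightarrow> complex" where
  "sym_coeff N m r = (-1) ^ r / ((of_nat N / 2 + of_nat m - 2) gchoose r)"

text \<open>The substitution of the coefficients for the powers of the mark \<open>u\<close>, together with the factor
  \<open>\<gamma>\<^sub>m(N)\<close>: applied to \<open>E[q\<^sub>A\<^sup>m]\<close> it gives \<open>\<gamma>\<^sub>m(N) tr S\<^bsup>(m)\<^esup> A\<^sub>1 \<dots> A\<^sub>m\<close> (\<open>normalized_value_expect_mixed_form_power\<close>).\<close>

definition normalized_value :: "nat \<Rightarrow> nat \<Rightarrow> 'a fps \<Rightarrow> 'a::{complex_algebra, comm_ring_1}" where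
  "normalized_value N m g = (gamma_factor m (of_nat N) / fact m) *\<^sub>C
     (\<Sum>r=0..m div 2. sym_coeff N m r *\<^sub>C fps_nth g r)"

lemma of_nat_mult_cscale: "of_nat n * (x :: 'a::complex_algebra) = of_nat n *\<^sub>C x"
  by (induction n) (simp_all add: distrib_right cscale_add_left)

lemma of_int_mult_cscale: "of_int n * (x :: 'a::complex_algebra) = of_int n *\<^sub>C x"
  by (cases n rule: int_cases2) (simp_all add: of_nat_mult_cscale)

lemma cscale_sum_left: "(\<Sum>i\<in>A. f i) *\<^sub>C (x :: 'a::complex_vector) = (\<Sum>i\<in>A. f i *\<^sub>C x)"
  by (induction A rule: infinite_finite_induct) (simp_all add: cscale_add_left)

lemma normalized_value_zero [simp]: "normalized_value N m 0 = 0"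
  by (simp add: normalized_value_def)

lemma normalized_value_add:
  "normalized_value N m (f + g) = normalized_value N m f + normalized_value N m g"
  by (simp add: normalized_value_def cscale_add_right sum.distrib)

lemma normalized_value_sum:
  "normalized_value N m (\<Sum>i\<in>A. f i) = (\<Sum>i\<in>A. normalized_value N m (f i))"
  by (induction A rule: infinite_finite_induct) (simp_all add: normalized_value_add)

lemma normalized_value_const_mult:
  "normalized_value N m (fps_const c * g) = c * normalized_value N m g"
  by (simp add: normalized_value_def sum_distrib_left mult.left_commute cscale_sum_right)

lemma complex_gbinomial_nonzero:
  assumes "\<And>i. i < r \<Longrightarrow> x \<noteq> of_nat i"
  shows "(x :: complex) gchoose r \<noteq> 0"
  using assms by (auto simp: gbinomial_prod_rev)

text \<open>All binomial coefficients in denominators have the form \<open>binom(k/2, r)\<close> with \<open>k\<close> large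
  enough for this lemma to show that they do not vanish.\<close>

lemma half_integer_neq:
  assumes "2 * i < k"
  shows "of_nat k / 2 \<noteq> (of_nat i :: complex)"
proof
  assume "of_nat k / 2 = (of_nat i :: complex)"
  then have "of_nat k = (of_nat (2 * i) :: complex)" by (simp add: field_simps)
  then have "k = 2 * i" by (simp only: of_nat_eq_iff)
  with assms show False by simp
qed

text \<open>The absorption identities for both binomial coefficients reduce the sum for \<open>(l+1, x)\<close> to 1 plus
  \<open>(l+1)/x\<close> times the sum for \<open>(l, x-1)\<close>.\<close>

lemma sum_binomial_ratio:
  assumes "\<And>i. i \<le> l \<Longrightarrow> x + 1 \<noteq> of_nat i"
  shows "(\<Sum>r\<le>l. of_nat (l choose r) / (x gchoose r)) = (x + 1) / (x + 1 - of_nat l :: complex)"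
  using assms
proof (induction l arbitrary: x)
  case 0
  from 0[of 0] show ?case by simp
next
  case (Suc l)
  have x: "x \<noteq> 0" using Suc.prems[of 1] by auto
  have xl: "x \<noteq> of_nat l" using Suc.prems[of "Suc l"] by auto
  have "x - 1 + 1 \<noteq> of_nat i" if "i \<le> l" for i
    using Suc.prems[of "Suc i"] that by auto
  note IH = Suc.IH[OF this]
  have summand: "of_nat (Suc l choose Suc r) / (x gchoose Suc r) =
      (of_nat (Suc l) / x) * (of_nat (l choose r) / ((x - 1) gchoose r))" for r
  proof -
    have "of_nat (Suc r) * (of_nat (Suc l choose Suc r) :: complex) = of_nat (Suc l) * of_nat (l choose r)"
      by (metis Suc_times_binomial of_nat_mult)
    then have 1: "(of_nat (Suc l choose Suc r) :: complex) = of_nat (Suc l) * of_nat (l choose r) / of_nat (Suc r)"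
      by (simp add: field_simps del: of_nat_Suc)
    have "of_nat (Suc r) * (x gchoose Suc r) = x * ((x - 1) gchoose r)"
      by (rule gbinomial_absorption)
    then have 2: "x gchoose Suc r = x * ((x - 1) gchoose r) / of_nat (Suc r)"
      by (simp add: field_simps del: of_nat_Suc)
    show ?thesis unfolding 1 2 by (simp del: of_nat_Suc)
  qed
  have "(\<Sum>r\<le>Suc l. of_nat (Suc l choose r) / (x gchoose r)) =
      1 + (of_nat (Suc l) / x) * (\<Sum>r\<le>l. of_nat (l choose r) / ((x - 1) gchoose r))"
    by (subst sum.atMost_Suc_shift) (simp only: summand sum_distrib_left, simp)
  also have "(\<Sum>r\<le>l. of_nat (l choose r) / ((x - 1) gchoose r)) = x / (x - of_nat l)"
    using IH by simp
  also have "1 + (of_nat (Suc l) / x) * (x / (x - of_nat l)) = 1 + of_nat (Suc l) / (x - of_nat l)"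
    using x by simp
  also have "\<dots> = (x + 1) / (x + 1 - of_nat (Suc l))"
    using xl by (simp add: field_simps)
  finally show ?case .
qed

text \<open>The right-hand side of \<open>expect_identity_form\<close>, coefficientwise in \<open>u\<close>.\<close>

lemma partial_trace_coeff:
  fixes g :: "'a::comm_ring_1 fps"
  shows "fps_nth ((of_nat N + of_nat n * (1 + fps_X)) * g + 2 * fps_X * (1 - fps_X) * fps_deriv g) r =
    of_int (int N + int n + 2 * int r) * fps_nth g r +
    (if r = 0 then 0 else of_int (int n + 2 - 2 * int r) * fps_nth g (r - 1))"
proof -
  let ?D = "fps_X * fps_deriv g"
  have "(of_nat N + of_nat n * (1 + fps_X)) * g + 2 * fps_X * (1 - fps_X) * fps_deriv g =
      of_nat N * g + of_nat n * g + fps_X * (of_nat n * g) + 2 * ?D - fps_X * (2 * ?D)"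
    by (simp add: algebra_simps)
  moreover have nat: "fps_nth (of_nat k * f) i = of_nat k * fps_nth f i" for k i and f :: "'a fps"
    by (simp flip: fps_of_nat)
  moreover have "fps_nth (2 * f) i = 2 * fps_nth f i" for i and f :: "'a fps"
    using nat[of 2 f i] by simp
  moreover have "fps_nth ?D k = of_nat k * fps_nth g k" for k
    by (cases k) simp_all
  moreover have "fps_nth (fps_X * f) (Suc k) = fps_nth f k" "fps_nth (fps_X * f) 0 = 0" for k and f :: "'a fps"
    by simp_all
  ultimately show ?thesis
    by (cases r) (simp_all only: fps_add_nth fps_sub_nth nat.simps if_False if_True, simp_all add: algebra_simps)
qed

text \<open>All quantities are expressed by \<open>x = N/2 + m - 2\<close>, \<open>m\<close> and \<open>r\<close>. The claim amounts to the fact that, after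
  the common factor of the binomial coefficients is removed, the bracket on the left does not depend on \<open>r\<close>
  and factorizes as \<open>(x+1)(2x-m+1)\<close>.\<close>

lemma sym_coeff_partial_trace:
  assumes m: "m \<ge> 2" and N: "N \<ge> 1" and r: "2 * r \<le> m - 1"
  shows "gamma_factor m (of_nat N) / fact m *
      (of_int (int N + int (m - 1) + 2 * int r) * sym_coeff N m r
        + of_int (int (m - 1) - 2 * int r) * sym_coeff N m (Suc r)) =
    (of_nat (N + m - 2) / of_nat m) * (gamma_factor (m - 1) (of_nat N) / fact (m - 1) * sym_coeff N (m - 1) r)"
proof -
  define x :: complex where "x = of_nat N / 2 + of_nat m - 2"
  have x_half: "x = of_nat (N + 2 * m - 4) / 2"
    using m N by (simp add: x_def of_nat_diff field_simps)
  have neq: "x \<noteq> of_nat i" if "2 * i < N + 2 * m - 4" for i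
    unfolding x_half by (rule half_integer_neq) (use that in simp)
  have i_bound: "2 * i < N + 2 * m - 4" if "i \<le> r" for i
    using that m N r by presburger
  have x0: "x \<noteq> 0" and xr: "x - of_nat r \<noteq> 0" using neq[of 0] neq[of r] i_bound[of 0] i_bound[of r] by auto
  have x1: "x + 1 \<noteq> 0"
  proof
    assume "x + 1 = 0"
    then have "(of_nat (N + 2 * m - 2) :: complex) = of_nat 0"
      using m N by (simp add: x_def of_nat_diff field_simps)
    then have "N + 2 * m - 2 = 0" by (simp only: of_nat_eq_iff)
    then show False using m N by simp
  qed
  define b where "b = x gchoose r"
  have b: "b \<noteq> 0" unfolding b_def
    by (rule complex_gbinomial_nonzero) (use neq i_bound in simp)
  have b1: "x gchoose Suc r = b * (x - of_nat r) / of_nat (Suc r)"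
  proof -
    have "of_nat (Suc r) * (x gchoose Suc r) = b * (x - of_nat r)"
      using gbinomial_absorb_comp[of x r] gbinomial_absorption[of r x]
      by (simp add: b_def mult.commute del: of_nat_Suc)
    then show ?thesis by (simp add: field_simps del: of_nat_Suc)
  qed
  have b2: "(x - 1) gchoose r = b * (x - of_nat r) / x"
    using gbinomial_absorb_comp[of x r] x0 by (simp add: b_def field_simps)
  define M :: complex where "M = of_nat m"
  have M: "M \<noteq> 0" using m by (simp add: M_def)
  have Nx: "of_nat N = 2 * x - 2 * M + 4" by (simp add: x_def M_def)
  define R :: complex where "R = of_nat r"
  have c0: "sym_coeff N m r = (-1) ^ r / b" by (simp add: sym_coeff_def x_def b_def)
  have c1: "sym_coeff N m (Suc r) = - ((-1) ^ r * (R + 1) / (b * (x - R)))"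
    unfolding sym_coeff_def x_def[symmetric] b1 by (simp add: R_def add.commute)
  have c2: "sym_coeff N (m - 1) r = (-1) ^ r * x / (b * (x - R))"
  proof -
    have "of_nat N / 2 + of_nat (m - 1) - 2 = x - 1" using m by (simp add: x_def of_nat_diff)
    then show ?thesis using b2 by (simp add: sym_coeff_def R_def)
  qed
  have g0: "gamma_factor m (of_nat N) = (2 * x - M + 2) / (2 * (x + 1))"
    unfolding gamma_factor_def Nx by (simp add: M_def algebra_simps)
  have g1: "gamma_factor (m - 1) (of_nat N) = (2 * x - M + 1) / (2 * x)"
    unfolding gamma_factor_def Nx using m by (simp add: M_def of_nat_diff algebra_simps)
  have f: "(fact m :: complex) = M * fact (m - 1)"
    using m by (cases m) (simp_all add: M_def)
  have n1: "(of_int (int N + int (m - 1) + 2 * int r) :: complex) = 2 * x - M + 3 + 2 * R"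
    using m by (simp add: Nx of_nat_diff R_def M_def)
  have n2: "(of_int (int (m - 1) - 2 * int r) :: complex) = M - 1 - 2 * R"
    using m by (simp add: of_nat_diff R_def M_def)
  have n3: "(of_nat (N + m - 2) :: complex) = 2 * x - M + 2"
    using m by (simp add: Nx of_nat_diff M_def)
  define s :: complex where "s = (-1) ^ r"
  have key: "(2 * x - M + 3 + 2 * R) * (x - R) - (M - 1 - 2 * R) * (R + 1) = (x + 1) * (2 * x - M + 1)"
    by (simp add: algebra_simps power2_eq_square)
  have xR: "x - R \<noteq> 0" using xr by (simp add: R_def)
  have "(2 * x - M + 3 + 2 * R) * (s / b) + (M - 1 - 2 * R) * - (s * (R + 1) / (b * (x - R))) =
      s / (b * (x - R)) * ((2 * x - M + 3 + 2 * R) * (x - R) - (M - 1 - 2 * R) * (R + 1))"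
    using b xR by (simp add: field_simps)
  then have sum: "(2 * x - M + 3 + 2 * R) * (s / b) + (M - 1 - 2 * R) * - (s * (R + 1) / (b * (x - R))) =
      s / (b * (x - R)) * ((x + 1) * (2 * x - M + 1))"
    by (simp only: key)
  have cancel: "A / (2 * y) / (M * f) * (s / D * (y * B)) = A / M * (B / (2 * x) / f * (s * x / D))"
    if "y \<noteq> 0" "f \<noteq> 0" "D \<noteq> 0" for A B y f D :: complex
    using that x0 M by (simp add: mult_ac)
  show ?thesis
    unfolding c0 c1 c2 g0 g1 f n1 n2 n3 s_def[symmetric] M_def[symmetric] sum
    by (rule cancel[OF x1]) (use b xR in simp_all)
qed

text \<open>The partial trace of the symmetrizer. Collecting the coefficient of \<open>u\<^sup>r\<close> in \<open>g\<close> combines two neighbouring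
  coefficients of the symmetrizer of degree \<open>m\<close> into one of degree \<open>m-1\<close>.\<close>

lemma normalized_value_partial_trace:
  fixes g :: "'a::{complex_algebra, comm_ring_1} fps"
  assumes m: "m \<ge> 2" and N: "N \<ge> 1" and g: "\<And>r. 2 * r > m - 1 \<Longrightarrow> fps_nth g r = 0"
  shows "normalized_value N m ((of_nat N + of_nat (m - 1) * (1 + fps_X)) * g + 2 * fps_X * (1 - fps_X) * fps_deriv g) =
    (of_nat (N + m - 2) / of_nat m) *\<^sub>C normalized_value N (m - 1) g"
proof -
  let ?K = "m div 2"
  let ?p = "\<lambda>r. of_int (int N + int (m - 1) + 2 * int r) :: complex"
  let ?q = "\<lambda>r. of_int (int (m - 1) + 2 - 2 * int r) :: complex"
  let ?c = "sym_coeff N m" and ?G = "gamma_factor m (of_nat N) / fact m"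
  have "(\<Sum>r=0..?K. (if r = 0 then 0 else (?c r * ?q r) *\<^sub>C fps_nth g (r - 1))) =
      (\<Sum>r=0..?K. (?c (Suc r) * ?q (Suc r)) *\<^sub>C fps_nth g r)"
  proof -
    have "(\<Sum>r=0..?K. (if r = 0 then 0 else (?c r * ?q r) *\<^sub>C fps_nth g (r - 1))) =
        (\<Sum>r=0..Suc ?K. (if r = 0 then 0 else (?c r * ?q r) *\<^sub>C fps_nth g (r - 1)))"
    proof -
      \<comment> \<open>the boundary term: the coefficient of \<open>g\<close> vanishes for even \<open>m\<close>, the numerical factor for odd \<open>m\<close>\<close>
      have "(?c (Suc ?K) * ?q (Suc ?K)) *\<^sub>C fps_nth g ?K = 0"
      proof (cases "even m")
        case True
        then have "2 * ?K > m - 1" using m by auto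
        then show ?thesis by (simp add: g)
      next
        case False
        then have "int (m - 1) + 2 - 2 * int (Suc ?K) = 0" using m by (auto elim: oddE)
        then show ?thesis by (simp only: of_int_0 mult_zero_right cscale_zero_left)
      qed
      then show ?thesis by simp
    qed
    also have "\<dots> = (\<Sum>r=0..?K. (?c (Suc r) * ?q (Suc r)) *\<^sub>C fps_nth g r)"
      by (subst sum.atLeast0_atMost_Suc_shift) simp
    finally show ?thesis .
  qed
  note shift = this
  have "normalized_value N m ((of_nat N + of_nat (m - 1) * (1 + fps_X)) * g + 2 * fps_X * (1 - fps_X) * fps_deriv g) =
      ?G *\<^sub>C (\<Sum>r=0..?K. (?c r * ?p r) *\<^sub>C fps_nth g r +
        (if r = 0 then 0 else (?c r * ?q r) *\<^sub>C fps_nth g (r - 1)))"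
    unfolding normalized_value_def partial_trace_coeff
    by (intro arg_cong[where f = "cscale ?G"] sum.cong refl) (simp add: of_int_mult_cscale cscale_add_right del: of_int_add of_int_diff of_int_mult)
  also have "\<dots> = (\<Sum>r=0..?K. (?G * (?p r * ?c r + ?q (Suc r) * ?c (Suc r))) *\<^sub>C fps_nth g r)"
    unfolding sum.distrib shift
    by (simp only: sum.distrib[symmetric] cscale_sum_right cscale_add_left[symmetric] cscale_cscale mult.commute[of "?c _"])
  also have "\<dots> = (\<Sum>r=0..(m - 1) div 2. (?G * (?p r * ?c r + ?q (Suc r) * ?c (Suc r))) *\<^sub>C fps_nth g r)"
    by (rule sum.mono_neutral_right) (auto simp: g)
  also have "\<dots> = (\<Sum>r=0..(m - 1) div 2. ((of_nat (N + m - 2) / of_nat m) *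
      (gamma_factor (m - 1) (of_nat N) / fact (m - 1) * sym_coeff N (m - 1) r)) *\<^sub>C fps_nth g r)"
  proof (rule sum.cong[OF refl])
    fix r assume "r \<in> {0..(m - 1) div 2}"
    then have r: "2 * r \<le> m - 1" by auto
    have q: "int (m - 1) + 2 - 2 * int (Suc r) = int (m - 1) - 2 * int r" by simp
    show "(?G * (?p r * ?c r + ?q (Suc r) * ?c (Suc r))) *\<^sub>C fps_nth g r = ((of_nat (N + m - 2) / of_nat m) *
      (gamma_factor (m - 1) (of_nat N) / fact (m - 1) * sym_coeff N (m - 1) r)) *\<^sub>C fps_nth g r"
      unfolding q using sym_coeff_partial_trace[OF m N r] by (simp only:)
  qed
  also have "\<dots> = (of_nat (N + m - 2) / of_nat m) *\<^sub>C normalized_value N (m - 1) g"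
    by (simp only: normalized_value_def cscale_sum_right cscale_cscale mult.assoc)
  finally show ?thesis .
qed

section \<open>The commutative identity\<close>

text \<open>Being a mixed form, the identity form has the same homogeneity properties.\<close>

lemma identity_form_eq:
  "identity_form N = mixed_form N (\<lambda>i j. if i = j then 1 else 0 :: 'a::comm_ring_1)"
proof -
  have "mixed_form N (\<lambda>i j. if i = j then 1 else 0 :: 'a) =
      (\<Sum>j=1..N. \<Sum>i=1..N. if i = j then var (Top j) * var (Bottom i) else 0)"
    unfolding mixed_form_def by (intro sum.cong refl) simp
  also have "\<dots> = (\<Sum>j=1..N. var (Top j) * var (Bottom j))"
    by (intro sum.cong refl) (simp only: sum_delta_range)
  finally show ?thesis by (simp only: identity_form_def)
qed

text \<open>The Euler operator of the family of variables \<open>p\<close>, a derivation that measures the degree in these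
  variables.\<close>

definition euler :: "(nat \<Rightarrow> 'w) \<Rightarrow> nat \<Rightarrow> ('w multiset \<Rightarrow>\<^sub>0 'a::comm_ring_1) \<Rightarrow> ('w multiset \<Rightarrow>\<^sub>0 'a)" where
  "euler p N f = (\<Sum>i=1..N. var (p i) * pd (p i) f)"

lemma euler_mult: "euler p N (f * g) = euler p N f * g + f * euler p N g"
  by (simp add: euler_def pd_mult distrib_left sum.distrib sum_distrib_left sum_distrib_right mult_ac)

lemma euler_one [simp]: "euler p N 1 = 0"
  by (simp add: euler_def)

lemma euler_power: "euler p N f = f \<Longrightarrow> euler p N (f ^ k) = of_nat k * f ^ k"
  by (induction k) (simp_all add: euler_mult algebra_simps)

lemma euler_Top_mixed_form: "euler Top N (mixed_form N A) = mixed_form N A"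
proof -
  have "euler Top N (mixed_form N A) = (\<Sum>j=1..N. var (Top j) * (\<Sum>i=1..N. const (A j i) * var (Bottom i)))"
    unfolding euler_def by (intro sum.cong refl) (simp only: pd_Top_mixed_form)
  then show ?thesis
    by (simp only: mixed_form_def sum_distrib_left mult.left_commute)
qed

lemma euler_Bottom_mixed_form: "euler Bottom N (mixed_form N A) = mixed_form N A"
proof -
  have "euler Bottom N (mixed_form N A) = (\<Sum>i=1..N. var (Bottom i) * (\<Sum>j=1..N. const (A j i) * var (Top j)))"
    unfolding euler_def by (intro sum.cong refl) (simp only: pd_Bottom_mixed_form)
  also have "\<dots> = (\<Sum>i=1..N. \<Sum>j=1..N. const (A j i) * (var (Top j) * var (Bottom i)))"
    unfolding sum_distrib_left by (intro sum.cong refl) (simp only: mult_ac)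
  also have "\<dots> = (\<Sum>j=1..N. \<Sum>i=1..N. const (A j i) * (var (Top j) * var (Bottom i)))"
    by (rule sum.swap)
  finally show ?thesis by (simp only: mixed_form_def)
qed

lemma euler_form_product:
  assumes "euler p N f = f" "euler p N g = g"
  shows "euler p N (f ^ a * g ^ b) = of_nat (a + b) * (f ^ a * g ^ b)"
  by (simp add: euler_mult euler_power assms algebra_simps)

lemma expect_identity_form_Suc:
  fixes F :: "nat \<Rightarrow> nat \<Rightarrow> 'a::comm_ring_1"
  shows "expect N (identity_form N ^ Suc a * mixed_form N F ^ b) =
    (of_nat N + of_nat (a + b) * (1 + fps_X)) * expect N (identity_form N ^ a * mixed_form N F ^ b)
      + 2 * fps_X * (1 - fps_X) * fps_deriv (expect N (identity_form N ^ a * mixed_form N F ^ b))"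
proof -
  have eq: "identity_form N ^ Suc a * mixed_form N F ^ b =
      identity_form N * (identity_form N ^ a * mixed_form N F ^ b)"
    by (simp only: power_Suc mult.assoc)
  have euler: "euler p N (identity_form N ^ a * mixed_form N F ^ b) =
      of_nat (a + b) * (identity_form N ^ a * mixed_form N F ^ b)"
    if "\<And>A :: nat \<Rightarrow> nat \<Rightarrow> 'a. euler p N (mixed_form N A) = mixed_form N A" for p
    unfolding identity_form_eq by (rule euler_form_product) (rule that)+
  show ?thesis
    unfolding eq
    by (rule expect_identity_form)
      (use euler[OF euler_Top_mixed_form] euler[OF euler_Bottom_mixed_form] in \<open>simp_all only: euler_def\<close>)
qed

lemma one_minus_X_power_nth:
  "fps_nth ((1 - fps_X) ^ n) r = (of_int ((-1) ^ r * int (n choose r)) :: 'a::comm_ring_1)"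
proof (induction n arbitrary: r)
  case 0
  show ?case by (cases r) simp_all
next
  case (Suc n)
  have "fps_nth ((1 - fps_X) ^ Suc n) r =
      fps_nth ((1 - fps_X) ^ n) r - fps_nth (fps_X * (1 - fps_X :: 'a fps) ^ n) r"
    by (simp add: left_diff_distrib)
  then show ?case by (cases r) (simp_all add: Suc.IH algebra_simps)
qed

text \<open>The normalization \<open>\<gamma>\<^sub>2\<^sub>l(N)\<close> compensates for the sum over \<open>r\<close> into which the coefficients of the
  symmetrizer turn the factor \<open>(1-u)\<^sup>l\<close> of the moments.\<close>

lemma gamma_sum_eq_1:
  assumes l: "l \<ge> 1" and N: "N \<ge> 1"
  shows "gamma_factor (2 * l) (of_nat N) *
    (\<Sum>r\<le>l. of_nat (l choose r) / ((of_nat N / 2 + of_nat (2 * l) - 2) gchoose r)) = 1"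
proof -
  define x :: complex where "x = of_nat N / 2 + of_nat (2 * l) - 2"
  have x_half: "x + 1 = of_nat (N + 4 * l - 2) / 2"
    using l N by (simp add: x_def of_nat_diff field_simps)
  have neq: "x + 1 \<noteq> of_nat i" if "i \<le> l" for i
    unfolding x_half by (rule half_integer_neq) (use that l N in simp)
  have "gamma_factor (2 * l) (of_nat N) = (x + 1 - of_nat l) / (x + 1)"
  proof -
    have "of_nat N + of_nat (2 * l) - 2 = 2 * (x + 1 - of_nat l)"
      "of_nat N + 2 * of_nat (2 * l) - 2 = 2 * (x + 1)"
      by (simp_all add: x_def)
    then show ?thesis
      unfolding gamma_factor_def by (simp only: mult_divide_mult_cancel_left_if) simp
  qed
  moreover have "x + 1 \<noteq> 0" "x + 1 - of_nat l \<noteq> 0" using neq[of 0] neq[of l] by auto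
  moreover have "(\<Sum>r\<le>l. of_nat (l choose r) / (x gchoose r)) = (x + 1) / (x + 1 - of_nat l)"
    by (rule sum_binomial_ratio) (rule neq)
  ultimately show ?thesis unfolding x_def[symmetric] by simp
qed

context
  fixes N :: nat and F :: "nat \<Rightarrow> nat \<Rightarrow> 'a::{complex_algebra, comm_ring_1}" and h :: "nat \<Rightarrow> 'a"
  assumes N: "N \<ge> 1"
    and skew: "\<And>i j. i \<in> {1..N} \<Longrightarrow> j \<in> {1..N} \<Longrightarrow> F (reflect N j) (reflect N i) = - F i j"
    and h0: "h 0 = 1"
    and newton: "\<And>n. of_nat (2 * n + 2) * h (2 * n + 2) =
      (\<Sum>j\<le>n. mat_trace N (mat_pow N F (2 * j + 2)) * h (2 * (n - j)))"
begin

lemma expect_mixed_form_power_nth: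
  "fps_nth (expect N (mixed_form N F ^ b)) r =
    (if even b then of_int ((-1) ^ r * int (b div 2 choose r)) * (of_nat (fact b) * h b) else 0)"
proof (cases "even b")
  case True
  then obtain n where "b = 2 * n" by (rule evenE)
  then show ?thesis
    using expect_mixed_form_even_power[OF skew h0 newton, of n]
    by (simp add: one_minus_X_power_nth mult.commute)
next
  case False
  then obtain n where "b = 2 * n + 1" by (rule oddE)
  then show ?thesis
    using expect_mixed_form_odd_power[OF skew h0 newton, of n] by simp
qed

text \<open>At most \<open>n/2\<close> horizontal edges fit into the top row of a diagram with \<open>n\<close> nodes. Without counting edges, this
  follows from the recursion: the only coefficient that could violate the bound is multiplied by
  \<open>n + 2 - 2r\<close> with \<open>2r = n + 2\<close>.\<close>

lemma expect_form_product_nth_eq_0: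
  "2 * r > a + b \<Longrightarrow> fps_nth (expect N (identity_form N ^ a * mixed_form N F ^ b)) r = 0"
proof (induction a arbitrary: r)
  case 0
  then have "b div 2 < r" by auto
  then show ?case by (simp add: expect_mixed_form_power_nth binomial_eq_0)
next
  case (Suc a)
  have "fps_nth (expect N (identity_form N ^ a * mixed_form N F ^ b)) r = 0"
    using Suc by simp
  moreover have "of_int (int (a + b) + 2 - 2 * int r) *
      fps_nth (expect N (identity_form N ^ a * mixed_form N F ^ b)) (r - 1) = 0"
  proof (cases "2 * r = a + b + 2")
    case True
    then have "int (a + b) + 2 - 2 * int r = 0" by simp
    then show ?thesis by (simp only: of_int_0 mult_zero_left)
  next
    case False
    then have "2 * (r - 1) > a + b" using Suc.prems by simp
    then show ?thesis using Suc.IH by simp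
  qed
  ultimately show ?case
    unfolding expect_identity_form_Suc partial_trace_coeff by (simp del: of_int_add of_int_diff of_int_mult)
qed

text \<open>Iterated partial traces; the factors \<open>(N+m-2)/m\<close> combine to a quotient of binomial coefficients.\<close>

lemma normalized_value_form_product:
  assumes b: "b \<ge> 1"
  shows "normalized_value N (a + b) (expect N (identity_form N ^ a * mixed_form N F ^ b)) =
    (of_nat ((N + a + b - 2) choose a) / of_nat ((a + b) choose a)) *\<^sub>C
      normalized_value N b (expect N (mixed_form N F ^ b))"
proof (induction a)
  case (Suc a)
  let ?m = "Suc a + b"
  have m: "?m \<ge> 2" "?m - 1 = a + b" using b by simp_all
  have "normalized_value N ?m (expect N (identity_form N ^ Suc a * mixed_form N F ^ b)) =
      (of_nat (N + ?m - 2) / of_nat ?m) *\<^sub>C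
        normalized_value N (a + b) (expect N (identity_form N ^ a * mixed_form N F ^ b))"
    unfolding expect_identity_form_Suc m(2)[symmetric]
    by (rule normalized_value_partial_trace[OF m(1) N]) (use expect_form_product_nth_eq_0 m(2) in auto)
  also have "\<dots> = (of_nat (N + ?m - 2) / of_nat ?m *
      (of_nat ((N + a + b - 2) choose a) / of_nat ((a + b) choose a))) *\<^sub>C
      normalized_value N b (expect N (mixed_form N F ^ b))"
    by (simp only: Suc.IH cscale_cscale)
  also have "of_nat (N + ?m - 2) / of_nat ?m *
      (of_nat ((N + a + b - 2) choose a) / of_nat ((a + b) choose a)) =
      (of_nat ((N + Suc a + b - 2) choose Suc a) / of_nat ((Suc a + b) choose Suc a) :: complex)"
  proof -
    define k where "k = N + a + b - 2"
    have k: "N + ?m - 2 = Suc k" "N + Suc a + b - 2 = Suc k" using N b by (simp_all add: k_def)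
    have "of_nat (Suc a) * of_nat (Suc n choose Suc a) = (of_nat (Suc n) * of_nat (n choose a) :: complex)" for n
      by (metis Suc_times_binomial of_nat_mult)
    then have s: "of_nat (Suc n choose Suc a) = (of_nat (Suc n) * of_nat (n choose a) / of_nat (Suc a) :: complex)" for n
      by (simp add: field_simps del: of_nat_Suc)
    have "Suc a + b = Suc (a + b)" by simp
    then show ?thesis unfolding k k_def[symmetric] by (simp only: s) (simp del: of_nat_Suc)
  qed
  finally show ?case .
qed simp

text \<open>The moments of the identity form alone contribute only to the coefficient of \<open>T\<^sup>m\<close>. Any complex scalar
  is admissible there, because \<open>T\<^sup>m\<close> is killed by the application to 1.\<close>

lemma expect_identity_form_power_nth_scalar:
  "\<exists>c. fps_nth (expect N (identity_form N ^ a :: dot multiset \<Rightarrow>\<^sub>0 'a)) r = c *\<^sub>C 1"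
proof (induction a arbitrary: r)
  case 0
  show ?case by (cases "r = 0") (auto intro: exI[of _ 1] exI[of _ 0])
next
  case (Suc a)
  obtain c d where c: "fps_nth (expect N (identity_form N ^ a :: dot multiset \<Rightarrow>\<^sub>0 'a)) r = c *\<^sub>C 1"
    and d: "fps_nth (expect N (identity_form N ^ a :: dot multiset \<Rightarrow>\<^sub>0 'a)) (r - 1) = d *\<^sub>C 1"
    using Suc by metis
  have "expect N (identity_form N ^ Suc a) =
      (of_nat N + of_nat a * (1 + fps_X)) * expect N (identity_form N ^ a)
      + 2 * fps_X * (1 - fps_X) * fps_deriv (expect N (identity_form N ^ a :: dot multiset \<Rightarrow>\<^sub>0 'a))"
    using expect_identity_form_Suc[of N a F 0] by simp
  then have "fps_nth (expect N (identity_form N ^ Suc a :: dot multiset \<Rightarrow>\<^sub>0 'a)) r =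
      (of_int (int N + int a + 2 * int r) * c + (if r = 0 then 0 else of_int (int a + 2 - 2 * int r) * d)) *\<^sub>C 1"
    by (simp only: partial_trace_coeff c d of_int_mult_cscale[where 'a = 'a] cscale_cscale)
      (simp add: cscale_add_left del: of_int_add of_int_diff of_int_mult)
  then show ?case by blast
qed

lemma normalized_value_identity_form_power_scalar:
  "\<exists>c. normalized_value N m (expect N (identity_form N ^ a :: dot multiset \<Rightarrow>\<^sub>0 'a)) = c *\<^sub>C 1"
proof -
  obtain c where "fps_nth (expect N (identity_form N ^ a :: dot multiset \<Rightarrow>\<^sub>0 'a)) r = c r *\<^sub>C 1" for r
    using expect_identity_form_power_nth_scalar by metis
  then show ?thesis
    unfolding normalized_value_def by (simp only: cscale_cscale cscale_sum_left[symmetric]) blast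
qed

lemma normalized_value_mixed_form_power:
  assumes b: "b \<ge> 1"
  shows "normalized_value N b (expect N (mixed_form N F ^ b)) = (if even b then h b else 0)"
proof (cases "even b")
  case True
  then obtain l where l: "b = 2 * l" by (rule evenE)
  have coeff: "sym_coeff N b r *\<^sub>C fps_nth (expect N (mixed_form N F ^ b)) r =
      (fact b * (of_nat (l choose r) / ((of_nat N / 2 + of_nat b - 2) gchoose r))) *\<^sub>C h b" for r
  proof -
    have "fps_nth (expect N (mixed_form N F ^ b)) r = (of_int ((-1) ^ r * int (l choose r)) * of_nat (fact b)) *\<^sub>C h b"
      unfolding expect_mixed_form_power_nth using True
      by (simp only: if_True of_int_mult_cscale of_nat_mult_cscale cscale_cscale l) simp
    then show ?thesis
      by (cases "even r") (simp_all add: sym_coeff_def mult.commute)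
  qed
  have "normalized_value N b (expect N (mixed_form N F ^ b)) =
      (gamma_factor b (of_nat N) * (\<Sum>r\<le>l. of_nat (l choose r) / ((of_nat N / 2 + of_nat b - 2) gchoose r))) *\<^sub>C h b"
  proof -
    have "b div 2 = l" by (simp add: l)
    moreover have "g / fact b * (fact b * s) = g * s" for g s :: complex by simp
    ultimately show ?thesis
      by (simp only: normalized_value_def coeff atLeast0AtMost cscale_sum_left[symmetric]
          sum_distrib_left[symmetric] cscale_cscale)
  qed
  also have "\<dots> = h b"
    using gamma_sum_eq_1[of l N] b N l by simp
  finally show ?thesis using True by simp
next
  case False
  then show ?thesis by (simp add: normalized_value_def expect_mixed_form_power_nth)
qed

lemma expect_shifted_power:
  "expect N ((const T * identity_form N + mixed_form N F) ^ m) =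
    (\<Sum>k\<le>m. fps_const (of_nat (m choose k) * T ^ k) * expect N (identity_form N ^ k * mixed_form N F ^ (m - k)))"
proof -
  have "const T ^ k = (const (T ^ k) :: dot multiset \<Rightarrow>\<^sub>0 'a)" for k
    by (induction k) (simp_all add: const_mult)
  then have "(const T * identity_form N + mixed_form N F) ^ m =
      (\<Sum>k\<le>m. const (of_nat (m choose k) * T ^ k) * (identity_form N ^ k * mixed_form N F ^ (m - k)))"
    unfolding binomial_ring
    by (intro sum.cong refl) (simp add: power_mult_distrib const_mult const_of_nat mult_ac)
  then show ?thesis by (simp only: gaussian_sum gaussian_const_mult)
qed

text \<open>The binomial expansion of the \<open>m\<close>-th power: the quotient of binomial coefficients in
  \<open>normalized_value_form_product\<close> has the binomial coefficient of the expansion as its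
  denominator.\<close>

theorem normalized_value_shifted_power:
  assumes m: "m \<ge> 1"
  shows "\<exists>c. normalized_value N m (expect N ((const T * identity_form N + mixed_form N F) ^ m)) =
    c *\<^sub>C T ^ m + (\<Sum>l=1..m div 2. of_nat ((N + m - 2) choose (m - 2 * l)) * (T ^ (m - 2 * l) * h (2 * l)))"
proof -
  let ?s = "\<lambda>k. of_nat (m choose k) * T ^ k *
    normalized_value N m (expect N (identity_form N ^ k * mixed_form N F ^ (m - k)))"
  have term_lt: "?s k = (if even (m - k) then of_nat ((N + m - 2) choose k) * (T ^ k * h (m - k)) else 0)"
    if k: "k < m" for k
  proof -
    have "N + k + (m - k) - 2 = N + m - 2" "k + (m - k) = m" using k by simp_all
    then have "normalized_value N m (expect N (identity_form N ^ k * mixed_form N F ^ (m - k))) =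
      (of_nat ((N + m - 2) choose k) / of_nat (m choose k)) *\<^sub>C (if even (m - k) then h (m - k) else 0)"
      using normalized_value_form_product[of "m - k" k] normalized_value_mixed_form_power[of "m - k"] k
      by (simp only: if_True)
    then show ?thesis
      using k by (simp add: of_nat_mult_cscale[where 'a = 'a])
  qed
  obtain c where c: "normalized_value N m (expect N (identity_form N ^ m :: dot multiset \<Rightarrow>\<^sub>0 'a)) = c *\<^sub>C 1"
    using normalized_value_identity_form_power_scalar by blast
  have "normalized_value N m (expect N ((const T * identity_form N + mixed_form N F) ^ m)) = (\<Sum>k\<le>m. ?s k)"
    unfolding expect_shifted_power normalized_value_sum normalized_value_const_mult ..
  also have "\<dots> = ?s m + (\<Sum>k<m. ?s k)"
    by (simp add: lessThan_Suc_atMost[symmetric])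
  also have "?s m = c *\<^sub>C T ^ m" by (simp add: c)
  also have "(\<Sum>k<m. ?s k) =
      (\<Sum>k<m. if even (m - k) then of_nat ((N + m - 2) choose k) * (T ^ k * h (m - k)) else 0)"
    by (rule sum.cong[OF refl], rule term_lt) simp
  also have "\<dots> = (\<Sum>k\<in>{k \<in> {..<m}. even (m - k)}. of_nat ((N + m - 2) choose k) * (T ^ k * h (m - k)))"
    by (rule sum.inter_filter[symmetric]) simp
  also have "\<dots> = (\<Sum>l=1..m div 2. of_nat ((N + m - 2) choose (m - 2 * l)) * (T ^ (m - 2 * l) * h (2 * l)))"
    by (rule sum.reindex_bij_witness[of _ "\<lambda>l. m - 2 * l" "\<lambda>k. (m - k) div 2"]) (auto elim!: evenE, presburger)
  finally show ?thesis by blast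
qed

end

section \<open>Products of Brauer diagrams\<close>

lemma diagrams_eq: "diagrams m = perfect_matchings (dots m)"
  by (simp add: diagrams_def perfect_matchings_def)

lemma finite_dots [simp]: "finite (dots m)"
  by (simp add: dots_def)

lemma finite_diagrams: "finite (diagrams m)"
  by (simp add: diagrams_eq finite_perfect_matchings)

lemma perfect_matching_edge_cases:
  assumes "d \<in> perfect_matchings V" "e \<in> d"
  obtains x y where "e = {x, y}" "x \<noteq> y" "x \<in> V" "y \<in> V"
proof -
  obtain x y where xy: "e = {x, y}" "x \<noteq> y"
    using perfect_matching_edgeD(2)[OF assms] by (metis card_2_iff)
  moreover have "e \<subseteq> V" by (rule perfect_matching_edgeD(1)[OF assms])
  ultimately show thesis using that by blast
qed

lemma perfect_matching_edge_eqI: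
  assumes "d \<in> perfect_matchings V" "e \<in> d" "x \<in> e" "y \<in> e" "x \<noteq> y"
  shows "e = {x, y}"
  by (rule perfect_matching_edge_cases[OF assms(1,2)]) (use assms(3-5) in auto)

lemma perfect_matching_exchange:
  assumes d: "d \<in> perfect_matchings V" and e: "{a, b} \<in> d" "{c, e} \<in> d" and ne: "{a, b} \<noteq> {c, e}"
  shows "insert {a, c} (insert {b, e} (d - {{a, b}} - {{c, e}})) \<in> perfect_matchings V"
proof -
  have ab: "a \<noteq> b" "a \<in> V" "b \<in> V" and ce: "c \<noteq> e" "c \<in> V" "e \<in> V"
    using perfect_matching_edgeD[OF d e(1)] perfect_matching_edgeD[OF d e(2)] by (auto simp: card_2_iff)
  have disj: "{a, b} \<inter> {c, e} = {}"
    using perfect_matching_unique[OF d e] ne by blast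
  have "{c, e} \<in> d - {{a, b}}" using e(2) ne by simp
  from perfect_matching_remove[OF perfect_matching_remove[OF d e(1)] this]
  have "d - {{a, b}} - {{c, e}} \<in> perfect_matchings (V - {a, b} - {c, e})" .
  also have "V - {a, b} - {c, e} = V - {a, c} - {b, e}" by blast
  finally have "insert {b, e} (d - {{a, b}} - {{c, e}}) \<in> perfect_matchings (V - {a, c})"
    by (rule perfect_matching_insert(1)) (use ab ce disj in auto)
  then show ?thesis
    by (rule perfect_matching_insert(1)) (use ab ce disj in auto)
qed

lemma sym_connected_in_stack: "sym (connected_in_stack d d')"
  unfolding connected_in_stack_def by (rule sym_rtrancl) (auto simp: sym_def insert_commute)

lemma trans_connected_in_stack:
  "(u, v) \<in> connected_in_stack d d' \<Longrightarrow> (v, w) \<in> connected_in_stack d d' \<Longrightarrow> (u, w) \<in> connected_in_stack d d'"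
  unfolding connected_in_stack_def by (rule rtrancl_trans)

lemma connected_in_stack_lower:
  assumes "{x, y} \<in> d"
  shows "(place 1 0 x, place 1 0 y) \<in> connected_in_stack d d'"
proof -
  have "place 1 0 ` {x, y} \<in> (`) (place 1 0) ` d" using assms by (rule imageI)
  then show ?thesis unfolding connected_in_stack_def by (intro r_into_rtrancl) simp
qed

lemma connected_in_stack_upper:
  assumes "{x, y} \<in> d'"
  shows "(place 2 1 x, place 2 1 y) \<in> connected_in_stack d d'"
proof -
  have "place 2 1 ` {x, y} \<in> (`) (place 2 1) ` d'" using assms by (rule imageI)
  then show ?thesis unfolding connected_in_stack_def by (intro r_into_rtrancl) simp
qed

text \<open>A criterion for products without closed loops. A function \<open>f\<close> that is constant along the edges of the stack
  and sends an outer dot to its edge in \<open>d\<close> separates the components; paths between the ends of every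
  edge of \<open>d\<close> show that the components are not smaller, and no component stays in the middle row.\<close>

lemma stack_eqI:
  assumes d: "d \<in> diagrams m"
    and lower: "\<And>e x y. e \<in> d1 \<Longrightarrow> x \<in> e \<Longrightarrow> y \<in> e \<Longrightarrow> f (place 1 0 x) = f (place 1 0 y)"
    and upper: "\<And>e x y. e \<in> d2 \<Longrightarrow> x \<in> e \<Longrightarrow> y \<in> e \<Longrightarrow> f (place 2 1 x) = f (place 2 1 y)"
    and outer: "\<And>x. x \<in> dots m \<Longrightarrow> f (place 2 0 x) \<in> d \<and> x \<in> f (place 2 0 x)"
    and conn: "\<And>x y. {x, y} \<in> d \<Longrightarrow> x \<noteq> y \<Longrightarrow> (place 2 0 x, place 2 0 y) \<in> connected_in_stack d1 d2"
    and middle: "\<And>a. a \<in> {1..m} \<Longrightarrow> \<exists>v. fst v \<noteq> 1 \<and> ((1, a), v) \<in> connected_in_stack d1 d2"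
  shows "diagram_mult m d1 d2 = d \<and> closed_loops m d1 d2 = 0"
proof -
  have f: "f u = f v" if "(u, v) \<in> connected_in_stack d1 d2" for u v
    using that unfolding connected_in_stack_def
  proof induction
    case (step v w)
    then obtain e g where e: "{v, w} = g ` e" "(e \<in> d1 \<and> g = place 1 0) \<or> (e \<in> d2 \<and> g = place 2 1)"
      by auto
    then obtain x y where "x \<in> e" "y \<in> e" "v = g x" "w = g y" by blast
    then have "f v = f w" using e(2) lower upper by metis
    with step show ?case by simp
  qed simp
  have d': "d \<in> perfect_matchings (dots m)" using d by (simp add: diagrams_eq)
  have "diagram_mult m d1 d2 = d"
  proof
    show "diagram_mult m d1 d2 \<subseteq> d"
    proof
      fix e assume "e \<in> diagram_mult m d1 d2"
      then obtain u v where e: "e = {u, v}" and uv: "u \<in> dots m" "v \<in> dots m" "u \<noteq> v"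
        "(place 2 0 u, place 2 0 v) \<in> connected_in_stack d1 d2"
        by (auto simp: diagram_mult_def)
      have "f (place 2 0 u) = {u, v}"
        by (rule perfect_matching_edge_eqI[OF d']) (use outer uv f[OF uv(4)] in auto)
      then show "e \<in> d" using outer[OF uv(1)] by (simp add: e)
    qed
    show "d \<subseteq> diagram_mult m d1 d2"
    proof
      fix e assume "e \<in> d"
      then obtain x y where "e = {x, y}" "x \<noteq> y" "x \<in> dots m" "y \<in> dots m"
        by (rule perfect_matching_edge_cases[OF d'])
      then show "e \<in> diagram_mult m d1 d2"
        using conn \<open>e \<in> d\<close> unfolding diagram_mult_def by blast
    qed
  qed
  have "\<not> connected_in_stack d1 d2 `` {(1, a)} \<subseteq> {1} \<times> {1..m}" if "a \<in> {1..m}" for a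
    using middle[OF that] by fastforce
  then have "{C. \<exists>a\<in>{1..m}. C = connected_in_stack d1 d2 `` {(1, a)} \<and> C \<subseteq> {1} \<times> {1..m}} = {}"
    by blast
  then have "closed_loops m d1 d2 = 0" by (simp add: closed_loops_def)
  with \<open>diagram_mult m d1 d2 = d\<close> show ?thesis ..
qed

lemma perm_diagram_in_diagrams:
  assumes "\<sigma> permutes {1..m}"
  shows "perm_diagram m \<sigma> \<in> diagrams m"
  unfolding diagrams_eq
proof (rule perfect_matchingI)
  have mem: "\<sigma> a \<in> {1..m} \<longleftrightarrow> a \<in> {1..m}" for a by (rule permutes_in_image[OF assms])
  show "e \<subseteq> dots m \<and> card e = 2" if e: "e \<in> perm_diagram m \<sigma>" for e
  proof -
    obtain a where a: "a \<in> {1..m}" "e = {Top a, Bottom (\<sigma> a)}"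
      using e unfolding perm_diagram_def by blast
    moreover have "\<sigma> a \<in> {1..m}" using a(1) by (simp only: mem)
    ultimately show ?thesis unfolding a(2) dots_def by simp
  qed
  fix v assume v: "v \<in> dots m"
  show "\<exists>!e. e \<in> perm_diagram m \<sigma> \<and> v \<in> e"
  proof (cases v)
    case (Top a)
    then have "a \<in> {1..m}" using v by (auto simp: dots_def)
    then show ?thesis by (intro ex1I[of _ "{Top a, Bottom (\<sigma> a)}"]) (auto simp: perm_diagram_def Top)
  next
    case (Bottom b)
    then have "b \<in> {1..m}" using v by (auto simp: dots_def)
    then obtain a where a: "b = \<sigma> a" "a \<in> {1..m}" using permutes_image[OF assms] by blast
    then show ?thesis
      using permutes_inj[OF assms]
      by (intro ex1I[of _ "{Top a, Bottom (\<sigma> a)}"]) (auto simp: perm_diagram_def Bottom inj_eq)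
  qed
qed

lemma stack_perm_diagrams:
  assumes s: "s permutes {1..m}" and p: "p permutes {1..m}"
  shows "diagram_mult m (perm_diagram m s) (perm_diagram m p) = perm_diagram m (s \<circ> p)"
    "closed_loops m (perm_diagram m s) (perm_diagram m p) = 0"
proof -
  define edge where "edge a = {Top a, Bottom (s (p a))}" for a
  \<comment> \<open>levels 2, 1 and 0 are the top, the middle and the bottom row of the stack\<close>
  define f where "f = (\<lambda>(l :: nat, a). edge (if l = 2 then a else if l = 1 then inv_into UNIV p a else inv_into UNIV p (inv_into UNIV s a)))"
  have ps: "inv_into UNIV p (p a) = a" "inv_into UNIV s (s a) = a" "p (inv_into UNIV p a) = a" "s (inv_into UNIV s a) = a" for a
    using s p by (simp_all add: permutes_inverses)
  have mem: "s a \<in> {1..m} \<longleftrightarrow> a \<in> {1..m}" "p a \<in> {1..m} \<longleftrightarrow> a \<in> {1..m}"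
    "inv_into UNIV p a \<in> {1..m} \<longleftrightarrow> a \<in> {1..m}" "inv_into UNIV s a \<in> {1..m} \<longleftrightarrow> a \<in> {1..m}" for a
    using permutes_in_image[OF s] permutes_in_image[OF p] permutes_in_image[OF permutes_inv[OF s]]
      permutes_in_image[OF permutes_inv[OF p]] by blast+
  have lower: "{Top a, Bottom (s a)} \<in> perm_diagram m s" if "a \<in> {1..m}" for a
    using that by (auto simp: perm_diagram_def)
  have upper: "{Top a, Bottom (p a)} \<in> perm_diagram m p" if "a \<in> {1..m}" for a
    using that by (auto simp: perm_diagram_def)
  have eq: "diagram_mult m (perm_diagram m s) (perm_diagram m p) = perm_diagram m (s \<circ> p) \<and>
    closed_loops m (perm_diagram m s) (perm_diagram m p) = 0"
  proof (rule stack_eqI[where f = f])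
    show "perm_diagram m (s \<circ> p) \<in> diagrams m"
      by (rule perm_diagram_in_diagrams) (rule permutes_compose[OF p s])
    show "f (place 1 0 x) = f (place 1 0 y)" if "e \<in> perm_diagram m s" "x \<in> e" "y \<in> e" for e x y
      using that by (auto simp: perm_diagram_def f_def ps)
    show "f (place 2 1 x) = f (place 2 1 y)" if "e \<in> perm_diagram m p" "x \<in> e" "y \<in> e" for e x y
      using that by (auto simp: perm_diagram_def f_def ps)
    show "f (place 2 0 x) \<in> perm_diagram m (s \<circ> p) \<and> x \<in> f (place 2 0 x)" if "x \<in> dots m" for x
    proof -
      have edge: "edge a \<in> perm_diagram m (s \<circ> p)" if "a \<in> {1..m}" for a
        using that unfolding edge_def perm_diagram_def comp_def by blast
      show ?thesis
      proof (cases x)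
        case (Top a)
        then have "a \<in> {1..m}" using that by (auto simp: dots_def)
        then show ?thesis using edge[of a] by (simp add: Top f_def) (simp add: edge_def)
      next
        case (Bottom b)
        then have "b \<in> {1..m}" using that by (auto simp: dots_def)
        then have "inv_into UNIV p (inv_into UNIV s b) \<in> {1..m}" by (simp only: mem)
        from edge[OF this] show ?thesis by (simp add: Bottom f_def) (simp add: edge_def ps)
      qed
    qed
    show "(place 2 0 x, place 2 0 y) \<in> connected_in_stack (perm_diagram m s) (perm_diagram m p)"
      if xy: "{x, y} \<in> perm_diagram m (s \<circ> p)" for x y
    proof -
      obtain a where a: "a \<in> {1..m}" "{x, y} = {Top a, Bottom (s (p a))}"
        using xy unfolding perm_diagram_def comp_def by blast
      have "((2, a), (1, p a)) \<in> connected_in_stack (perm_diagram m s) (perm_diagram m p)"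
        using connected_in_stack_upper[OF upper[OF a(1)]] by simp
      moreover have "((1, p a), (0, s (p a))) \<in> connected_in_stack (perm_diagram m s) (perm_diagram m p)"
      proof -
        have "p a \<in> {1..m}" using a(1) by (simp only: mem)
        from connected_in_stack_lower[OF lower[OF this]] show ?thesis by simp
      qed
      ultimately have "((2, a), (0, s (p a))) \<in> connected_in_stack (perm_diagram m s) (perm_diagram m p)"
        by (rule trans_connected_in_stack)
      then show ?thesis
        using a(2) symD[OF sym_connected_in_stack] by (auto simp: doubleton_eq_iff)
    qed
    show "\<exists>v. fst v \<noteq> 1 \<and> ((1, a), v) \<in> connected_in_stack (perm_diagram m s) (perm_diagram m p)"
      if "a \<in> {1..m}" for a
      using connected_in_stack_lower[OF lower[OF that]] by (intro exI[of _ "(0, s a)"]) simp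
  qed
  then show "diagram_mult m (perm_diagram m s) (perm_diagram m p) = perm_diagram m (s \<circ> p)"
    "closed_loops m (perm_diagram m s) (perm_diagram m p) = 0" by simp_all
qed

definition contraction_diagram :: "nat \<Rightarrow> nat \<Rightarrow> nat \<Rightarrow> diagram" where
  "contraction_diagram m a b =
     {{Top a, Top b}, {Bottom a, Bottom b}} \<union> {{Top c, Bottom c} | c. c \<in> {1..m} - {a, b}}"

lemma contraction_diagram_in_diagrams:
  assumes "a \<in> {1..m}" "b \<in> {1..m}" "a \<noteq> b"
  shows "contraction_diagram m a b \<in> diagrams m"
proof -
  let ?d = "perm_diagram m id"
  have "?d \<in> perfect_matchings (dots m)"
    using perm_diagram_in_diagrams[OF permutes_id] by (simp add: diagrams_eq)
  then have "insert {Top a, Top b} (insert {Bottom a, Bottom b} (?d - {{Top a, Bottom a}} - {{Top b, Bottom b}}))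
      \<in> perfect_matchings (dots m)"
    by (rule perfect_matching_exchange) (use assms in \<open>auto simp: perm_diagram_def doubleton_eq_iff\<close>)
  also have "insert {Top a, Top b} (insert {Bottom a, Bottom b} (?d - {{Top a, Bottom a}} - {{Top b, Bottom b}})) =
      contraction_diagram m a b"
    by (auto simp: perm_diagram_def contraction_diagram_def doubleton_eq_iff)
  finally show ?thesis by (simp add: diagrams_eq)
qed

text \<open>A diagram with a horizontal edge \<open>ab\<close> in the top row and \<open>ce\<close> in the bottom row is the product of
  \<open>\<epsilon>\<^sub>c\<^sub>e\<close> with a diagram that has the vertical edges \<open>ac\<close> and \<open>be\<close> instead: stacking joins the new edges
  through the arc \<open>ce\<close> of \<open>\<epsilon>\<^sub>c\<^sub>e\<close>, whose other arc becomes the bottom edge. By induction this reduces every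
  diagram to permutations.\<close>

lemma stack_contraction:
  assumes d: "d \<in> diagrams m"
    and top: "{Top a, Top b} \<in> d" and bottom: "{Bottom c, Bottom e} \<in> d"
  defines "d0 \<equiv> insert {Top a, Bottom c} (insert {Top b, Bottom e} (d - {{Top a, Top b}} - {{Bottom c, Bottom e}}))"
  shows "d0 \<in> diagrams m" "diagram_mult m (contraction_diagram m c e) d0 = d"
    "closed_loops m (contraction_diagram m c e) d0 = 0" "top_horizontal d0 < top_horizontal d"
proof -
  let ?E = "contraction_diagram m c e"
  have d': "d \<in> perfect_matchings (dots m)" using d by (simp add: diagrams_eq)
  have "a \<noteq> b" and "c \<noteq> e"
    using perfect_matching_edgeD(2)[OF d' top] perfect_matching_edgeD(2)[OF d' bottom] by auto
  show d0: "d0 \<in> diagrams m"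
    unfolding d0_def diagrams_eq
    by (rule perfect_matching_exchange[OF d' top bottom]) (auto simp: doubleton_eq_iff)
  define edge where "edge x = (THE e'. e' \<in> d \<and> x \<in> e')" for x
  have edge_eq: "edge x = e'" if "e' \<in> d" "x \<in> e'" for x e'
    unfolding edge_def by (rule the_equality) (use that perfect_matching_unique[OF d'] in blast)+
  have edge: "edge x \<in> d \<and> x \<in> edge x" if "x \<in> dots m" for x
    unfolding edge_def by (rule theI') (rule perfect_matching_ex1[OF d' that])
  define f where "f = (\<lambda>(l :: nat, x). if l = 2 then edge (Top x)
     else if l = 1 \<and> x \<in> {c, e} then {Top a, Top b} else edge (Bottom x))"
  have old: "Bottom c \<notin> e'" "Bottom e \<notin> e'" if "e' \<in> d" "e' \<noteq> {Bottom c, Bottom e}" for e'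
    using perfect_matching_unique[OF d' that(1) bottom] that(2) by auto
  have lower: "{Top x, Bottom x} \<in> ?E" if "x \<in> {1..m}" "x \<notin> {c, e}" for x
    using that by (auto simp: contraction_diagram_def)
  have vertical: "(place 2 0 x, place 2 1 x) \<in> connected_in_stack ?E d0"
    if x: "x \<in> dots m" "x \<notin> {Bottom c, Bottom e}" for x
  proof (cases x)
    case (Top y)
    then show ?thesis by (simp add: connected_in_stack_def)
  next
    case (Bottom y)
    then have "{Top y, Bottom y} \<in> ?E" using x by (intro lower) (auto simp: dots_def)
    from connected_in_stack_lower[OF this, of d0] show ?thesis
      using Bottom symD[OF sym_connected_in_stack] by auto
  qed
  have new: "{Top a, Bottom c} \<in> d0" "{Top b, Bottom e} \<in> d0" by (simp_all add: d0_def)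
  have ac: "((2, a), (1, c)) \<in> connected_in_stack ?E d0" and be: "((2, b), (1, e)) \<in> connected_in_stack ?E d0"
    using connected_in_stack_upper[OF new(1)] connected_in_stack_upper[OF new(2)] by simp_all
  have "diagram_mult m ?E d0 = d \<and> closed_loops m ?E d0 = 0"
  proof (rule stack_eqI[where f = f])
    show "d \<in> diagrams m" by (rule d)
    show "f (place 1 0 x) = f (place 1 0 y)" if e': "e' \<in> ?E" "x \<in> e'" "y \<in> e'" for e' x y
    proof -
      have "f (1, c) = f (1, e)" "f (0, c) = f (0, e)"
        using edge_eq[OF bottom, of "Bottom c"] edge_eq[OF bottom, of "Bottom e"] by (simp_all add: f_def)
      moreover have "f (1, z) = f (0, z)" if "z \<notin> {c, e}" for z
        using that by (simp add: f_def)
      moreover have "e' = {Top c, Top e} \<or> e' = {Bottom c, Bottom e} \<or>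
          (\<exists>z. z \<notin> {c, e} \<and> e' = {Top z, Bottom z})"
        using e'(1) unfolding contraction_diagram_def by blast
      ultimately show ?thesis using e'(2,3) by (elim disjE exE conjE) auto
    qed
    show "f (place 2 1 x) = f (place 2 1 y)" if e': "e' \<in> d0" "x \<in> e'" "y \<in> e'" for e' x y
    proof (cases "e' = {Top a, Bottom c} \<or> e' = {Top b, Bottom e}")
      case True
      have "f (2, a) = {Top a, Top b}" "f (2, b) = {Top a, Top b}"
        "f (1, c) = {Top a, Top b}" "f (1, e) = {Top a, Top b}"
        using edge_eq[OF top] by (simp_all add: f_def)
      moreover have "z \<in> {Top a, Bottom c, Top b, Bottom e}" if "z \<in> e'" for z
        using True that by blast
      ultimately have "f (place 2 1 z) = {Top a, Top b}" if "z \<in> e'" for z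
        using that by fastforce
      then show ?thesis using e'(2,3) by simp
    next
      case False
      then have e'd: "e' \<in> d" "e' \<noteq> {Bottom c, Bottom e}" using e'(1) by (auto simp: d0_def)
      have "f (place 2 1 z) = e'" if "z \<in> e'" for z
        using that old[OF e'd] edge_eq[OF e'd(1) that] by (cases z) (auto simp: f_def)
      then show ?thesis using e' by simp
    qed
    show "f (place 2 0 x) \<in> d \<and> x \<in> f (place 2 0 x)" if "x \<in> dots m" for x
      using edge[OF that] by (cases x) (simp_all add: f_def)
    show "(place 2 0 x, place 2 0 y) \<in> connected_in_stack ?E d0" if xy: "{x, y} \<in> d" "x \<noteq> y" for x y
    proof (cases "{x, y} = {Top a, Top b} \<or> {x, y} = {Bottom c, Bottom e}")
      case True
      have "{Top c, Top e} \<in> ?E" "{Bottom c, Bottom e} \<in> ?E" by (simp_all add: contraction_diagram_def)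
      note conn = connected_in_stack_lower[OF this(1), of d0] connected_in_stack_lower[OF this(2), of d0]
      have "((2, a), (2, b)) \<in> connected_in_stack ?E d0"
        using trans_connected_in_stack[OF ac trans_connected_in_stack[OF _ symD[OF sym_connected_in_stack be]]] conn(1)
        by simp
      then show ?thesis
        using True conn(2) symD[OF sym_connected_in_stack] by (auto simp: doubleton_eq_iff)
    next
      case False
      then have "{x, y} \<in> d0" using xy by (auto simp: d0_def)
      then have "(place 2 1 x, place 2 1 y) \<in> connected_in_stack ?E d0"
        by (rule connected_in_stack_upper)
      moreover have "x \<in> dots m" "y \<in> dots m" using perfect_matching_edgeD(1)[OF d' xy(1)] by auto
      moreover have "x \<notin> {Bottom c, Bottom e}" "y \<notin> {Bottom c, Bottom e}"
        using old[OF xy(1)] False by auto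
      ultimately show ?thesis
        using vertical[of x] symD[OF sym_connected_in_stack vertical[of y]] trans_connected_in_stack
        by metis
    qed
    show "\<exists>v. fst v \<noteq> 1 \<and> ((1, x), v) \<in> connected_in_stack ?E d0" if x: "x \<in> {1..m}" for x
    proof (cases "x \<in> {c, e}")
      case True
      then have "((1, x), (2, a)) \<in> connected_in_stack ?E d0 \<or> ((1, x), (2, b)) \<in> connected_in_stack ?E d0"
        using symD[OF sym_connected_in_stack ac] symD[OF sym_connected_in_stack be] by auto
      moreover have "fst (2 :: nat, z :: nat) \<noteq> 1" for z by simp
      ultimately show ?thesis by blast
    next
      case False
      from connected_in_stack_lower[OF lower[OF x this], of d0] show ?thesis
        by (intro exI[of _ "(0, x)"]) simp
    qed
  qed
  then show "diagram_mult m ?E d0 = d" "closed_loops m ?E d0 = 0" by simp_all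
  have "{e' \<in> d0. e' \<subseteq> range Top} \<subset> {e' \<in> d. e' \<subseteq> range Top}"
  proof
    show "{e' \<in> d0. e' \<subseteq> range Top} \<subseteq> {e' \<in> d. e' \<subseteq> range Top}" by (auto simp: d0_def)
    have "{Top a, Top b} \<notin> d0" by (auto simp: d0_def doubleton_eq_iff)
    then show "{e' \<in> d0. e' \<subseteq> range Top} \<noteq> {e' \<in> d. e' \<subseteq> range Top}" using top by blast
  qed
  moreover have "finite {e' \<in> d. e' \<subseteq> range Top}"
    using finite_perfect_matching[OF finite_dots d'] by simp
  ultimately show "top_horizontal d0 < top_horizontal d"
    unfolding top_horizontal_def by (rule psubset_card_mono[rotated])
qed

lemma no_top_horizontal_imp_perm:
  assumes d: "d \<in> diagrams m" and h: "top_horizontal d = 0"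
  shows "\<exists>\<sigma>. \<sigma> permutes {1..m} \<and> d = perm_diagram m \<sigma>"
proof -
  have d': "d \<in> perfect_matchings (dots m)" using d by (simp add: diagrams_eq)
  have "finite {e' \<in> d. e' \<subseteq> range Top}"
    using finite_perfect_matching[OF finite_dots d'] by simp
  then have none: "e \<notin> d" if "e \<subseteq> range Top" for e
    using h that by (auto simp: top_horizontal_def)
  have ex: "\<exists>b. b \<in> {1..m} \<and> {Top a, Bottom b} \<in> d" if a: "a \<in> {1..m}" for a
  proof -
    have "Top a \<in> dots m" using a by (simp add: dots_def)
    then obtain x where x: "x \<in> dots m - {Top a}" "{Top a, x} \<in> d"
      by (rule perfect_matching_partner[OF d'])
    show ?thesis using x none[of "{Top a, x}"] by (cases x) (auto simp: dots_def)
  qed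
  define \<sigma> where "\<sigma> a = (if a \<in> {1..m} then SOME b. b \<in> {1..m} \<and> {Top a, Bottom b} \<in> d else a)" for a
  have \<sigma>: "\<sigma> a \<in> {1..m}" "{Top a, Bottom (\<sigma> a)} \<in> d" if "a \<in> {1..m}" for a
    using someI_ex[OF ex[OF that]] that by (auto simp: \<sigma>_def)
  have inj: "inj_on \<sigma> {1..m}"
  proof (rule inj_onI)
    fix a b assume ab: "a \<in> {1..m}" "b \<in> {1..m}" "\<sigma> a = \<sigma> b"
    have "{Top a, Bottom (\<sigma> a)} = {Top b, Bottom (\<sigma> b)}"
      by (rule perfect_matching_unique[OF d' \<sigma>(2)[OF ab(1)] \<sigma>(2)[OF ab(2)], of "Bottom (\<sigma> a)"])
        (simp_all add: ab(3))
    then show "a = b" by (simp add: doubleton_eq_iff)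
  qed
  have img: "\<sigma> ` {1..m} = {1..m}"
    by (rule endo_inj_surj) (use \<sigma> inj in auto)
  have perm: "\<sigma> permutes {1..m}"
    by (rule bij_imp_permutes) (use inj img in \<open>auto simp: bij_betw_def \<sigma>_def\<close>)
  moreover have "d = perm_diagram m \<sigma>"
  proof
    show "perm_diagram m \<sigma> \<subseteq> d" using \<sigma>(2) by (auto simp: perm_diagram_def)
    show "d \<subseteq> perm_diagram m \<sigma>"
    proof
      fix e assume e: "e \<in> d"
      then obtain x y where xy: "e = {x, y}" "x \<in> dots m" "y \<in> dots m"
        by (rule perfect_matching_edge_cases[OF d'])
      have "\<exists>a\<in>{1..m}. e = {Top a, Bottom (\<sigma> a)}"
      proof (cases x)
        case (Top a)
        then have "a \<in> {1..m}" using xy by (auto simp: dots_def)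
        moreover have "e = {Top a, Bottom (\<sigma> a)}"
          by (rule perfect_matching_unique[OF d' e \<sigma>(2)[OF \<open>a \<in> {1..m}\<close>], of "Top a"]) (simp_all add: xy Top)
        ultimately show ?thesis by blast
      next
        case (Bottom b)
        then have "b \<in> \<sigma> ` {1..m}" using xy img by (auto simp: dots_def)
        then obtain a where a: "a \<in> {1..m}" "b = \<sigma> a" by blast
        have "e = {Top a, Bottom (\<sigma> a)}"
          by (rule perfect_matching_unique[OF d' e \<sigma>(2)[OF a(1)], of "Bottom b"]) (simp_all add: xy Bottom a(2))
        then show ?thesis using a(1) by blast
      qed
      then show "e \<in> perm_diagram m \<sigma>" by (auto simp: perm_diagram_def)
    qed
  qed
  ultimately show ?thesis by blast
qed

text \<open>Otherwise the partners of the \<open>m\<close> bottom dots are \<open>m\<close> different top dots other than \<open>a\<close>.\<close>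

lemma top_horizontal_imp_bottom_horizontal:
  assumes d: "d \<in> diagrams m" and top: "{Top a, Top b} \<in> d"
  shows "\<exists>c e. {Bottom c, Bottom e} \<in> d"
proof (rule ccontr)
  assume no: "\<not> (\<exists>c e. {Bottom c, Bottom e} \<in> d)"
  have d': "d \<in> perfect_matchings (dots m)" using d by (simp add: diagrams_eq)
  have a: "a \<in> {1..m}" using perfect_matching_edgeD(1)[OF d' top] by (auto simp: dots_def)
  have "\<exists>t. t \<in> {1..m} - {a} \<and> {Top t, Bottom c} \<in> d" if c: "c \<in> {1..m}" for c
  proof -
    have "Bottom c \<in> dots m" using c by (simp add: dots_def)
    then obtain x where x: "x \<in> dots m - {Bottom c}" "{Bottom c, x} \<in> d"
      by (rule perfect_matching_partner[OF d'])
    show ?thesis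
    proof (cases x)
      case (Top t)
      have "t \<noteq> a"
      proof
        assume "t = a"
        then have "{Bottom c, x} = {Top a, Top b}"
          using Top by (intro perfect_matching_unique[OF d' x(2) top, of "Top a"]) auto
              then show False by (auto simp: doubleton_eq_iff)
      qed
      then show ?thesis using x Top by (auto simp: dots_def insert_commute)
    next
      case (Bottom y)
      then show ?thesis using x no by blast
    qed
  qed
  then obtain t where t: "\<And>c. c \<in> {1..m} \<Longrightarrow> t c \<in> {1..m} - {a} \<and> {Top (t c), Bottom c} \<in> d"
    by metis
  have "inj_on t {1..m}"
  proof (rule inj_onI)
    fix c e assume ce: "c \<in> {1..m}" "e \<in> {1..m}" "t c = t e"
    have "{Top (t c), Bottom c} = {Top (t e), Bottom e}"
      by (rule perfect_matching_unique[OF d' conjunct2[OF t[OF ce(1)]] conjunct2[OF t[OF ce(2)]],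
            of "Top (t c)"]) (simp_all add: ce(3))
    then show "c = e" by (simp add: doubleton_eq_iff)
  qed
  then have "card {1..m} \<le> card ({1..m} - {a})"
    by (rule card_inj_on_le) (use t in blast, simp)
  moreover have "card ({1..m} - {a}) < card {1..m}"
    by (rule card_Diff1_less[OF finite_atLeastAtMost a])
  ultimately show False by linarith
qed

section \<open>The Brauer action in coordinates\<close>

text \<open>An edge is compatible with a row index \<open>I\<close>, placed at the bottom dots, and a column index \<open>J\<close>, placed at
  the top dots, if the indices at its ends are equal (vertical edge) or reflections of each other
  (horizontal edge). The product \<open>dd'\<close> places \<open>d\<close> under \<open>d'\<close>, so the column index of \<open>d\<close> meets the row index of \<open>d'\<close>
  in the middle row.\<close>

fun joined :: "nat \<Rightarrow> (nat \<Rightarrow> nat) \<Rightarrow> (nat \<Rightarrow> nat) \<Rightarrow> dot \<Rightarrow> dot \<Rightarrow> bool" where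
  "joined N I J (Top a) (Top b) \<longleftrightarrow> J b = reflect N (J a)"
| "joined N I J (Top a) (Bottom b) \<longleftrightarrow> I b = J a"
| "joined N I J (Bottom a) (Top b) \<longleftrightarrow> J b = I a"
| "joined N I J (Bottom a) (Bottom b) \<longleftrightarrow> I b = reflect N (I a)"

definition consistent :: "nat \<Rightarrow> diagram \<Rightarrow> (nat \<Rightarrow> nat) \<Rightarrow> (nat \<Rightarrow> nat) \<Rightarrow> bool" where
  "consistent N d I J \<longleftrightarrow> (\<forall>x y. {x, y} \<in> d \<longrightarrow> x \<noteq> y \<longrightarrow> joined N I J x y)"

definition diagram_op :: "nat \<Rightarrow> diagram \<Rightarrow> complex tensor_op" where
  "diagram_op N d I J = (if consistent N d I J then 1 else 0)"

lemma multi_index_range: "I \<in> multi_indices N m \<Longrightarrow> a \<in> {1..m} \<Longrightarrow> I a \<in> {1..N}"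
  by (auto simp: multi_indices_def)

lemma multi_index_eqI:
  "I \<in> multi_indices N m \<Longrightarrow> J \<in> multi_indices N m \<Longrightarrow> (\<And>a. a \<in> {1..m} \<Longrightarrow> I a = J a) \<Longrightarrow> I = J"
  unfolding multi_indices_def by (rule PiE_ext)

lemma finite_multi_indices [simp]: "finite (multi_indices N m)"
  by (simp add: multi_indices_def finite_PiE)

lemma if_mult_if: "(if A then 1 else 0) * (if B then 1 else 0) = (if A \<and> B then 1 else (0 :: complex))"
  by simp

lemma reflect_eq_iff:
  "i \<in> {1..N} \<Longrightarrow> j \<in> {1..N} \<Longrightarrow> i = reflect N j \<longleftrightarrow> j = reflect N i"
  using reflect_reflect by metis

lemma joined_sym:
  assumes "I \<in> multi_indices N m" "J \<in> multi_indices N m" "x \<in> dots m" "y \<in> dots m"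
  shows "joined N I J x y \<longleftrightarrow> joined N I J y x"
proof -
  have *: "K b = reflect N (K a) \<longleftrightarrow> K a = reflect N (K b)"
    if "K \<in> multi_indices N m" "a \<in> {1..m}" "b \<in> {1..m}" for K a b
    by (rule reflect_eq_iff) (rule multi_index_range[OF that(1) that(3)], rule multi_index_range[OF that(1) that(2)])
  have dots: "a \<in> {1..m}" if "Top a \<in> dots m \<or> Bottom a \<in> dots m" for a
    using that by (auto simp: dots_def)
  show ?thesis
  proof (cases x)
    case x: (Top a)
    show ?thesis
    proof (cases y)
      case (Top b)
      have "a \<in> {1..m}" "b \<in> {1..m}" using dots assms(3,4) x Top by simp_all
      from *[OF assms(2) this] show ?thesis by (simp add: x Top)
    qed (simp add: x eq_commute)
  next
    case x: (Bottom a)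
    show ?thesis
    proof (cases y)
      case (Bottom b)
      have "a \<in> {1..m}" "b \<in> {1..m}" using dots assms(3,4) x Bottom by simp_all
      from *[OF assms(1) this] show ?thesis by (simp add: x Bottom)
    qed (simp add: x eq_commute)
  qed
qed

lemma consistent_perm_diagram:
  "consistent N (perm_diagram m \<sigma>) I J \<longleftrightarrow> (\<forall>a\<in>{1..m}. I (\<sigma> a) = J a)"
proof
  assume c: "consistent N (perm_diagram m \<sigma>) I J"
  show "\<forall>a\<in>{1..m}. I (\<sigma> a) = J a"
  proof
    fix a assume "a \<in> {1..m}"
    then have "{Top a, Bottom (\<sigma> a)} \<in> perm_diagram m \<sigma>" unfolding perm_diagram_def by blast
    then have "joined N I J (Top a) (Bottom (\<sigma> a))" using c unfolding consistent_def by blast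
    then show "I (\<sigma> a) = J a" by simp
  qed
next
  assume I: "\<forall>a\<in>{1..m}. I (\<sigma> a) = J a"
  show "consistent N (perm_diagram m \<sigma>) I J"
    unfolding consistent_def
  proof (intro allI impI)
    fix x y assume "{x, y} \<in> perm_diagram m \<sigma>"
    then obtain a where "a \<in> {1..m}" "{x, y} = {Top a, Bottom (\<sigma> a)}"
      unfolding perm_diagram_def by blast
    then show "joined N I J x y" using I by (auto simp: doubleton_eq_iff)
  qed
qed

lemma Q_op_entry:
  assumes ab: "a \<in> {1..m}" "b \<in> {1..m}" "a \<noteq> b" and I: "I \<in> multi_indices N m" and J: "J \<in> multi_indices N m"
  shows "Q_op N m a b I J =
    (if I b = reflect N (I a) \<and> J b = reflect N (J a) \<and> (\<forall>c\<in>{1..m} - {a, b}. I c = J c) then 1 else 0)"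
proof -
  let ?R = "(if \<forall>c\<in>{1..m} - {a, b}. I c = J c then 1 else 0) :: complex"
  have prod: "(\<Prod>c\<in>{1..m} - {a, b}. identity_matrix (I c) (J c)) = ?R"
    by (auto simp: identity_matrix_def intro!: prod.neutral prod_zero)
  have entry: "simple_tensor m ((\<lambda>_. identity_matrix)(a := A, b := B)) I J = A (I a) (J a) * (B (I b) (J b) * ?R)"
    for A B
  proof -
    let ?M = "(\<lambda>_. identity_matrix)(a := A, b := B)"
    have "simple_tensor m ?M I J = ?M a (I a) (J a) * (\<Prod>c\<in>{1..m} - {a}. ?M c (I c) (J c))"
      unfolding simple_tensor_def by (rule prod.remove) (use ab in auto)
    also have "(\<Prod>c\<in>{1..m} - {a}. ?M c (I c) (J c)) =
        ?M b (I b) (J b) * (\<Prod>c\<in>{1..m} - {a} - {b}. ?M c (I c) (J c))"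
      by (rule prod.remove) (use ab in auto)
    also have "(\<Prod>c\<in>{1..m} - {a} - {b}. ?M c (I c) (J c)) = (\<Prod>c\<in>{1..m} - {a, b}. identity_matrix (I c) (J c))"
      by (rule prod.cong) auto
    finally have "simple_tensor m ?M I J = ?M a (I a) (J a) * (?M b (I b) (J b) * ?R)"
      by (simp only: prod)
    moreover have "?M a = A" "?M b = B" using ab(3) by simp_all
    ultimately show ?thesis by (simp only:)
  qed
  have "Q_op N m a b I J = (\<Sum>i=1..N. \<Sum>j=1..N. if j = J a then (if i = I a then
      (if I b = reflect N (I a) \<and> J b = reflect N (J a) then 1 else 0) * ?R else 0) else 0)"
    unfolding Q_op_def entry by (intro sum.cong refl) (simp add: matrix_unit_def)
  also have "\<dots> = (if I b = reflect N (I a) \<and> J b = reflect N (J a) then 1 else 0) * ?R"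
    using multi_index_range[OF J ab(1)] multi_index_range[OF I ab(1)]
    by (simp only: sum.delta finite_atLeastAtMost if_True)
  finally show ?thesis by auto
qed

text \<open>Exactly one middle index \<open>K\<close> contributes: it agrees with \<open>I\<close> away from \<open>c\<close> and \<open>e\<close>, and the new vertical edges force
  \<open>K(c) = J(a)\<close> and \<open>K(e) = J(b)\<close>.\<close>

lemma op_mult_Q_diagram_op:
  assumes d: "d \<in> diagrams m"
    and top: "{Top a, Top b} \<in> d" and bottom: "{Bottom c, Bottom e} \<in> d"
    and I: "I \<in> multi_indices N m" and J: "J \<in> multi_indices N m"
  defines "d0 \<equiv> insert {Top a, Bottom c} (insert {Top b, Bottom e} (d - {{Top a, Top b}} - {{Bottom c, Bottom e}}))"
  shows "op_mult N m (Q_op N m c e) (diagram_op N d0) I J = diagram_op N d I J"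
proof -
  have d': "d \<in> perfect_matchings (dots m)" using d by (simp add: diagrams_eq)
  have dots: "Top a \<in> dots m" "Top b \<in> dots m" "Bottom c \<in> dots m" "Bottom e \<in> dots m"
    using perfect_matching_edgeD(1)[OF d' top] perfect_matching_edgeD(1)[OF d' bottom] by auto
  then have abce: "a \<in> {1..m}" "b \<in> {1..m}" "c \<in> {1..m}" "e \<in> {1..m}" by (auto simp: dots_def)
  have ce: "c \<noteq> e" using perfect_matching_edgeD(2)[OF d' bottom] by auto
  define K0 where "K0 = I(c := J a, e := J b)"
  have K0: "K0 \<in> multi_indices N m"
    using I abce multi_index_range[OF J abce(1)] multi_index_range[OF J abce(2)]
    by (auto simp: K0_def multi_indices_def PiE_iff extensional_def)
  have K0_val: "K0 c = J a" "K0 e = J b" "z \<notin> {c, e} \<Longrightarrow> K0 z = I z" for z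
    using ce by (simp_all add: K0_def)
  have old: "Bottom c \<notin> {x, y} \<and> Bottom e \<notin> {x, y}" if "{x, y} \<in> d" "{x, y} \<noteq> {Bottom c, Bottom e}" for x y
    using perfect_matching_unique[OF d' that(1) bottom, of "Bottom c"]
      perfect_matching_unique[OF d' that(1) bottom, of "Bottom e"] that(2) by blast
  have joined_K0: "joined N K0 J x y \<longleftrightarrow> joined N I J x y"
    if "Bottom c \<notin> {x, y} \<and> Bottom e \<notin> {x, y}" for x y
    using that K0_val(3) by (cases x; cases y) auto
  have new: "{Top a, Bottom c} \<in> d0" "{Top b, Bottom e} \<in> d0" by (simp_all add: d0_def)
  let ?Q = "\<lambda>K. I e = reflect N (I c) \<and> K e = reflect N (K c) \<and> (\<forall>z\<in>{1..m} - {c, e}. I z = K z)"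
  have key: "?Q K \<and> consistent N d0 K J \<longleftrightarrow> K = K0 \<and> consistent N d I J" if K: "K \<in> multi_indices N m" for K
  proof
    assume QK: "?Q K \<and> consistent N d0 K J"
    have "joined N K J (Top a) (Bottom c)" "joined N K J (Top b) (Bottom e)"
      using QK new unfolding consistent_def by blast+
    then have Kce: "K c = J a" "K e = J b" by simp_all
    have KK0: "K = K0"
    proof (rule multi_index_eqI[OF K K0])
      fix z assume "z \<in> {1..m}"
      then show "K z = K0 z" using QK Kce K0_val by (cases "z \<in> {c, e}") auto
    qed
    have "consistent N d I J"
      unfolding consistent_def
    proof (intro allI impI)
      fix x y assume xy: "{x, y} \<in> d" "x \<noteq> y"
      consider "{x, y} = {Top a, Top b}" | "{x, y} = {Bottom c, Bottom e}"
        | "{x, y} \<noteq> {Top a, Top b}" "{x, y} \<noteq> {Bottom c, Bottom e}" by blast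
      then show "joined N I J x y"
      proof cases
        case 1
        have "joined N I J (Top a) (Top b)" using QK Kce by simp
        then show ?thesis using 1 joined_sym[OF I J dots(1,2)] by (auto simp: doubleton_eq_iff)
      next
        case 2
        have "joined N I J (Bottom c) (Bottom e)" using QK by simp
        then show ?thesis using 2 joined_sym[OF I J dots(3,4)] by (auto simp: doubleton_eq_iff)
      next
        case 3
        then have "{x, y} \<in> d0" using xy by (simp add: d0_def)
        then have "joined N K J x y" using QK xy(2) unfolding consistent_def by blast
        then show ?thesis using joined_K0[OF old[OF xy(1) 3(2)]] KK0 by simp
      qed
    qed
    with KK0 show "K = K0 \<and> consistent N d I J" by simp
  next
    assume KK: "K = K0 \<and> consistent N d I J"
    have tb: "joined N I J (Top a) (Top b)" "joined N I J (Bottom c) (Bottom e)"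
      using KK top bottom perfect_matching_edgeD(2)[OF d' top] ce unfolding consistent_def by fastforce+
    have "consistent N d0 K0 J"
      unfolding consistent_def
    proof (intro allI impI)
      fix x y assume xy: "{x, y} \<in> d0" "x \<noteq> y"
      consider "{x, y} = {Top a, Bottom c}" | "{x, y} = {Top b, Bottom e}"
        | "{x, y} \<in> d" "{x, y} \<noteq> {Bottom c, Bottom e}" using xy unfolding d0_def by blast
      then show "joined N K0 J x y"
      proof cases
        case 3
        then show ?thesis using joined_K0[OF old[OF 3]] KK xy(2) unfolding consistent_def by blast
      qed (auto simp: doubleton_eq_iff K0_val)
    qed
    moreover have "?Q K0" using tb K0_val by auto
    ultimately show "?Q K \<and> consistent N d0 K J" using KK by simp
  qed
  have "Q_op N m c e I K * diagram_op N d0 K J = (if K = K0 then diagram_op N d I J else 0)"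
    if K: "K \<in> multi_indices N m" for K
  proof -
    have "Q_op N m c e I K * diagram_op N d0 K J = (if ?Q K \<and> consistent N d0 K J then 1 else 0)"
      unfolding Q_op_entry[OF abce(3,4) ce I K] diagram_op_def by (rule if_mult_if)
    also have "\<dots> = (if K = K0 \<and> consistent N d I J then 1 else 0)"
      by (simp only: key[OF K])
    finally show ?thesis by (simp add: diagram_op_def)
  qed
  then have "op_mult N m (Q_op N m c e) (diagram_op N d0) I J =
      (\<Sum>K\<in>multi_indices N m. if K = K0 then diagram_op N d I J else 0)"
    unfolding op_mult_def by (intro sum.cong refl)
  then show ?thesis using K0 by (simp add: sum.delta)
qed

lemma op_mult_P_diagram_op:
  assumes ab: "a \<in> {1..m}" "b \<in> {1..m}" and p: "p permutes {1..m}"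
    and I: "I \<in> multi_indices N m" and J: "J \<in> multi_indices N m"
  shows "op_mult N m (P_op m a b) (diagram_op N (perm_diagram m p)) I J =
    diagram_op N (perm_diagram m (transpose a b \<circ> p)) I J"
proof -
  let ?t = "transpose a b"
  have t: "?t permutes {1..m}" by (rule permutes_swap_id) (use ab in auto)
  have tm: "?t z \<in> {1..m} \<longleftrightarrow> z \<in> {1..m}" and pm: "p z \<in> {1..m} \<longleftrightarrow> z \<in> {1..m}" for z
    using permutes_in_image[OF t] permutes_in_image[OF p] by blast+
  define K0 where "K0 = I \<circ> ?t"
  have K0: "K0 \<in> multi_indices N m"
  proof -
    have "K0 z \<in> {1..N}" if "z \<in> {1..m}" for z
      using multi_index_range[OF I, of "?t z"] that tm by (simp only: K0_def comp_def)
    moreover have "K0 z = undefined" if "z \<notin> {1..m}" for z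
    proof -
      have "?t z = z" by (rule permutes_not_in[OF t that])
      moreover have "I z = undefined" using PiE_arb I that unfolding multi_indices_def by metis
      ultimately show ?thesis by (simp add: K0_def)
    qed
    ultimately show ?thesis by (simp add: multi_indices_def PiE_iff extensional_def)
  qed
  have key: "(\<forall>z\<in>{1..m}. I z = K (?t z)) \<and> consistent N (perm_diagram m p) K J \<longleftrightarrow>
      K = K0 \<and> consistent N (perm_diagram m (?t \<circ> p)) I J"
    if K: "K \<in> multi_indices N m" for K
  proof -
    have "(\<forall>z\<in>{1..m}. I z = K (?t z)) \<longleftrightarrow> K = K0"
    proof
      assume *: "\<forall>z\<in>{1..m}. I z = K (?t z)"
      show "K = K0"
      proof (rule multi_index_eqI[OF K K0])
        fix z assume "z \<in> {1..m}"
        then have "I (?t z) = K (?t (?t z))" using * tm by blast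
        then show "K z = K0 z" by (simp add: K0_def)
      qed
    qed (simp add: K0_def)
    then show ?thesis by (auto simp: consistent_perm_diagram K0_def)
  qed
  have "P_op m a b I K * diagram_op N (perm_diagram m p) K J =
      (if K = K0 then diagram_op N (perm_diagram m (?t \<circ> p)) I J else 0)"
    if K: "K \<in> multi_indices N m" for K
  proof -
    have "P_op m a b I K * diagram_op N (perm_diagram m p) K J =
        (if (\<forall>z\<in>{1..m}. I z = K (?t z)) \<and> consistent N (perm_diagram m p) K J then 1 else 0)"
      unfolding P_op_def diagram_op_def by (rule if_mult_if)
    also have "\<dots> = (if K = K0 \<and> consistent N (perm_diagram m (?t \<circ> p)) I J then 1 else 0)"
      by (simp only: key[OF K])
    finally show ?thesis by (simp add: diagram_op_def)
  qed
  then have "op_mult N m (P_op m a b) (diagram_op N (perm_diagram m p)) I J =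
      (\<Sum>K\<in>multi_indices N m. if K = K0 then diagram_op N (perm_diagram m (?t \<circ> p)) I J else 0)"
    unfolding op_mult_def by (intro sum.cong refl)
  then show ?thesis using K0 by (simp add: sum.delta)
qed

lemma op_mult_cong:
  assumes "op_eq N m A A'" "op_eq N m B B'"
  shows "op_eq N m (op_mult N m A B) (op_mult N m A' B')"
  using assms unfolding op_eq_def op_mult_def by (intro ballI sum.cong refl) auto

lemma op_eq_trans [trans]: "op_eq N m A B \<Longrightarrow> op_eq N m B C \<Longrightarrow> op_eq N m A C"
  by (simp add: op_eq_def)

lemma single_in_brauer_carrier: "d \<in> diagrams m \<Longrightarrow> Poly_Mapping.single d c \<in> brauer_carrier m"
  by (simp add: brauer_carrier_def)

lemma brauer_mult_single:
  "brauer_mult \<omega> m (Poly_Mapping.single d 1) (Poly_Mapping.single d' 1) =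
    Poly_Mapping.single (diagram_mult m d d') (\<omega> ^ closed_loops m d d')"
  by (simp add: brauer_mult_def)

lemma brauer_eps_eq: "brauer_eps m a b = Poly_Mapping.single (contraction_diagram m a b) 1"
  by (simp add: brauer_eps_def contraction_diagram_def)

lemma contraction_diagram_commute: "contraction_diagram m a b = contraction_diagram m b a"
  by (simp add: contraction_diagram_def insert_commute)

lemma Q_op_commute:
  assumes "a \<in> {1..m}" "b \<in> {1..m}" "a \<noteq> b"
  shows "op_eq N m (Q_op N m a b) (Q_op N m b a)"
  unfolding op_eq_def
proof (intro ballI)
  fix I J assume IJ: "I \<in> multi_indices N m" "J \<in> multi_indices N m"
  have "I b = reflect N (I a) \<longleftrightarrow> I a = reflect N (I b)" "J b = reflect N (J a) \<longleftrightarrow> J a = reflect N (J b)"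
    by (rule reflect_eq_iff; (rule multi_index_range[OF IJ(1)] multi_index_range[OF IJ(2)], rule assms))+
  then show "Q_op N m a b I J = Q_op N m b a I J"
    using Q_op_entry[OF assms IJ] Q_op_entry[OF assms(2,1) assms(3)[symmetric] IJ]
    by (simp add: insert_commute)
qed

lemma P_op_commute: "P_op m a b = P_op m b a"
  by (intro ext) (simp add: P_op_def transpose_commute)

context
  fixes N m :: nat and \<rho> :: "brauer \<Rightarrow> complex tensor_op"
  assumes \<rho>: "brauer_action N m \<rho>"
begin

lemma brauer_action_add:
  "x \<in> brauer_carrier m \<Longrightarrow> y \<in> brauer_carrier m \<Longrightarrow> op_eq N m (\<rho> (x + y)) (\<lambda>I J. \<rho> x I J + \<rho> y I J)"
  using \<rho> by (simp add: brauer_action_def)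

lemma brauer_action_cscale:
  "x \<in> brauer_carrier m \<Longrightarrow> op_eq N m (\<rho> (c *\<^sub>C x)) (\<lambda>I J. c * \<rho> x I J)"
  using \<rho> by (simp add: brauer_action_def)

lemma brauer_action_mult:
  "x \<in> brauer_carrier m \<Longrightarrow> y \<in> brauer_carrier m \<Longrightarrow>
    op_eq N m (\<rho> (brauer_mult (of_nat N) m x y)) (op_mult N m (\<rho> x) (\<rho> y))"
  using \<rho> by (simp add: brauer_action_def)

lemma brauer_action_one: "op_eq N m (\<rho> (brauer_one m)) op_one"
  using \<rho> by (simp add: brauer_action_def)

lemma brauer_action_s:
  assumes "a \<in> {1..m}" "b \<in> {1..m}" "a \<noteq> b"
  shows "op_eq N m (\<rho> (Poly_Mapping.single (perm_diagram m (transpose a b)) 1)) (P_op m a b)"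
proof -
  have *: "op_eq N m (\<rho> (brauer_s m a b)) (P_op m a b)" if "a \<in> {1..m}" "b \<in> {1..m}" "a < b" for a b
    using \<rho> that by (simp add: brauer_action_def)
  show ?thesis
  proof (cases "a < b")
    case True
    then show ?thesis using *[of a b] assms by (simp add: brauer_s_def)
  next
    case False
    then have "op_eq N m (\<rho> (brauer_s m b a)) (P_op m b a)" using * assms by simp
    then show ?thesis by (simp add: brauer_s_def transpose_commute[of b a] P_op_commute[of m b a])
  qed
qed

lemma brauer_action_eps:
  assumes "a \<in> {1..m}" "b \<in> {1..m}" "a \<noteq> b"
  shows "op_eq N m (\<rho> (Poly_Mapping.single (contraction_diagram m a b) 1)) (Q_op N m a b)"
proof -
  have *: "op_eq N m (\<rho> (brauer_eps m a b)) (Q_op N m a b)" if "a \<in> {1..m}" "b \<in> {1..m}" "a < b" for a b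
    using \<rho> that by (simp add: brauer_action_def)
  show ?thesis
  proof (cases "a < b")
    case True
    then show ?thesis using *[of a b] assms by (simp add: brauer_eps_eq)
  next
    case False
    then have "op_eq N m (\<rho> (brauer_eps m b a)) (Q_op N m b a)" using * assms by simp
    then show ?thesis
      using Q_op_commute[OF assms(2,1) assms(3)[symmetric]]
      by (simp add: brauer_eps_eq contraction_diagram_commute[of m b a]) (rule op_eq_trans)
  qed
qed

lemma brauer_action_perm:
  assumes "p permutes {1..m}"
  shows "op_eq N m (\<rho> (Poly_Mapping.single (perm_diagram m p) 1)) (diagram_op N (perm_diagram m p))"
  using assms finite_atLeastAtMost
proof (induction rule: permutes_induct)
  case id
  have "op_one I J = diagram_op N (perm_diagram m id) I J"
    if "I \<in> multi_indices N m" "J \<in> multi_indices N m" for I J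
    using multi_index_eqI[OF that] by (auto simp: op_one_def diagram_op_def consistent_perm_diagram)
  then show ?case
    using brauer_action_one unfolding brauer_one_def op_eq_def by simp
next
  case (swap a b p)
  let ?t = "transpose a b"
  have t: "?t permutes {1..m}" by (rule permutes_swap_id) (use swap in auto)
  have "brauer_mult (of_nat N) m (Poly_Mapping.single (perm_diagram m ?t) 1) (Poly_Mapping.single (perm_diagram m p) 1) =
      Poly_Mapping.single (perm_diagram m (?t \<circ> p)) 1"
    by (simp add: brauer_mult_single stack_perm_diagrams[OF t \<open>p permutes {1..m}\<close>])
  then have "op_eq N m (\<rho> (Poly_Mapping.single (perm_diagram m (?t \<circ> p)) 1))
      (op_mult N m (\<rho> (Poly_Mapping.single (perm_diagram m ?t) 1)) (\<rho> (Poly_Mapping.single (perm_diagram m p) 1)))"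
    using brauer_action_mult[OF single_in_brauer_carrier[OF perm_diagram_in_diagrams[OF t], of 1]
        single_in_brauer_carrier[OF perm_diagram_in_diagrams[OF \<open>p permutes {1..m}\<close>], of 1]] by simp
  also have "op_eq N m \<dots> (op_mult N m (P_op m a b) (diagram_op N (perm_diagram m p)))"
    by (rule op_mult_cong[OF brauer_action_s swap.IH]) (use swap.hyps in auto)
  also have "op_eq N m \<dots> (diagram_op N (perm_diagram m (?t \<circ> p)))"
    unfolding op_eq_def by (intro ballI op_mult_P_diagram_op) (use swap in auto)
  finally show ?case .
qed

text \<open>Induction on the number of horizontal edges, each of which is split off by \<open>stack_contraction\<close>; permutations
  are products of transpositions.\<close>

lemma brauer_action_diagram:
  "d \<in> diagrams m \<Longrightarrow> op_eq N m (\<rho> (Poly_Mapping.single d 1)) (diagram_op N d)"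
proof (induction "top_horizontal d" arbitrary: d rule: less_induct)
  case less
  note d = \<open>d \<in> diagrams m\<close>
  have d': "d \<in> perfect_matchings (dots m)" using d by (simp add: diagrams_eq)
  show ?case
  proof (cases "top_horizontal d = 0")
    case True
    then show ?thesis using no_top_horizontal_imp_perm[OF d] brauer_action_perm by blast
  next
    case False
    then obtain e0 where e0: "e0 \<in> d" "e0 \<subseteq> range Top"
      by (auto simp: top_horizontal_def card_eq_0_iff)
    obtain x y where xy: "e0 = {x, y}" by (rule perfect_matching_edge_cases[OF d' e0(1)])
    then obtain a b where top: "{Top a, Top b} \<in> d" using e0 by auto
    obtain c e where bottom: "{Bottom c, Bottom e} \<in> d"
      using top_horizontal_imp_bottom_horizontal[OF d top] by blast
    define d0 where "d0 = insert {Top a, Bottom c} (insert {Top b, Bottom e} (d - {{Top a, Top b}} - {{Bottom c, Bottom e}}))"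
    note stack = stack_contraction[OF d top bottom, folded d0_def]
    have ce: "c \<in> {1..m}" "e \<in> {1..m}" "c \<noteq> e"
      using perfect_matching_edgeD(1)[OF d' bottom] perfect_matching_edgeD(2)[OF d' bottom] by (auto simp: dots_def)
    have "brauer_mult (of_nat N) m (Poly_Mapping.single (contraction_diagram m c e) 1) (Poly_Mapping.single d0 1) =
        Poly_Mapping.single d 1"
      by (simp add: brauer_mult_single stack)
    then have "op_eq N m (\<rho> (Poly_Mapping.single d 1))
        (op_mult N m (\<rho> (Poly_Mapping.single (contraction_diagram m c e) 1)) (\<rho> (Poly_Mapping.single d0 1)))"
      using brauer_action_mult[OF single_in_brauer_carrier[OF contraction_diagram_in_diagrams[OF ce], of 1]
          single_in_brauer_carrier[OF stack(1), of 1]] by simp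
    also have "op_eq N m \<dots> (op_mult N m (Q_op N m c e) (diagram_op N d0))"
      by (rule op_mult_cong[OF brauer_action_eps[OF ce] less.hyps]) (use stack in auto)
    also have "op_eq N m \<dots> (diagram_op N d)"
      unfolding op_eq_def d0_def by (intro ballI op_mult_Q_diagram_op[OF d top bottom])
    finally show ?thesis .
  qed
qed

lemma brauer_action_sum:
  assumes "finite A" "\<And>i. i \<in> A \<Longrightarrow> x i \<in> brauer_carrier m"
  shows "(\<Sum>i\<in>A. x i) \<in> brauer_carrier m \<and> op_eq N m (\<rho> (\<Sum>i\<in>A. x i)) (\<lambda>I J. \<Sum>i\<in>A. \<rho> (x i) I J)"
  using assms
proof (induction A)
  case empty
  have "0 \<in> brauer_carrier m" by (simp add: brauer_carrier_def)
  then show ?case using brauer_action_cscale[of 0 0] by (simp add: op_eq_def)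
next
  case (insert a A)
  then have IH: "(\<Sum>i\<in>A. x i) \<in> brauer_carrier m"
    "op_eq N m (\<rho> (\<Sum>i\<in>A. x i)) (\<lambda>I J. \<Sum>i\<in>A. \<rho> (x i) I J)" "x a \<in> brauer_carrier m" by simp_all
  then have "x a + (\<Sum>i\<in>A. x i) \<in> brauer_carrier m"
    using keys_add[of "x a" "\<Sum>i\<in>A. x i"] by (auto simp: brauer_carrier_def)
  moreover have "op_eq N m (\<rho> (x a + (\<Sum>i\<in>A. x i))) (\<lambda>I J. \<rho> (x a) I J + (\<Sum>i\<in>A. \<rho> (x i) I J))"
    using brauer_action_add[OF IH(3,1)] IH(2) by (simp add: op_eq_def)
  ultimately show ?case using insert.hyps by simp
qed

lemma cscale_in_brauer_carrier: "x \<in> brauer_carrier m \<Longrightarrow> c *\<^sub>C x \<in> brauer_carrier m"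
  by (auto simp: brauer_carrier_def in_keys_iff cscale_complex_def)

lemma brauer_action_symmetrizer:
  assumes IJ: "I \<in> multi_indices N m" "J \<in> multi_indices N m"
  shows "\<rho> (symmetrizer (of_nat N) m) I J = (1 / fact m) *
    (\<Sum>r=0..m div 2. sym_coeff N m r * (\<Sum>d | d \<in> diagrams m \<and> top_horizontal d = r. diagram_op N d I J))"
proof -
  define D where "D r = {d. d \<in> diagrams m \<and> top_horizontal d = r}" for r
  define x where "x r = (\<Sum>d\<in>D r. Poly_Mapping.single d (1 :: complex))" for r
  have fin: "finite (D r)" for r
    by (rule finite_subset[OF _ finite_diagrams[of m]]) (auto simp: D_def)
  have D: "Poly_Mapping.single d 1 \<in> brauer_carrier m" if "d \<in> D r" for d r
    using that by (intro single_in_brauer_carrier) (simp add: D_def)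
  have x: "x r \<in> brauer_carrier m" "\<rho> (x r) I J = (\<Sum>d\<in>D r. diagram_op N d I J)" for r
  proof -
    have *: "x r \<in> brauer_carrier m \<and> op_eq N m (\<rho> (x r)) (\<lambda>I J. \<Sum>d\<in>D r. \<rho> (Poly_Mapping.single d 1) I J)"
      unfolding x_def by (rule brauer_action_sum[OF fin]) (rule D)
    then show "x r \<in> brauer_carrier m" by blast
    have "\<rho> (x r) I J = (\<Sum>d\<in>D r. \<rho> (Poly_Mapping.single d 1) I J)"
      using * IJ by (simp add: op_eq_def)
    also have "\<dots> = (\<Sum>d\<in>D r. diagram_op N d I J)"
      by (rule sum.cong[OF refl]) (use brauer_action_diagram IJ in \<open>simp add: D_def op_eq_def\<close>)
    finally show "\<rho> (x r) I J = (\<Sum>d\<in>D r. diagram_op N d I J)" .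
  qed
  have sum: "(\<Sum>r=0..m div 2. sym_coeff N m r *\<^sub>C x r) \<in> brauer_carrier m \<and>
      op_eq N m (\<rho> (\<Sum>r=0..m div 2. sym_coeff N m r *\<^sub>C x r))
        (\<lambda>I J. \<Sum>r=0..m div 2. \<rho> (sym_coeff N m r *\<^sub>C x r) I J)"
    by (rule brauer_action_sum) (simp_all add: cscale_in_brauer_carrier x)
  have "symmetrizer (of_nat N) m = (1 / fact m) *\<^sub>C (\<Sum>r=0..m div 2. sym_coeff N m r *\<^sub>C x r)"
    by (simp only: symmetrizer_def sym_coeff_def x_def D_def)
  then have "\<rho> (symmetrizer (of_nat N) m) I J = (1 / fact m) * (\<Sum>r=0..m div 2. \<rho> (sym_coeff N m r *\<^sub>C x r) I J)"
    using brauer_action_cscale[OF conjunct1[OF sum], of "1 / fact m"] conjunct2[OF sum] IJ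
    by (simp add: op_eq_def)
  also have "(\<Sum>r=0..m div 2. \<rho> (sym_coeff N m r *\<^sub>C x r) I J) =
      (\<Sum>r=0..m div 2. sym_coeff N m r * (\<Sum>d\<in>D r. diagram_op N d I J))"
    by (intro sum.cong refl) (use brauer_action_cscale[OF x(1)] IJ x(2) in \<open>simp add: op_eq_def\<close>)
  finally show ?thesis by (simp only: D_def)
qed

end

fun label :: "(nat \<Rightarrow> nat) \<Rightarrow> (nat \<Rightarrow> nat) \<Rightarrow> dot \<Rightarrow> dot" where
  "label I J (Top a) = Top (J a)"
| "label I J (Bottom a) = Bottom (I a)"

text \<open>Perfect matchings of the dots are diagrams, and the weight of a diagram is the corresponding matrix
  entry times \<open>u\<^sup>r\<close>.\<close>

lemma wick_labels_nth:
  assumes IJ: "I \<in> multi_indices N m" "J \<in> multi_indices N m"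
  shows "fps_nth (wick (form_weight N) (image_mset (label I J) (mset_set (dots m)))) r =
    (\<Sum>d | d \<in> diagrams m \<and> top_horizontal d = r. diagram_op N d I J) *\<^sub>C (1 :: 'a::{complex_algebra, comm_ring_1})"
proof -
  let ?w = "\<lambda>x y. form_weight N (label I J x) (label I J y) :: 'a fps"
  have weight: "edge_weight ?w e = (if e \<subseteq> range Top then fps_X else 1) *
      (if \<forall>x y. e = {x, y} \<longrightarrow> x \<noteq> y \<longrightarrow> joined N I J x y then 1 else 0)"
    if d: "d \<in> diagrams m" and e: "e \<in> d" for d e
  proof -
    obtain x y where xy: "e = {x, y}" "x \<noteq> y" "x \<in> dots m" "y \<in> dots m"
      using perfect_matching_edge_cases[of d "dots m" e] d e by (auto simp: diagrams_eq)
    have "edge_weight ?w e = ?w x y"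
      unfolding xy(1) by (rule edge_weight_pair) (rule form_weight_sym, rule xy(2))
    also have "\<dots> = (if e \<subseteq> range Top then fps_X else 1) * (if joined N I J x y then 1 else 0)"
      using multi_index_range[OF IJ(1)] multi_index_range[OF IJ(2)] xy
      by (cases x; cases y) (auto simp: dots_def)
    also have "joined N I J x y \<longleftrightarrow> (\<forall>x y. e = {x, y} \<longrightarrow> x \<noteq> y \<longrightarrow> joined N I J x y)"
      using joined_sym[OF IJ xy(3,4)] xy(1,2) by (auto simp: doubleton_eq_iff)
    finally show ?thesis .
  qed
  have prod: "(\<Prod>e\<in>d. edge_weight ?w e) = fps_X ^ top_horizontal d * (if consistent N d I J then 1 else 0)"
    if d: "d \<in> diagrams m" for d
  proof -
    have fin: "finite d" using finite_perfect_matching[OF finite_dots] d by (simp add: diagrams_eq)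
    have "(\<Prod>e\<in>d. edge_weight ?w e) = (\<Prod>e\<in>d. if e \<subseteq> range Top then fps_X else 1) *
        (\<Prod>e\<in>d. if \<forall>x y. e = {x, y} \<longrightarrow> x \<noteq> y \<longrightarrow> joined N I J x y then 1 else 0)"
      unfolding prod.distrib[symmetric] by (rule prod.cong[OF refl]) (rule weight[OF d])
    also have "(\<Prod>e\<in>d. if e \<subseteq> range Top then fps_X else 1 :: 'a fps) = fps_X ^ top_horizontal d"
      using fin by (simp add: top_horizontal_def prod.If_cases Int_def)
    also have "(\<Prod>e\<in>d. if \<forall>x y. e = {x, y} \<longrightarrow> x \<noteq> y \<longrightarrow> joined N I J x y then 1 else 0 :: 'a fps) =
        (if consistent N d I J then 1 else 0)"
    proof (cases "consistent N d I J")
      case True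
      have "(if \<forall>x y. e = {x, y} \<longrightarrow> x \<noteq> y \<longrightarrow> joined N I J x y then 1 else 0 :: 'a fps) = 1"
        if "e \<in> d" for e
        by (rule if_P) (use True that in \<open>unfold consistent_def, blast\<close>)
      then show ?thesis using True by (simp only: prod.neutral_const if_True cong: prod.cong)
    next
      case False
      then obtain e where e: "e \<in> d" "\<not> (\<forall>x y. e = {x, y} \<longrightarrow> x \<noteq> y \<longrightarrow> joined N I J x y)"
        unfolding consistent_def by blast
      have "(if \<forall>x y. e = {x, y} \<longrightarrow> x \<noteq> y \<longrightarrow> joined N I J x y then 1 else 0 :: 'a fps) = 0"
        by (rule if_not_P) (rule e(2))
      then show ?thesis using False e(1) by (simp only: if_False) (rule prod_zero[OF fin], blast)
    qed
    finally show ?thesis .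
  qed
  have "wick (form_weight N) (image_mset (label I J) (mset_set (dots m))) = hafnian ?w (dots m)"
    by (rule hafnian_eq_wick[symmetric]) (simp_all add: form_weight_sym)
  also have "\<dots> = (\<Sum>d\<in>diagrams m. fps_X ^ top_horizontal d * (if consistent N d I J then 1 else 0))"
    unfolding hafnian_def diagrams_eq[symmetric] by (rule sum.cong[OF refl]) (rule prod)
  finally have "fps_nth (wick (form_weight N) (image_mset (label I J) (mset_set (dots m)))) r =
      (\<Sum>d\<in>diagrams m. if top_horizontal d = r then diagram_op N d I J *\<^sub>C (1 :: 'a) else 0)"
    by (simp add: fps_sum_nth) (intro sum.cong refl, auto simp: diagram_op_def)
  also have "\<dots> = (\<Sum>d\<in>{d \<in> diagrams m. top_horizontal d = r}. diagram_op N d I J *\<^sub>C (1 :: 'a))"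
    by (rule sum.inter_filter[symmetric]) (rule finite_diagrams)
  finally show ?thesis by (simp add: cscale_sum_left)
qed

section \<open>From the noncommutative trace to a symmetrized polynomial\<close>

lemma uea_gen_zero: "uea_gen 0 = 0"
  using uea_gen_add[of 0 0] by simp

lemma sym_gen_zero: "sym_gen 0 = 0"
  using sym_gen_add[of 0 0] by simp

lemma sym_gen_uminus: "sym_gen (- x) = - sym_gen x"
  using sym_gen_add[of x "- x"] by (simp add: sym_gen_zero eq_neg_iff_add_eq_0 add.commute)

lemma symmetrization_linear:
  "symmetrization (u + v) = symmetrization u + symmetrization v"
  "symmetrization (c *\<^sub>C u) = c *\<^sub>C symmetrization u"
  "symmetrization 0 = 0"
  by (transfer; simp add: linext_add linext_cscale)+

lemma symmetrization_sum: "symmetrization (\<Sum>i\<in>A. f i) = (\<Sum>i\<in>A. symmetrization (f i))"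
  by (induction A rule: infinite_finite_induct) (simp_all add: symmetrization_linear)

lemma apply_to_one_sum: "apply_to_one (\<Sum>i\<in>A. f i) = (\<Sum>i\<in>A. apply_to_one (f i))"
  by (induction A rule: infinite_finite_induct) (simp_all add: apply_to_one_linear)

text \<open>The symmetrization of \<open>T\<^sup>m\<close> is the power \<open>T\<^sup>m\<close> in the enveloping algebra, and \<open>T1 = 0\<close>.\<close>

lemma apply_to_one_symmetrization_T_power:
  assumes "m \<ge> 1"
  shows "apply_to_one (symmetrization (sym_gen T_ext ^ m)) = (0 :: 'g::complex_lie loop uea)"
proof -
  let ?T = "T_ext :: 'g ext"
  have "sym_gen ?T ^ m = prod_list (map sym_gen (replicate m ?T))"
    by (simp add: prod_list_replicate)
  then have "symmetrization (sym_gen ?T ^ m) = symmetrized_product (replicate m ?T)"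
    by (simp only: symmetrization_prod_list)
  also have "\<dots> = (1 / fact m) *\<^sub>C (\<Sum>\<sigma> | \<sigma> permutes {..<m}. uea_gen ?T ^ m)"
  proof -
    have "prod_list (map (\<lambda>k. uea_gen (replicate m ?T ! \<sigma> k)) [0..<m]) = uea_gen ?T ^ m"
      if "\<sigma> permutes {..<m}" for \<sigma>
    proof -
      have "\<sigma> k < m" if "k < m" for k
        using permutes_in_image[OF \<open>\<sigma> permutes {..<m}\<close>, of k] that by simp
      then have "map (\<lambda>k. uea_gen (replicate m ?T ! \<sigma> k)) [0..<m] = map (\<lambda>k. uea_gen ?T) [0..<m]"
        by (intro map_cong refl) simp
      then show ?thesis by (simp add: map_replicate_const prod_list_replicate)
    qed
    then show ?thesis unfolding symmetrized_product_def by simp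
  qed
  also have "uea_gen ?T ^ m = uea_gen ?T ^ (m - 1) * uea_gen ?T"
    using power_minus_mult[of m "uea_gen ?T"] assms by simp
  finally show ?thesis
    by (simp only: apply_to_one_linear apply_to_one_sum apply_to_one_mult_T sum.neutral_const cscale_zero_right)
qed

text \<open>The entries of the matrix \<open>T + F[-1]\<close>, as elements of \<open>\<complex>T \<oplus> t\<^sup>-\<^sup>1\<oo>\<^sub>N[t\<^sup>-\<^sup>1]\<close>.\<close>

definition shifted_gen :: "nat \<Rightarrow> nat \<Rightarrow> 'n::finite orth ext" where
  "shifted_gen i j = (if i = j then T_ext else 0) + Ext 0 (loop_elt (so_gen i j) (-1))"

lemma simple_tensor_one_place:
  assumes "a \<in> {1..m}"
  shows "simple_tensor m ((\<lambda>_. identity_matrix)(a := A)) I J =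
    (if \<forall>c\<in>{1..m} - {a}. I c = J c then A (I a) (J a) else 0)"
proof -
  let ?M = "(\<lambda>_. identity_matrix)(a := A)"
  have "simple_tensor m ?M I J = ?M a (I a) (J a) * (\<Prod>c\<in>{1..m} - {a}. ?M c (I c) (J c))"
    unfolding simple_tensor_def by (rule prod.remove) (use assms in auto)
  also have "(\<Prod>c\<in>{1..m} - {a}. ?M c (I c) (J c)) = (\<Prod>c\<in>{1..m} - {a}. identity_matrix (I c) (J c))"
    by (rule prod.cong) auto
  also have "\<dots> = (if \<forall>c\<in>{1..m} - {a}. I c = J c then 1 else 0)"
    by (auto simp: identity_matrix_def intro!: prod.neutral prod_zero)
  finally have "simple_tensor m ?M I J = A (I a) (J a) * (if \<forall>c\<in>{1..m} - {a}. I c = J c then 1 else 0)"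
    by (simp only: fun_upd_same)
  then show ?thesis by (simp only: if_distrib[of "(*) _"] mult_1_right mult_zero_right)
qed

lemma T_plus_F_entry:
  assumes a: "a \<in> {1..m}" and I: "I \<in> multi_indices CARD('n) m" and J: "J \<in> multi_indices CARD('n) m"
  shows "T_plus_F m a I J =
    (if \<forall>c\<in>{1..m} - {a}. I c = J c then uea_gen (shifted_gen (I a) (J a) :: 'n::finite orth ext) else 0)"
proof -
  let ?P = "\<forall>c\<in>{1..m} - {a}. I c = J c"
  let ?g = "\<lambda>i j. uea_gen (Ext 0 (loop_elt (so_gen i j) (-1)) :: 'n orth ext)"
  have "F_op m (-1) a I J = (\<Sum>i=1..CARD('n). \<Sum>j=1..CARD('n).
      if j = J a then (if i = I a then (if ?P then ?g (I a) (J a) else 0) else 0) else 0)"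
    unfolding F_op_def op_tensor_def simple_tensor_one_place[OF a]
    by (intro sum.cong refl) (simp add: matrix_unit_def)
  also have "\<dots> = (if ?P then ?g (I a) (J a) else 0)"
    using multi_index_range[OF I a] multi_index_range[OF J a]
    by (simp only: sum.delta finite_atLeastAtMost if_True)
  finally have F: "F_op m (-1) a I J = (if ?P then ?g (I a) (J a) else 0)" .
  have eq: "I = J \<longleftrightarrow> ?P \<and> I a = J a"
  proof
    assume "?P \<and> I a = J a"
    then show "I = J" by (intro multi_index_eqI[OF I J]) blast
  qed simp
  show ?thesis
    unfolding T_plus_F_def F op_tensor_def op_one_def eq shifted_gen_def uea_gen_add
    by (simp add: uea_gen_zero)
qed

text \<open>Each factor acts in its own tensor position, so only one intermediate multi-index contributes and
  the positions outside of the list stay unchanged.\<close>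

lemma foldr_T_plus_F:
  assumes "distinct as" "set as \<subseteq> {1..m}" "I \<in> multi_indices CARD('n) m" "J \<in> multi_indices CARD('n) m"
  shows "foldr (\<lambda>a. op_mult CARD('n) m (T_plus_F m a)) as op_one I J =
    (if \<forall>c\<in>{1..m} - set as. I c = J c
     then prod_list (map (\<lambda>a. uea_gen (shifted_gen (I a) (J a) :: 'n::finite orth ext)) as) else 0)"
  using assms
proof (induction as arbitrary: I)
  case Nil
  have "I = J \<longleftrightarrow> (\<forall>c\<in>{1..m}. I c = J c)"
    using multi_index_eqI[OF Nil(3,4)] by auto
  then show ?case by (simp add: op_one_def)
next
  case (Cons a as)
  note I = Cons.prems(3) and J = Cons.prems(4)
  have a: "a \<in> {1..m}" "a \<notin> set as" "distinct as" "set as \<subseteq> {1..m}" using Cons.prems by simp_all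
  let ?y = "\<lambda>i j. uea_gen (shifted_gen i j :: 'n orth ext)"
  let ?rest = "\<lambda>K. foldr (\<lambda>a. op_mult CARD('n) m (T_plus_F m a)) as op_one K J :: 'n orth ext uea"
  \<comment> \<open>after the first factor only position \<open>a\<close> has changed, and no later factor acts there\<close>
  define K0 where "K0 = I(a := J a)"
  have K0: "K0 \<in> multi_indices CARD('n) m"
    using I a(1) multi_index_range[OF J a(1)] by (auto simp: K0_def multi_indices_def PiE_iff extensional_def)
  let ?C = "\<forall>c\<in>{1..m} - set (a # as). I c = J c"
  have "T_plus_F m a I K * ?rest K =
      (if K = K0 then if ?C then ?y (I a) (J a) * prod_list (map (\<lambda>a. ?y (I a) (J a)) as) else 0 else 0)"
    if K: "K \<in> multi_indices CARD('n) m" for K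
  proof (cases "(\<forall>c\<in>{1..m} - {a}. I c = K c) \<and> (\<forall>c\<in>{1..m} - set as. K c = J c)")
    case True
    have KK0: "K = K0"
    proof (rule multi_index_eqI[OF K K0])
      fix c assume c: "c \<in> {1..m}"
      show "K c = K0 c"
      proof (cases "c = a")
        case True
        have "K a = J a" using \<open>_ \<and> _\<close> a(1,2) by blast
        then show ?thesis by (simp add: K0_def True)
      next
        case False
        then have "I c = K c" using \<open>_ \<and> _\<close> c by blast
        then show ?thesis using False by (simp add: K0_def)
      qed
    qed
    have C: ?C
    proof
      fix c assume "c \<in> {1..m} - set (a # as)"
      then have "I c = K c" "K c = J c" using True by auto
      then show "I c = J c" by simp
    qed
    have "K a = J a" by (simp add: KK0 K0_def)
    then have "T_plus_F m a I K = ?y (I a) (J a)"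
      by (simp only: T_plus_F_entry[OF a(1) I K] if_P[OF conjunct1[OF True]])
    moreover have "map (\<lambda>a. ?y (K a) (J a)) as = map (\<lambda>a. ?y (I a) (J a)) as"
      using a(2) by (intro map_cong refl) (auto simp: KK0 K0_def)
    then have "?rest K = prod_list (map (\<lambda>a. ?y (I a) (J a)) as)"
      by (simp only: Cons.IH[OF a(3,4) K J] if_P[OF conjunct2[OF True]])
    ultimately show ?thesis by (simp only: if_P[OF KK0] if_P[OF C])
  next
    case False
    have "\<not> (K = K0 \<and> ?C)"
    proof
      assume KC: "K = K0 \<and> ?C"
      have "\<forall>c\<in>{1..m} - {a}. I c = K c" using KC by (simp add: K0_def)
      moreover have "\<forall>c\<in>{1..m} - set as. K c = J c"
      proof
        fix c assume "c \<in> {1..m} - set as"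
        then show "K c = J c" using KC by (cases "c = a") (simp_all add: K0_def)
      qed
      ultimately show False using False by blast
    qed
    then have R: "(if K = K0 then if ?C then z else 0 else 0) = 0" for z :: "'n orth ext uea"
      by auto
    have "T_plus_F m a I K = (0 :: 'n orth ext uea) \<or> ?rest K = 0"
      using False T_plus_F_entry[OF a(1) I K] Cons.IH[OF a(3,4) K J] by metis
    then show ?thesis unfolding R by (elim disjE) simp_all
  qed
  then have "foldr (\<lambda>a. op_mult CARD('n) m (T_plus_F m a)) (a # as) op_one I J =
      (\<Sum>K\<in>multi_indices CARD('n) m.
        if K = K0 then if ?C then ?y (I a) (J a) * prod_list (map (\<lambda>a. ?y (I a) (J a)) as) else 0 else 0)"
    by (simp only: foldr.simps comp_def op_mult_def cong: sum.cong)
  also have "\<dots> = (if ?C then ?y (I a) (J a) * prod_list (map (\<lambda>a. ?y (I a) (J a)) as) else 0)"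
    using K0 by (simp add: sum.delta)
  finally show ?case by simp
qed

lemma T_plus_F_product_entry:
  assumes "I \<in> multi_indices CARD('n) m" "J \<in> multi_indices CARD('n) m"
  shows "T_plus_F_product m I J =
    prod_list (map (\<lambda>a. uea_gen (shifted_gen (I a) (J a) :: 'n::finite orth ext)) [1..<m + 1])"
proof -
  have "set [1..<m + 1] = {1..m}" by auto
  then have all: "(\<forall>c\<in>{1..m} - set [1..<m + 1]. I c = J c) = True" and sub: "set [1..<m + 1] \<subseteq> {1..m}"
    by simp_all
  show ?thesis
    unfolding T_plus_F_product_def foldr_T_plus_F[OF distinct_upt sub assms] all by (rule if_P) (rule TrueI)
qed

definition symmetrizer_entry :: "nat \<Rightarrow> nat \<Rightarrow> (nat \<Rightarrow> nat) \<Rightarrow> (nat \<Rightarrow> nat) \<Rightarrow> complex" where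
  "symmetrizer_entry N m I J = (1 / fact m) *
    (\<Sum>r=0..m div 2. sym_coeff N m r * (\<Sum>d | d \<in> diagrams m \<and> top_horizontal d = r. diagram_op N d I J))"

lemma image_mset_label_dots:
  "image_mset (label I J) (mset_set (dots m)) =
    image_mset (Top \<circ> J) (mset_set {1..m}) + image_mset (Bottom \<circ> I) (mset_set {1..m})"
proof -
  have "mset_set (dots m) = mset_set (Top ` {1..m}) + mset_set (Bottom ` {1..m})"
    unfolding dots_def by (rule mset_set_Union) auto
  moreover have "mset_set (Top ` {1..m}) = image_mset Top (mset_set {1..m})"
    "mset_set (Bottom ` {1..m}) = image_mset Bottom (mset_set {1..m})"
    by (simp_all add: image_mset_mset_set inj_on_def)
  ultimately show ?thesis by (simp add: multiset.map_comp o_def)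
qed

text \<open>The entries are read off from the hafnian of a multiset of labels, which forgets the order of the positions.\<close>

lemma symmetrizer_entry_perm:
  assumes \<pi>: "\<pi> permutes {1..m}"
    and IJ: "I \<in> multi_indices N m" "J \<in> multi_indices N m"
      "I \<circ> \<pi> \<in> multi_indices N m" "J \<circ> \<pi> \<in> multi_indices N m"
  shows "symmetrizer_entry N m (I \<circ> \<pi>) (J \<circ> \<pi>) = symmetrizer_entry N m I J"
proof -
  have "image_mset \<pi> (mset_set {1..m}) = mset_set {1..m}"
    using permutes_inj_on[OF \<pi>] permutes_image[OF \<pi>] by (simp add: image_mset_mset_set)
  then have perm: "image_mset (f \<circ> \<pi>) (mset_set {1..m}) = image_mset f (mset_set {1..m})" for f :: "nat \<Rightarrow> dot"
    by (metis multiset.map_comp)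
  have "image_mset (label (I \<circ> \<pi>) (J \<circ> \<pi>)) (mset_set (dots m)) = image_mset (label I J) (mset_set (dots m))"
    unfolding image_mset_label_dots using perm[of "Top \<circ> J"] perm[of "Bottom \<circ> I"] by (simp only: comp_assoc)
  then have "(\<Sum>d | d \<in> diagrams m \<and> top_horizontal d = r. diagram_op N d (I \<circ> \<pi>) (J \<circ> \<pi>)) *\<^sub>C (1 :: complex) =
      (\<Sum>d | d \<in> diagrams m \<and> top_horizontal d = r. diagram_op N d I J) *\<^sub>C 1" for r
    unfolding wick_labels_nth[OF IJ(1,2), symmetric] wick_labels_nth[OF IJ(3,4), symmetric] by (simp only:)
  then show ?thesis unfolding symmetrizer_entry_def cscale_complex_def mult_1_right by (simp only:)
qed

lemma comp_perm_multi_index: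
  assumes \<pi>: "\<pi> permutes {1..m}" and I: "I \<in> multi_indices N m"
  shows "I \<circ> \<pi> \<in> multi_indices N m"
proof -
  have "(I \<circ> \<pi>) z \<in> {1..N}" if "z \<in> {1..m}" for z
  proof -
    have "\<pi> z \<in> {1..m}" using that permutes_in_image[OF \<pi>] by blast
    from multi_index_range[OF I this] show ?thesis by (simp only: comp_def)
  qed
  moreover have "(I \<circ> \<pi>) z = undefined" if "z \<notin> {1..m}" for z
  proof -
    have "\<pi> z = z" by (rule permutes_not_in[OF \<pi> that])
    moreover have "I z = undefined" using PiE_arb I that unfolding multi_indices_def by metis
    ultimately show ?thesis by simp
  qed
  ultimately show ?thesis by (simp add: multi_indices_def PiE_iff extensional_def)
qed

lemma sum_multi_indices_perm:
  assumes \<pi>: "\<pi> permutes {1..m}"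
  shows "(\<Sum>I\<in>multi_indices N m. g (I \<circ> \<pi>)) = (\<Sum>I\<in>multi_indices N m. g I)"
proof (rule sum.reindex_bij_witness[of _ "\<lambda>I. I \<circ> inv_into UNIV \<pi>" "\<lambda>I. I \<circ> \<pi>"])
  note inv = permutes_inv[OF \<pi>]
  fix I assume I: "I \<in> multi_indices N m"
  show "I \<circ> inv_into UNIV \<pi> \<in> multi_indices N m" "I \<circ> \<pi> \<in> multi_indices N m"
    by (rule comp_perm_multi_index[OF inv I], rule comp_perm_multi_index[OF \<pi> I])
  show "I \<circ> \<pi> \<circ> inv_into UNIV \<pi> = I" "I \<circ> inv_into UNIV \<pi> \<circ> \<pi> = I"
    using permutes_inv_o[OF \<pi>] by (simp_all add: comp_assoc)
qed simp

text \<open>Permuting the factors of the product amounts to permuting the positions in both multi-indices, which does not change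
  the entries of the symmetrizer. Hence each of the \<open>m!\<close> orders of the factors gives the same sum.\<close>

lemma sum_symmetrized:
  fixes y :: "nat \<Rightarrow> nat \<Rightarrow> 'a::complex_lie"
  shows "(\<Sum>I\<in>multi_indices N m. \<Sum>J\<in>multi_indices N m. symmetrizer_entry N m I J *\<^sub>C
      prod_list (map (\<lambda>a. uea_gen (y (J a) (I a))) [1..<m + 1])) =
    (\<Sum>I\<in>multi_indices N m. \<Sum>J\<in>multi_indices N m. symmetrizer_entry N m I J *\<^sub>C
      symmetrized_product (map (\<lambda>a. y (J a) (I a)) [1..<m + 1]))"
proof -
  let ?MI = "multi_indices N m" and ?S = "symmetrizer_entry N m"
  let ?p = "\<lambda>I J. prod_list (map (\<lambda>a. uea_gen (y (J a) (I a))) [1..<m + 1])"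
  let ?q = "\<lambda>\<sigma> I J. prod_list (map (\<lambda>k. uea_gen (map (\<lambda>a. y (J a) (I a)) [1..<m + 1] ! \<sigma> k)) [0..<m])"
  let ?Sm = "{\<sigma>. \<sigma> permutes {..<m}}"
  have perm: "(\<Sum>I\<in>?MI. \<Sum>J\<in>?MI. ?S I J *\<^sub>C ?q \<sigma> I J) = (\<Sum>I\<in>?MI. \<Sum>J\<in>?MI. ?S I J *\<^sub>C ?p I J)"
    if \<sigma>: "\<sigma> permutes {..<m}" for \<sigma>
  proof -
    \<comment> \<open>positions are counted from 1, the entries of a list from 0\<close>
    define \<pi> where "\<pi> a = (if a \<in> {1..m} then Suc (\<sigma> (a - 1)) else a)" for a
    have \<sigma>_less: "\<sigma> k < m" if "k < m" for k using permutes_in_image[OF \<sigma>, of k] that by simp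
    have \<pi>: "\<pi> permutes {1..m}"
    proof (rule bij_imp_permutes)
      have inj: "inj_on \<pi> {1..m}"
      proof (rule inj_onI)
        fix a b assume "a \<in> {1..m}" "b \<in> {1..m}" "\<pi> a = \<pi> b"
        then have "\<sigma> (a - 1) = \<sigma> (b - 1)" by (simp add: \<pi>_def)
        then have "a - 1 = b - 1" using permutes_inj[OF \<sigma>] by (metis injD)
        then show "a = b" using \<open>a \<in> {1..m}\<close> \<open>b \<in> {1..m}\<close> by auto
      qed
      have sub: "\<pi> ` {1..m} \<subseteq> {1..m}"
      proof
        fix z assume "z \<in> \<pi> ` {1..m}"
        then obtain a where a: "a \<in> {1..m}" "z = Suc (\<sigma> (a - 1))" by (auto simp: \<pi>_def)
        have "\<sigma> (a - 1) < m" by (rule \<sigma>_less) (use a(1) in auto)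
        then show "z \<in> {1..m}" using a(2) by simp
      qed
      have "\<pi> ` {1..m} = {1..m}"
        by (rule endo_inj_surj[OF finite_atLeastAtMost sub inj])
      with inj show "bij_betw \<pi> {1..m} {1..m}" by (simp add: bij_betw_def)
      show "\<pi> a = a" if "a \<notin> {1..m}" for a
        unfolding \<pi>_def by (rule if_not_P[OF that])
    qed
    have q: "?q \<sigma> I J = ?p (I \<circ> \<pi>) (J \<circ> \<pi>)" for I J
    proof -
      have "map (\<lambda>k. uea_gen (map (\<lambda>a. y (J a) (I a)) [1..<m + 1] ! \<sigma> k)) [0..<m] =
          map (\<lambda>a. uea_gen (y ((J \<circ> \<pi>) a) ((I \<circ> \<pi>) a))) [1..<m + 1]"
      proof (rule nth_equalityI)
        fix k assume "k < length (map (\<lambda>k. uea_gen (map (\<lambda>a. y (J a) (I a)) [1..<m + 1] ! \<sigma> k)) [0..<m])"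
        then have k: "k < m" by simp
        have "[1..<m + 1] ! \<sigma> k = Suc (\<sigma> k)" "[1..<m + 1] ! k = Suc k"
          using k \<sigma>_less[OF k] by (simp_all add: nth_upt del: upt_Suc)
        moreover have "\<pi> (Suc k) = Suc (\<sigma> k)" using k by (simp add: \<pi>_def)
        ultimately show "map (\<lambda>k. uea_gen (map (\<lambda>a. y (J a) (I a)) [1..<m + 1] ! \<sigma> k)) [0..<m] ! k =
            map (\<lambda>a. uea_gen (y ((J \<circ> \<pi>) a) ((I \<circ> \<pi>) a))) [1..<m + 1] ! k"
          using k \<sigma>_less[OF k] by (simp del: upt_Suc)
      qed simp
      then show ?thesis by (simp only:)
    qed
    have "(\<Sum>I\<in>?MI. \<Sum>J\<in>?MI. ?S I J *\<^sub>C ?q \<sigma> I J) =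
        (\<Sum>I\<in>?MI. \<Sum>J\<in>?MI. ?S (I \<circ> \<pi>) (J \<circ> \<pi>) *\<^sub>C ?p (I \<circ> \<pi>) (J \<circ> \<pi>))"
      by (intro sum.cong refl)
        (simp only: q symmetrizer_entry_perm[OF \<pi>] comp_perm_multi_index[OF \<pi>])
    also have "\<dots> = (\<Sum>I\<in>?MI. \<Sum>J\<in>?MI. ?S I (J \<circ> \<pi>) *\<^sub>C ?p I (J \<circ> \<pi>))"
      by (rule sum_multi_indices_perm[OF \<pi>, of "\<lambda>I. \<Sum>J\<in>?MI. ?S I (J \<circ> \<pi>) *\<^sub>C ?p I (J \<circ> \<pi>)"])
    also have "\<dots> = (\<Sum>I\<in>?MI. \<Sum>J\<in>?MI. ?S I J *\<^sub>C ?p I J)"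
    proof (rule sum.cong[OF refl])
      fix I
      show "(\<Sum>J\<in>?MI. ?S I (J \<circ> \<pi>) *\<^sub>C ?p I (J \<circ> \<pi>)) = (\<Sum>J\<in>?MI. ?S I J *\<^sub>C ?p I J)"
        by (rule sum_multi_indices_perm[OF \<pi>, of "\<lambda>J. ?S I J *\<^sub>C ?p I J"])
    qed
    finally show ?thesis .
  qed
  have sp: "symmetrized_product (map (\<lambda>a. y (J a) (I a)) [1..<m + 1]) = (1 / fact m) *\<^sub>C (\<Sum>\<sigma>\<in>?Sm. ?q \<sigma> I J)" for I J
    by (simp add: symmetrized_product_def del: upt_Suc)
  have "(\<Sum>I\<in>?MI. \<Sum>J\<in>?MI. ?S I J *\<^sub>C symmetrized_product (map (\<lambda>a. y (J a) (I a)) [1..<m + 1])) =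
      (\<Sum>I\<in>?MI. \<Sum>J\<in>?MI. \<Sum>\<sigma>\<in>?Sm. (1 / fact m) *\<^sub>C ?S I J *\<^sub>C ?q \<sigma> I J)"
    unfolding sp cscale_sum_right
    by (intro sum.cong refl) (rule cscale_left_commute)
  also have "\<dots> = (\<Sum>\<sigma>\<in>?Sm. (1 / fact m) *\<^sub>C (\<Sum>I\<in>?MI. \<Sum>J\<in>?MI. ?S I J *\<^sub>C ?q \<sigma> I J))"
    unfolding cscale_sum_right
    by (subst (2) sum.swap, subst sum.swap) (rule refl)
  also have "\<dots> = (\<Sum>\<sigma>\<in>?Sm. (1 / fact m) *\<^sub>C (\<Sum>I\<in>?MI. \<Sum>J\<in>?MI. ?S I J *\<^sub>C ?p I J))"
    by (rule sum.cong[OF refl]) (simp only: perm mem_Collect_eq)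
  also have "\<dots> = (\<Sum>I\<in>?MI. \<Sum>J\<in>?MI. ?S I J *\<^sub>C ?p I J)"
  proof -
    have "card ?Sm = fact m" by (rule card_permutations) simp_all
    then have "of_nat (card ?Sm) * (1 / fact m) = (1 :: complex)" by simp
    then show ?thesis
      by (simp only: sum_constant of_nat_mult_cscale[where 'a = "'a uea"] cscale_cscale cscale_one)
  qed
  finally show ?thesis by (rule sym)
qed

lemma prod_single:
  "(\<Prod>a\<in>S. Poly_Mapping.single (M a) (c a)) =
    Poly_Mapping.single (\<Sum>a\<in>S. M a) (\<Prod>a\<in>S. c a :: 'a::comm_ring_1)"
  by (induction S rule: infinite_finite_induct) (simp_all add: mult_single)

lemma mixed_form_power:
  "mixed_form N A ^ m = (\<Sum>J\<in>multi_indices N m. \<Sum>I\<in>multi_indices N m.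
    Poly_Mapping.single (image_mset (label I J) (mset_set (dots m))) (\<Prod>a=1..m. A (J a) (I a)))"
proof -
  have "mixed_form N A ^ m = (\<Prod>a=1..m. \<Sum>j=1..N. \<Sum>i=1..N. Poly_Mapping.single {#Top j, Bottom i#} (A j i))"
    by (simp add: mixed_form_def const_def var_def mult_single add_mset_commute)
  also have "\<dots> = (\<Sum>J\<in>multi_indices N m. \<Prod>a=1..m. \<Sum>i=1..N. Poly_Mapping.single {#Top (J a), Bottom i#} (A (J a) i))"
    unfolding multi_indices_def by (rule prod_sum_PiE) simp_all
  also have "\<dots> = (\<Sum>J\<in>multi_indices N m. \<Sum>I\<in>multi_indices N m. \<Prod>a=1..m.
      Poly_Mapping.single {#Top (J a), Bottom (I a)#} (A (J a) (I a)))"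
    unfolding multi_indices_def by (intro sum.cong refl prod_sum_PiE) simp_all
  also have "\<dots> = (\<Sum>J\<in>multi_indices N m. \<Sum>I\<in>multi_indices N m.
    Poly_Mapping.single (image_mset (label I J) (mset_set (dots m))) (\<Prod>a=1..m. A (J a) (I a)))"
  proof (intro sum.cong refl)
    fix I J :: "nat \<Rightarrow> nat"
    have "(\<Sum>a\<in>S. {#Top (J a), Bottom (I a)#}) = image_mset (Top \<circ> J) (mset_set S) + image_mset (Bottom \<circ> I) (mset_set S)"
      if "finite S" for S
      using that by (induction S) simp_all
    then show "(\<Prod>a=1..m. Poly_Mapping.single {#Top (J a), Bottom (I a)#} (A (J a) (I a))) =
        Poly_Mapping.single (image_mset (label I J) (mset_set (dots m))) (\<Prod>a=1..m. A (J a) (I a))"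
      by (simp only: prod_single image_mset_label_dots finite_atLeastAtMost)
  qed
  finally show ?thesis .
qed

text \<open>Expanding \<open>q\<^sub>A\<^sup>m\<close> into monomials, the label multiset of a monomial records the row and the column
  multi-index.\<close>

lemma normalized_value_expect_mixed_form_power:
  fixes A :: "nat \<Rightarrow> nat \<Rightarrow> 'a::{complex_algebra, comm_ring_1}"
  shows "normalized_value N m (expect N (mixed_form N A ^ m)) =
    gamma_factor m (of_nat N) *\<^sub>C (\<Sum>I\<in>multi_indices N m. \<Sum>J\<in>multi_indices N m.
      symmetrizer_entry N m I J *\<^sub>C (\<Prod>a=1..m. A (J a) (I a)))"
proof -
  have entry: "normalized_value N m (wick (form_weight N) (image_mset (label I J) (mset_set (dots m)))) =
      (gamma_factor m (of_nat N) * symmetrizer_entry N m I J) *\<^sub>C (1 :: 'a)"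
    if "I \<in> multi_indices N m" "J \<in> multi_indices N m" for I J
    unfolding normalized_value_def wick_labels_nth[OF that] symmetrizer_entry_def
    by (simp only: cscale_cscale cscale_sum_left[symmetric]) simp
  have "normalized_value N m (expect N (mixed_form N A ^ m)) =
      (\<Sum>J\<in>multi_indices N m. \<Sum>I\<in>multi_indices N m. (\<Prod>a=1..m. A (J a) (I a)) *
        normalized_value N m (wick (form_weight N) (image_mset (label I J) (mset_set (dots m)))))"
    unfolding mixed_form_power gaussian_sum gaussian_single normalized_value_sum normalized_value_const_mult ..
  also have "\<dots> = (\<Sum>J\<in>multi_indices N m. \<Sum>I\<in>multi_indices N m.
      gamma_factor m (of_nat N) *\<^sub>C symmetrizer_entry N m I J *\<^sub>C (\<Prod>a=1..m. A (J a) (I a)))"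
    by (intro sum.cong refl) (simp only: entry cscale_mult_right mult_1_right cscale_cscale)
  also have "\<dots> = (\<Sum>I\<in>multi_indices N m. \<Sum>J\<in>multi_indices N m.
      gamma_factor m (of_nat N) *\<^sub>C symmetrizer_entry N m I J *\<^sub>C (\<Prod>a=1..m. A (J a) (I a)))"
    by (rule sum.swap)
  finally show ?thesis by (simp only: cscale_sum_right)
qed

section \<open>The elements \<open>\<Phi>\<^sub>k\<close> and the Segal--Sugawara vectors\<close>

lemma sym_shift_hom:
  "sym_shift (u + v) = sym_shift u + sym_shift v"
  "sym_shift (u * v) = sym_shift u * sym_shift v"
  "sym_shift (sym_gen X) = sym_gen (loop_elt X (-1))"
  "sym_shift 1 = 1" "sym_shift 0 = 0"
proof -
  show "sym_shift (u + v) = sym_shift u + sym_shift v"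
    by transfer (rule linext_add)
  show "sym_shift (u * v) = sym_shift u * sym_shift v"
    by transfer (rule linext_mult, simp)
  show "sym_shift (sym_gen X) = sym_gen (loop_elt X (-1))"
    using sym_shift_prod_list[of "[X]"] by simp
  show "sym_shift 1 = 1"
    using sym_shift_prod_list[of "[]"] by simp
  show "sym_shift 0 = 0"
    by transfer simp
qed

lemma sym_incl_hom:
  "sym_incl (u + v) = sym_incl u + sym_incl v"
  "sym_incl (u * v) = sym_incl u * sym_incl v"
  "sym_incl (sym_gen X) = sym_gen (Ext 0 X)"
  "sym_incl 1 = 1" "sym_incl 0 = 0"
proof -
  show "sym_incl (u + v) = sym_incl u + sym_incl v"
    by transfer (rule linext_add)
  show "sym_incl (u * v) = sym_incl u * sym_incl v"
    by transfer (rule linext_mult, simp)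
  show "sym_incl (sym_gen X) = sym_gen (Ext 0 X)"
    using sym_incl_prod_list[of "[X]"] by simp
  show "sym_incl 1 = 1"
    using sym_incl_prod_list[of "[]"] by simp
  show "sym_incl 0 = 0"
    by transfer simp
qed

text \<open>The homomorphism \<open>X \<mapsto> X[-1]\<close> into the symmetric algebra of \<open>\<complex>T \<oplus> t\<^sup>-\<^sup>1\<gg>[t\<^sup>-\<^sup>1]\<close>; it carries Newton's identity
  for the elements \<open>\<Phi>\<^sub>k\<close> to this algebra.\<close>

definition lowered :: "'g::complex_lie sym \<Rightarrow> 'g ext sym" where
  "lowered u = sym_incl (sym_shift u)"

lemma lowered_hom:
  "lowered (u + v) = lowered u + lowered v" "lowered (u * v) = lowered u * lowered v"
  "lowered (sym_gen X) = sym_gen (Ext 0 (loop_elt X (-1)))" "lowered 1 = 1" "lowered 0 = 0"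
  by (simp_all add: lowered_def sym_shift_hom sym_incl_hom)

lemma lowered_sum: "lowered (\<Sum>i\<in>A. f i) = (\<Sum>i\<in>A. lowered (f i))"
  by (induction A rule: infinite_finite_induct) (simp_all add: lowered_hom)

lemma lowered_of_nat: "lowered (of_nat n) = of_nat n"
  by (induction n) (simp_all add: lowered_hom)

lemma lowered_mat_pow: "lowered (mat_pow N A k i j) = mat_pow N (\<lambda>i j. lowered (A i j)) k i j"
  by (induction k arbitrary: i j) (simp_all add: lowered_hom mat_prod_def lowered_sum)

lemma lowered_mat_trace:
  "lowered (mat_trace N (mat_pow N A k)) = mat_trace N (mat_pow N (\<lambda>i j. lowered (A i j)) k)"
  by (simp add: mat_trace_def lowered_sum lowered_mat_pow)

definition F_gen :: "nat \<Rightarrow> nat \<Rightarrow> 'n::finite orth ext sym" where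
  "F_gen i j = sym_gen (Ext 0 (loop_elt (so_gen i j) (-1)))"

lemma so_gen_reflect:
  assumes "i \<in> {1..CARD('n)}" "j \<in> {1..CARD('n)}"
  shows "(so_gen (reflect CARD('n) j) (reflect CARD('n) i) :: 'n::finite orth) = - so_gen i j"
proof -
  have "so_matrix CARD('n) (reflect CARD('n) j) (reflect CARD('n) i) k l = - so_matrix CARD('n) i j k l" for k l
    using assms by (simp only: so_matrix_def reflect_reflect minus_diff_eq)
  moreover have "reflect CARD('n) j \<in> {1..CARD('n)}" "reflect CARD('n) i \<in> {1..CARD('n)}"
    using assms reflect_in by blast+
  ultimately show ?thesis
    using assms by (transfer) (simp add: fun_eq_iff)
qed

lemma F_gen_skew:
  assumes "i \<in> {1..CARD('n)}" "j \<in> {1..CARD('n)}"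
  shows "(F_gen (reflect CARD('n) j) (reflect CARD('n) i) :: 'n::finite orth ext sym) = - F_gen i j"
proof -
  have "Ext 0 (loop_elt (- X) (-1)) = - Ext 0 (loop_elt X (-1))" for X :: "'n orth"
    using loop_elt_cscale[of "-1" X "-1"] by (simp add: uminus_ext_def)
  then show ?thesis
    by (simp add: F_gen_def so_gen_reflect[OF assms] sym_gen_uminus)
qed

lemma Phi_newton:
  defines "h \<equiv> \<lambda>k. lowered (Phi k :: 'n::finite orth sym)"
  shows "h 0 = 1"
    and "of_nat (2 * n + 2) * h (2 * n + 2) =
      (\<Sum>j\<le>n. mat_trace CARD('n) (mat_pow CARD('n) F_gen (2 * j + 2)) * h (2 * (n - j)))"
proof -
  let ?N = "CARD('n)" and ?F = "\<lambda>i j. sym_gen (so_gen i j :: 'n orth)"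
  have Phi: "Phi k = fps_nth (fps_right_inverse (det (char_mat ?N ?F)) 1) k" for k
    by (simp add: Phi_def so_charpoly_def char_mat_def)
  have F: "(\<lambda>i j. lowered (?F i j)) = F_gen"
    by (intro ext) (simp add: lowered_hom F_gen_def)
  show "h 0 = 1" by (simp add: h_def Phi newton_identity(1) lowered_hom)
  let ?t = "\<lambda>k. mat_trace ?N (mat_pow ?N F_gen k) :: 'n orth ext sym"
  have odd: "?t k = 0" if "odd k" for k
    by (rule mat_trace_odd_power) (rule F_gen_skew, assumption+, rule that)
  have "of_nat (Suc k) * h (Suc k) = (\<Sum>i=0..k. h i * ?t (Suc (k - i)))" for k
    using arg_cong[OF newton_identity(2)[where F = ?F and N = ?N and k = k], of lowered]
    unfolding Phi[symmetric] lowered_hom(2) lowered_sum lowered_of_nat lowered_mat_trace F h_def .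
  from this[of "2 * n + 1"] have "of_nat (2 * n + 2) * h (2 * n + 2) =
      (\<Sum>i=0..2 * n + 1. h i * ?t (Suc (2 * n + 1 - i)))"
    by (simp only: Suc_eq_plus1 add.assoc one_add_one)
  \<comment> \<open>for odd \<open>i\<close> the exponent \<open>2n + 2 - i\<close> is odd and the trace vanishes\<close>
  also have "\<dots> = (\<Sum>i\<in>{i \<in> {0..2 * n + 1}. even i}. h i * ?t (Suc (2 * n + 1 - i)))"
    by (rule sum.mono_neutral_right) (auto simp: odd simp del: mat_pow.simps)
  also have "\<dots> = (\<Sum>j\<le>n. ?t (2 * j + 2) * h (2 * (n - j)))"
  proof (rule sum.reindex_bij_witness[of _ "\<lambda>j. 2 * (n - j)" "\<lambda>i. n - i div 2"])
    fix i assume i: "i \<in> {i \<in> {0..2 * n + 1}. even i}"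
    then obtain k where k: "i = 2 * k" by auto
    then have "k \<le> n" using i by simp
    then have "Suc (2 * n + 1 - i) = 2 * (n - i div 2) + 2" "2 * (n - (n - i div 2)) = i" using k by simp_all
    then show "?t (2 * (n - i div 2) + 2) * h (2 * (n - (n - i div 2))) = h i * ?t (Suc (2 * n + 1 - i))"
      by (simp only: mult.commute)
    show "2 * (n - (n - i div 2)) = i" "n - i div 2 \<in> {..n}" using k \<open>k \<le> n\<close> by simp_all
  qed auto
  finally show "of_nat (2 * n + 2) * h (2 * n + 2) =
      (\<Sum>j\<le>n. ?t (2 * j + 2) * h (2 * (n - j)))" .
qed

lemma mixed_form_shifted_gen:
  "mixed_form CARD('n) (\<lambda>j i. sym_gen (shifted_gen j i :: 'n::finite orth ext)) =
    const (sym_gen T_ext) * identity_form CARD('n) + mixed_form CARD('n) F_gen"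
proof -
  have "const (sym_gen (shifted_gen j i :: 'n orth ext)) * v =
      const (sym_gen T_ext) * (const (if j = i then 1 else 0) * v) + const (F_gen j i) * v"
    for j i and v :: "dot multiset \<Rightarrow>\<^sub>0 'n orth ext sym"
    by (simp add: shifted_gen_def F_gen_def sym_gen_add sym_gen_zero const_add distrib_right)
  then show ?thesis
    by (simp only: identity_form_eq mixed_form_def sum.distrib sum_distrib_left)
qed

theorem proposition2p8:
  fixes m :: nat and \<rho> :: "brauer \<Rightarrow> complex tensor_op"
  assumes "brauer_action CARD('n::finite) m \<rho>"
    and "m \<ge> 1"
  shows "(segal_sugawara \<rho> m :: 'n orth loop uea) =
    (\<Sum>l=1..m div 2. of_nat ((CARD('n) + m - 2) choose (m - 2 * l)) *
       apply_to_one (symmetrization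
         (sym_gen T_ext ^ (m - 2 * l) * sym_incl (sym_shift (Phi (2 * l))))))"
proof -
  let ?N = "CARD('n)" and ?MI = "multi_indices CARD('n) m"
  let ?S = "symmetrizer_entry ?N m" and ?y = "shifted_gen :: nat \<Rightarrow> nat \<Rightarrow> 'n orth ext"
  let ?T = "sym_gen (T_ext :: 'n orth ext)"
  let ?h = "\<lambda>k. lowered (Phi k :: 'n orth sym)"
  have entry: "\<rho> (symmetrizer (of_nat ?N) m) I J = ?S I J" if "I \<in> ?MI" "J \<in> ?MI" for I J
    unfolding symmetrizer_entry_def by (rule brauer_action_symmetrizer[OF assms(1) that])
  have list: "(\<Prod>a=1..m. sym_gen (?y (J a) (I a))) = prod_list (map sym_gen (map (\<lambda>a. ?y (J a) (I a)) [1..<m + 1]))" for I J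
  proof -
    have "{1..m} = set [1..<m + 1]" by auto
    then show ?thesis by (simp only: prod.distinct_set_conv_list[OF distinct_upt] map_map comp_def)
  qed
  have "op_trace ?N m (op_mult ?N m (op_tensor (\<rho> (symmetrizer (of_nat ?N) m)) 1) (T_plus_F_product m)) =
      (\<Sum>I\<in>?MI. \<Sum>J\<in>?MI. ?S I J *\<^sub>C prod_list (map (\<lambda>a. uea_gen (?y (J a) (I a))) [1..<m + 1]))"
    unfolding op_trace_def op_mult_def op_tensor_def
    by (intro sum.cong refl) (simp only: entry T_plus_F_product_entry cscale_mult_left mult_1_left)
  also have "\<dots> = symmetrization (\<Sum>I\<in>?MI. \<Sum>J\<in>?MI. ?S I J *\<^sub>C (\<Prod>a=1..m. sym_gen (?y (J a) (I a))))"
    unfolding sum_symmetrized by (simp only: symmetrization_sum symmetrization_linear list symmetrization_prod_list)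
  finally have trace: "op_trace ?N m (op_mult ?N m (op_tensor (\<rho> (symmetrizer (of_nat ?N) m)) 1) (T_plus_F_product m)) =
      symmetrization (\<Sum>I\<in>?MI. \<Sum>J\<in>?MI. ?S I J *\<^sub>C (\<Prod>a=1..m. sym_gen (?y (J a) (I a))))" .
  have "segal_sugawara \<rho> m = apply_to_one (symmetrization (gamma_factor m (of_nat ?N) *\<^sub>C
      (\<Sum>I\<in>?MI. \<Sum>J\<in>?MI. ?S I J *\<^sub>C (\<Prod>a=1..m. sym_gen (?y (J a) (I a))))))"
    by (simp only: segal_sugawara_def trace symmetrization_linear apply_to_one_linear)
  also have "\<dots> = apply_to_one (symmetrization (normalized_value ?N m
      (expect ?N ((const ?T * identity_form ?N + mixed_form ?N F_gen) ^ m))))"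
    by (simp only: normalized_value_expect_mixed_form_power[of ?N m "\<lambda>j i. sym_gen (?y j i)", symmetric]
        mixed_form_shifted_gen)
  finally have vector: "segal_sugawara \<rho> m = apply_to_one (symmetrization (normalized_value ?N m
      (expect ?N ((const ?T * identity_form ?N + mixed_form ?N F_gen) ^ m))))" .
  have "?N \<ge> 1" by (simp add: Suc_leI)
  then have "\<exists>c. normalized_value ?N m (expect ?N ((const ?T * identity_form ?N + mixed_form ?N F_gen) ^ m)) =
      c *\<^sub>C ?T ^ m + (\<Sum>l=1..m div 2. of_nat ((?N + m - 2) choose (m - 2 * l)) * (?T ^ (m - 2 * l) * ?h (2 * l)))"
    by (rule normalized_value_shifted_power) (rule F_gen_skew, assumption+, rule Phi_newton, rule Phi_newton, rule assms(2))
  then obtain c where value_eq: "normalized_value ?N m (expect ?N ((const ?T * identity_form ?N + mixed_form ?N F_gen) ^ m)) =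
      c *\<^sub>C ?T ^ m + (\<Sum>l=1..m div 2. of_nat ((?N + m - 2) choose (m - 2 * l)) * (?T ^ (m - 2 * l) * ?h (2 * l)))"
    by blast
  show ?thesis
    unfolding vector value_eq of_nat_mult_cscale
    by (simp only: symmetrization_linear symmetrization_sum apply_to_one_linear apply_to_one_sum
        apply_to_one_symmetrization_T_power[OF assms(2)] cscale_zero_right add_0_left lowered_def)
qed

end
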